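(* Let $G$ be a locally compact abelian group with compact open subgroup $H\subseteq G$, let $\mathcal{D}\subseteq\widehat{G}$ be a set of coset representatives in $\widehat{G}$ for $\widehat{G}/H^{\perp}$, let $A_1\in\operatorname{Aut}G$ be an automorphism that is expansive with respect to $H$, and set $N=|A_1|-1\ge1$. Denote by $\{\sigma_j: j=1,\ldots,N\}$ the $N$ elements of $\mathcal{D}\cap[(A_1^{*}H^{\perp})\setminus H^{\perp}]$, write $\Omega_j=\sigma_j+H^{\perp}$ for $j=1,\ldots,N$, and define $\psi_j\in L^2(G)$ by $\widehat{\psi}_j=\mathbf{1}_{\Omega_j}$. Then $\{\psi_1,\ldots,\psi_N\}$ is a set of wavelet generators for $L^2(G)$ with respect to $\mathcal{D}$ and $\mathcal{A}=\{A_1^n:n\in\mathbb{Z}\}$, and, for all $j=1,\ldots,N$ and $x\in G$, $$\psi_j(x)=(x,\sigma_j)\mathbf{1}_H(x).$$ Moreover, $\psi_j$ is constant on every open set of the form $c+A_1^{-1}H$, $c\in G$.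
   Context: Notation. $\widehat{G}$ is the dual group of $G$ and $(x,\gamma)$ denotes the duality pairing. $H^{\perp}=\{\gamma\in\widehat{G}: (x,\gamma)=1 \text{ for all } x\in H\}$, a compact open subgroup of $\widehat{G}$. $\mu$ and $\nu$ are the Haar measures on $G$ and $\widehat{G}$ normalized by $\mu(H)=1$, $\nu(H^{\perp})=1$; the Fourier transform $\hat f(\gamma)=\int_G f(x)\overline{(x,\gamma)}\,d\mu(x)$ extends to an isometry of $L^2(G)$ onto $L^2(\widehat{G})$. As a pointwise defined function, $\psi_j$ is given by $\psi_j(x)=\int_{\widehat{G}}\mathbf{1}_{\Omega_j}(\gamma)(x,\gamma)\,d\nu(\gamma)$. $\operatorname{Aut}G$ is the group of homeomorphic automorphisms of $G$. For $A\in\operatorname{Aut}G$, the modulus $|A|>0$ is defined by $\mu(AU)=|A|\mu(U)$ for measurable $U$, and the adjoint $A^{*}\in\operatorname{Aut}\widehat{G}$ by $(Ax,\gamma)=(x,A^{*}\gamma)$. For $s\in G$, $[s]=s+H\in G/H$. Expansiveness. $A\in\operatorname{Aut}G$ is expansive with respect to $H$ if $H\subsetneq AH$ and $\bigcap_{n\le0}A^nH=\{0\}$. In that case $|A|$ is an integer $\geq 2$. Translations and dilations. A set of coset representatives $\mathcal{D}$ contains exactly one element of each coset of $H^{\perp}$ in $\widehat{G}$. For $\gamma\in\widehat{G}$, $\theta(\gamma)$ is the unique element of $\mathcal{D}\cap(\gamma+H^{\perp})$, and $\eta(\gamma)=\gamma-\theta(\gamma)\in H^{\perp}$. For $[s]\in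 G/H$ let $w_{[s]}(\gamma)=\overline{(s,\eta(\gamma))}$ (this depends only on $[s]$ and $\mathcal{D}$). The operator $\tau_{[s]}=\tau_{[s],\mathcal{D}}$ on $L^2(G)$ is defined by $\widehat{\tau_{[s]}f}=\hat f\,w_{[s]}$. For $A\in\operatorname{Aut}G$, $\delta_Af(x)=|A|^{1/2}f(Ax)$. Wavelets. For $\psi_1,\ldots,\psi_N\in L^2(G)$ put $\psi_{j,A,[s]}=\delta_A\tau_{[s]}\psi_j$. $\{\psi_1,\ldots,\psi_N\}$ is a set of wavelet generators for $L^2(G)$ with respect to $\mathcal{D}$ and a countable nonempty set $\mathcal{A}\subseteq\operatorname{Aut}G$ if the family $\{\psi_{j,A,[s]}:1\le j\le N,\ A\in\mathcal{A},\ [s]\in G/H\}$ is an orthonormal basis of $L^2(G)$. *)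

theory Defs
  imports "HOL-Analysis.Analysis"
begin

section \<open>The dual group\<close>

typedef (overloaded) ('g::topological_ab_group_add) dual =
  "{\<xi>. continuous_on UNIV (\<xi> :: 'g \<Rightarrow> complex) \<and> (\<forall>x. norm (\<xi> x) = 1) \<and> (\<forall>x y. \<xi> (x + y) = \<xi> x * \<xi> y)}"
  morphisms char_of Dual
  by (rule exI[of _ "\<lambda>_. 1"]) auto

definition pairing :: "'g::topological_ab_group_add \<Rightarrow> 'g dual \<Rightarrow> complex" where
  "pairing x \<gamma> = char_of \<gamma> x"

lemma continuous_pairing: "continuous_on UNIV (\<lambda>x. pairing x \<gamma>)"
  and norm_pairing [simp]: "norm (pairing x \<gamma>) = 1"
  and pairing_add_left: "pairing (x + y) \<gamma> = pairing x \<gamma> * pairing y \<gamma>"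
  using char_of[of \<gamma>] by (auto simp: pairing_def)

lemma pairing_nonzero [simp]: "pairing x \<gamma> \<noteq> 0"
  using norm_pairing[of x \<gamma>] by (metis norm_zero zero_neq_one)

lemma pairing_zero_left [simp]: "pairing 0 \<gamma> = 1"
  using pairing_add_left[of 0 0 \<gamma>] by simp

lemma dual_eqI: "(\<And>x. pairing x \<gamma> = pairing x \<gamma>') \<Longrightarrow> \<gamma> = \<gamma>'"
  by (metis char_of_inject ext pairing_def)

lemma pairing_Dual:
  assumes "continuous_on UNIV \<xi>" "\<And>x. norm (\<xi> x) = 1" "\<And>x y. \<xi> (x + y) = \<xi> x * \<xi> y"
  shows "pairing x (Dual \<xi>) = \<xi> x"
  using assms by (simp add: pairing_def Dual_inverse)

instantiation dual :: (topological_ab_group_add) ab_group_add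
begin

definition "0 = Dual (\<lambda>_. 1)"
definition "\<gamma> + \<gamma>' = Dual (\<lambda>x. pairing x \<gamma> * pairing x \<gamma>')"
definition "- \<gamma> = Dual (\<lambda>x. cnj (pairing x \<gamma>))"
definition "\<gamma> - \<gamma>' = \<gamma> + - (\<gamma>' :: 'a dual)"

lemma pairing_zero_right [simp]: "pairing x 0 = 1"
  unfolding zero_dual_def by (subst pairing_Dual) auto

lemma pairing_add_right: "pairing x (\<gamma> + \<gamma>') = pairing x \<gamma> * pairing x \<gamma>'"
  unfolding plus_dual_def
  by (subst pairing_Dual)
     (auto simp: norm_mult pairing_add_left intro!: continuous_on_mult continuous_pairing)

lemma pairing_uminus_right: "pairing x (- \<gamma>) = cnj (pairing x \<gamma>)"
  unfolding uminus_dual_def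
  by (subst pairing_Dual) (auto simp: pairing_add_left intro!: continuous_on_cnj continuous_pairing)

instance
proof
  fix a b c :: "'a dual"
  show "a + b + c = a + (b + c)" "a + b = b + a" "0 + a = a" "a - b = a + - b"
    by (auto intro!: dual_eqI simp: pairing_add_right minus_dual_def)
  show "- a + a = 0"
  proof (rule dual_eqI)
    fix x
    show "pairing x (- a + a) = pairing x 0"
      by (simp add: pairing_add_right pairing_uminus_right mult.commute[of "cnj _"]
            flip: complex_norm_square)
  qed
qed

end

definition unif_nbhd :: "'g::topological_ab_group_add dual \<Rightarrow> 'g set \<Rightarrow> real \<Rightarrow> 'g dual set" where
  "unif_nbhd \<gamma> K e = {\<gamma>'. \<forall>x\<in>K. norm (pairing x \<gamma>' - pairing x \<gamma>) < e}"

text \<open>The topology of uniform convergence on compact sets (equivalently, the compact-open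
  topology).\<close>

instantiation dual :: (topological_ab_group_add) topological_space
begin

definition open_dual :: "'a dual set \<Rightarrow> bool" where
  "open_dual U \<longleftrightarrow> (\<forall>\<gamma>\<in>U. \<exists>K e. compact K \<and> e > 0 \<and> unif_nbhd \<gamma> K e \<subseteq> U)"

instance
proof
  show "open (UNIV :: 'a dual set)"
    unfolding open_dual_def by (metis compact_empty subset_UNIV zero_less_one)
next
  fix S T :: "'a dual set"
  assume S: "open S" and T: "open T"
  show "open (S \<inter> T)"
    unfolding open_dual_def
  proof
    fix \<gamma> assume "\<gamma> \<in> S \<inter> T"
    then have "\<gamma> \<in> S" "\<gamma> \<in> T" by auto
    from S[unfolded open_dual_def, rule_format, OF this(1)]
    obtain K e where K: "compact K" "e > 0" "unif_nbhd \<gamma> K e \<subseteq> S"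
      by auto
    from T[unfolded open_dual_def, rule_format, OF \<open>\<gamma> \<in> T\<close>]
    obtain L d where L: "compact L" "d > 0" "unif_nbhd \<gamma> L d \<subseteq> T"
      by auto
    have "unif_nbhd \<gamma> (K \<union> L) (min e d) \<subseteq> S \<inter> T"
      using K(3) L(3) by (auto simp: unif_nbhd_def)
    with K L show "\<exists>K e. compact K \<and> e > 0 \<and> unif_nbhd \<gamma> K e \<subseteq> S \<inter> T"
      by (intro exI[of _ "K \<union> L"] exI[of _ "min e d"]) auto
  qed
next
  fix \<K> :: "'a dual set set"
  assume *: "\<forall>S\<in>\<K>. open S"
  show "open (\<Union>\<K>)"
    unfolding open_dual_def
  proof
    fix \<gamma> assume "\<gamma> \<in> \<Union>\<K>"
    then obtain S where S: "S \<in> \<K>" "\<gamma> \<in> S" by auto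
    from *[rule_format, OF S(1), unfolded open_dual_def, rule_format, OF S(2)]
    obtain K e where K: "compact K" "e > 0" "unif_nbhd \<gamma> K e \<subseteq> S"
      by auto
    with S(1) have "unif_nbhd \<gamma> K e \<subseteq> \<Union>\<K>" by auto
    with K show "\<exists>K e. compact K \<and> e > 0 \<and> unif_nbhd \<gamma> K e \<subseteq> \<Union>\<K>"
      by auto
  qed
qed

end

lemma open_unif_nbhd:
  assumes "compact K"
  shows "open (unif_nbhd \<gamma> K e)"
  unfolding open_dual_def
proof
  fix \<gamma>' assume g: "\<gamma>' \<in> unif_nbhd \<gamma> K e"
  show "\<exists>L d. compact L \<and> d > 0 \<and> unif_nbhd \<gamma>' L d \<subseteq> unif_nbhd \<gamma> K e"
  proof (cases "K = {}")
    case True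
    then show ?thesis
      by (intro exI[of _ "{}"] exI[of _ 1]) (auto simp: unif_nbhd_def)
  next
    case False
    have "continuous_on K (\<lambda>x. norm (pairing x \<gamma>' - pairing x \<gamma>))"
      by (intro continuous_intros continuous_on_subset[OF continuous_pairing]) auto
    from continuous_attains_sup[OF assms False this] obtain z where z: "z \<in> K"
      "\<And>x. x \<in> K \<Longrightarrow> norm (pairing x \<gamma>' - pairing x \<gamma>) \<le> norm (pairing z \<gamma>' - pairing z \<gamma>)"
      by blast
    define d where "d = e - norm (pairing z \<gamma>' - pairing z \<gamma>)"
    have "d > 0" using g z(1) by (auto simp: d_def unif_nbhd_def)
    moreover have "unif_nbhd \<gamma>' K d \<subseteq> unif_nbhd \<gamma> K e"
    proof
      fix \<xi> assume c: "\<xi> \<in> unif_nbhd \<gamma>' K d"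
      show "\<xi> \<in> unif_nbhd \<gamma> K e"
        unfolding unif_nbhd_def
      proof safe
        fix x assume x: "x \<in> K"
        have "norm (pairing x \<xi> - pairing x \<gamma>)
            \<le> norm (pairing x \<xi> - pairing x \<gamma>') + norm (pairing x \<gamma>' - pairing x \<gamma>)"
          using norm_triangle_ineq[of "pairing x \<xi> - pairing x \<gamma>'" "pairing x \<gamma>' - pairing x \<gamma>"]
          by simp
        also have "\<dots> < d + norm (pairing z \<gamma>' - pairing z \<gamma>)"
          using c x z(2)[OF x] by (intro add_less_le_mono) (auto simp: unif_nbhd_def)
        finally show "norm (pairing x \<xi> - pairing x \<gamma>) < e" by (simp add: d_def)
      qed
    qed
    ultimately show ?thesis using assms by blast
  qed
qed

lemma self_in_unif_nbhd: "e > 0 \<Longrightarrow> \<gamma> \<in> unif_nbhd \<gamma> K e"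
  by (simp add: unif_nbhd_def)

lemma filterlim_dual_iff:
  fixes f :: "'b \<Rightarrow> 'g::topological_ab_group_add dual"
  shows "(f \<longlongrightarrow> \<gamma>) F \<longleftrightarrow>
    (\<forall>K e. compact K \<longrightarrow> e > 0 \<longrightarrow> eventually (\<lambda>x. f x \<in> unif_nbhd \<gamma> K e) F)"
proof
  assume "(f \<longlongrightarrow> \<gamma>) F"
  then show "\<forall>K e. compact K \<longrightarrow> e > 0 \<longrightarrow> eventually (\<lambda>x. f x \<in> unif_nbhd \<gamma> K e) F"
    by (auto intro!: topological_tendstoD open_unif_nbhd self_in_unif_nbhd)
next
  assume R: "\<forall>K e. compact K \<longrightarrow> e > 0 \<longrightarrow> eventually (\<lambda>x. f x \<in> unif_nbhd \<gamma> K e) F"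
  show "(f \<longlongrightarrow> \<gamma>) F"
  proof (rule topological_tendstoI)
    fix S :: "'g dual set" assume S: "open S" "\<gamma> \<in> S"
    from S(1)[unfolded open_dual_def, rule_format, OF S(2)]
    obtain K e where K: "compact K" "e > 0" "unif_nbhd \<gamma> K e \<subseteq> S"
      by auto
    from R[rule_format, OF K(1,2)] have "eventually (\<lambda>x. f x \<in> unif_nbhd \<gamma> K e) F" .
    then show "eventually (\<lambda>x. f x \<in> S) F"
      using K(3) by (auto elim: eventually_mono)
  qed
qed

instance dual :: (topological_ab_group_add) topological_ab_group_add
proof
  fix a b :: "'a dual"
  show "((\<lambda>x. fst x + snd x) \<longlongrightarrow> a + b) (nhds a \<times>\<^sub>F nhds b)"
    unfolding filterlim_dual_iff
  proof (intro allI impI)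
    fix K :: "'a set" and e :: real
    assume K: "compact K" "e > 0"
    have "eventually (\<lambda>x. x \<in> unif_nbhd a K (e/2)) (nhds a)"
      "eventually (\<lambda>x. x \<in> unif_nbhd b K (e/2)) (nhds b)"
      using K by (auto intro!: eventually_nhds_in_open open_unif_nbhd self_in_unif_nbhd)
    then have "eventually (\<lambda>x. fst x \<in> unif_nbhd a K (e/2) \<and> snd x \<in> unif_nbhd b K (e/2))
        (nhds a \<times>\<^sub>F nhds b)"
      unfolding eventually_prod_filter by auto
    then show "eventually (\<lambda>x. fst x + snd x \<in> unif_nbhd (a + b) K e) (nhds a \<times>\<^sub>F nhds b)"
    proof (rule eventually_mono)
      fix x :: "'a dual \<times> 'a dual"
      assume x: "fst x \<in> unif_nbhd a K (e/2) \<and> snd x \<in> unif_nbhd b K (e/2)"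
      show "fst x + snd x \<in> unif_nbhd (a + b) K e"
        unfolding unif_nbhd_def
      proof safe
        fix y assume y: "y \<in> K"
        have "pairing y (fst x + snd x) - pairing y (a + b)
            = pairing y (fst x) * (pairing y (snd x) - pairing y b)
              + (pairing y (fst x) - pairing y a) * pairing y b"
          by (simp add: pairing_add_right algebra_simps)
        also have "norm \<dots> \<le> norm (pairing y (snd x) - pairing y b)
            + norm (pairing y (fst x) - pairing y a)"
          by (rule order_trans[OF norm_triangle_ineq]) (simp add: norm_mult)
        also have "\<dots> < e"
          using x y by (force simp: unif_nbhd_def)
        finally show "norm (pairing y (fst x + snd x) - pairing y (a + b)) < e" .
      qed
    qed
  qed
  show "(uminus \<longlongrightarrow> - a) (nhds a)"
    unfolding filterlim_dual_iff
  proof (intro allI impI)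
    fix K :: "'a set" and e :: real
    assume K: "compact K" "e > 0"
    have "eventually (\<lambda>x. x \<in> unif_nbhd a K e) (nhds a)"
      using K by (auto intro!: eventually_nhds_in_open open_unif_nbhd self_in_unif_nbhd)
    then show "eventually (\<lambda>x. - x \<in> unif_nbhd (- a) K e) (nhds a)"
      by (rule eventually_mono)
         (simp add: unif_nbhd_def pairing_uminus_right flip: complex_cnj_diff)
  qed
qed

instance dual :: (topological_ab_group_add) t2_space
proof
  fix a b :: "'a dual"
  assume "a \<noteq> b"
  then obtain x where x: "pairing x a \<noteq> pairing x b"
    using dual_eqI by blast
  define e where "e = norm (pairing x a - pairing x b) / 2"
  have e: "e > 0" using x by (simp add: e_def)
  have "unif_nbhd a {x} e \<inter> unif_nbhd b {x} e = {}"
  proof (rule ccontr)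
    assume "unif_nbhd a {x} e \<inter> unif_nbhd b {x} e \<noteq> {}"
    then obtain c where "norm (pairing x c - pairing x a) < e" "norm (pairing x c - pairing x b) < e"
      by (auto simp: unif_nbhd_def)
    moreover have "norm (pairing x a - pairing x b)
        \<le> norm (pairing x c - pairing x a) + norm (pairing x c - pairing x b)"
      using norm_triangle_ineq4[of "pairing x c - pairing x b" "pairing x c - pairing x a"]
      by simp
    ultimately show False by (simp add: e_def)
  qed
  then show "\<exists>U V. open U \<and> open V \<and> a \<in> U \<and> b \<in> V \<and> U \<inter> V = {}"
    using e by (intro exI[of _ "unif_nbhd a {x} e"] exI[of _ "unif_nbhd b {x} e"])
      (auto intro: open_unif_nbhd self_in_unif_nbhd)
qed


section \<open>Subgroups, annihilators, coset representatives\<close>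

definition add_subgroup :: "'g::ab_group_add set \<Rightarrow> bool" where
  "add_subgroup H \<longleftrightarrow> 0 \<in> H \<and> (\<forall>x\<in>H. \<forall>y\<in>H. x + y \<in> H) \<and> (\<forall>x\<in>H. - x \<in> H)"

definition coset :: "'g::ab_group_add \<Rightarrow> 'g set \<Rightarrow> 'g set" where
  "coset s H = (+) s ` H"

definition quotient_group :: "'g::ab_group_add set \<Rightarrow> 'g set set" where
  "quotient_group H = range (\<lambda>s. coset s H)"

definition annihilator :: "'g::topological_ab_group_add set \<Rightarrow> 'g dual set" where
  "annihilator H = {\<gamma>. \<forall>x\<in>H. pairing x \<gamma> = 1}"

definition coset_reps :: "'g::ab_group_add set \<Rightarrow> 'g set \<Rightarrow> bool" where
  "coset_reps D K \<longleftrightarrow> (\<forall>C\<in>quotient_group K. \<exists>!d. d \<in> D \<inter> C)"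

definition theta :: "'g::topological_ab_group_add set \<Rightarrow> 'g dual set \<Rightarrow> 'g dual \<Rightarrow> 'g dual" where
  "theta H D \<gamma> = (THE d. d \<in> D \<inter> coset \<gamma> (annihilator H))"

definition eta :: "'g::topological_ab_group_add set \<Rightarrow> 'g dual set \<Rightarrow> 'g dual \<Rightarrow> 'g dual" where
  "eta H D \<gamma> = \<gamma> - theta H D \<gamma>"

text \<open>The argument \<open>C\<close> is an element of the quotient by \<open>H\<close>; the choice of its representative is
  immaterial by \<open>w_fun_coset\<close> below.\<close>

definition w_fun :: "'g::topological_ab_group_add set \<Rightarrow> 'g dual set \<Rightarrow> 'g set \<Rightarrow> 'g dual \<Rightarrow> complex" where
  "w_fun H D C \<gamma> = cnj (pairing (SOME s. s \<in> C) (eta H D \<gamma>))"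

lemma eta_in_annihilator:
  assumes "coset_reps D (annihilator H)"
  shows "eta H D \<gamma> \<in> annihilator H"
proof -
  have "\<exists>!d. d \<in> D \<inter> coset \<gamma> (annihilator H)"
    using assms by (auto simp: coset_reps_def quotient_group_def)
  then have "theta H D \<gamma> \<in> D \<inter> coset \<gamma> (annihilator H)"
    unfolding theta_def by (rule theI')
  then obtain k where "k \<in> annihilator H" "theta H D \<gamma> = \<gamma> + k"
    by (auto simp: coset_def)
  then show ?thesis
    by (simp add: eta_def annihilator_def pairing_uminus_right)
qed

lemma w_fun_coset:
  assumes "add_subgroup H" "coset_reps D (annihilator H)"
  shows "w_fun H D (coset s H) \<gamma> = cnj (pairing s (eta H D \<gamma>))"
proof -
  have "s \<in> coset s H"
    using assms(1) by (force simp: coset_def add_subgroup_def)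
  then have "(SOME t. t \<in> coset s H) \<in> coset s H"
    by (rule someI)
  then obtain h where "h \<in> H" "(SOME t. t \<in> coset s H) = s + h"
    by (auto simp: coset_def)
  moreover have "pairing h (eta H D \<gamma>) = 1"
    using eta_in_annihilator[OF assms(2)] \<open>h \<in> H\<close> by (auto simp: annihilator_def)
  ultimately show ?thesis
    by (simp add: w_fun_def pairing_add_left)
qed


section \<open>Haar measures and automorphisms\<close>

text \<open>Haar measures are regular Borel measures: outer regular on Borel sets, inner regular on open
  sets.  No countability assumption is made on the group.\<close>

definition haar_measure :: "'g::{topological_ab_group_add,t2_space} measure \<Rightarrow> bool" where
  "haar_measure M \<longleftrightarrow>
     sets M = sets borel \<and>
     emeasure M UNIV \<noteq> 0 \<and>
     (\<forall>x. \<forall>B\<in>sets borel. emeasure M ((+) x ` B) = emeasure M B) \<and>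
     (\<forall>K. compact K \<longrightarrow> emeasure M K < \<infinity>) \<and>
     (\<forall>B\<in>sets borel. emeasure M B = (INF U\<in>{U. open U \<and> B \<subseteq> U}. emeasure M U)) \<and>
     (\<forall>U. open U \<longrightarrow> emeasure M U = (SUP K\<in>{K. compact K \<and> K \<subseteq> U}. emeasure M K))"

definition Aut :: "('g::topological_ab_group_add \<Rightarrow> 'g) set" where
  "Aut = {A. Modules.additive A \<and> homeomorphism UNIV UNIV A (inv A)}"

definition aut_power :: "('g \<Rightarrow> 'g) \<Rightarrow> int \<Rightarrow> 'g \<Rightarrow> 'g" where
  "aut_power A n = (if n \<ge> 0 then A ^^ nat n else inv A ^^ nat (- n))"

definition modulus :: "'g::{topological_ab_group_add,t2_space} measure \<Rightarrow> ('g \<Rightarrow> 'g) \<Rightarrow> real" where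
  "modulus \<mu> A = (THE c. c > 0 \<and> (\<forall>U\<in>sets borel. emeasure \<mu> (A ` U) = ennreal c * emeasure \<mu> U))"

definition adjoint_aut :: "('g::topological_ab_group_add \<Rightarrow> 'g) \<Rightarrow> 'g dual \<Rightarrow> 'g dual" where
  "adjoint_aut A \<gamma> = (THE \<gamma>'. \<forall>x. pairing (A x) \<gamma> = pairing x \<gamma>')"

lemma pairing_adjoint_aut:
  assumes "A \<in> Aut"
  shows "pairing (A x) \<gamma> = pairing x (adjoint_aut A \<gamma>)"
proof -
  have A: "Modules.additive A" "continuous_on UNIV A"
    using assms by (auto simp: Aut_def dest: homeomorphism_cont1)
  have "pairing y (Dual (\<lambda>x. pairing (A x) \<gamma>)) = pairing (A y) \<gamma>" for y
    by (rule pairing_Dual)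
       (auto simp: pairing_add_left additive.add[OF A(1)]
          intro: continuous_on_compose2[OF continuous_pairing A(2)])
  then have "\<exists>!\<gamma>'. \<forall>x. pairing (A x) \<gamma> = pairing x \<gamma>'"
    by (intro ex1I[of _ "Dual (\<lambda>x. pairing (A x) \<gamma>)"]) (auto intro: dual_eqI)
  from theI'[OF this] show ?thesis
    unfolding adjoint_aut_def by blast
qed

definition expansive :: "'g::topological_ab_group_add set \<Rightarrow> ('g \<Rightarrow> 'g) \<Rightarrow> bool" where
  "expansive H A \<longleftrightarrow> H \<subset> A ` H \<and> (\<Inter>n\<in>{..0}. aut_power A n ` H) = {0}"


section \<open>Square-integrable functions and the Fourier transform\<close>

text \<open>Elements of the Hilbert space \<open>L\<^sup>2\<close> are represented by functions, to be compared up to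
  equality almost everywhere.\<close>

definition L2 :: "'a measure \<Rightarrow> ('a \<Rightarrow> complex) set" where
  "L2 M = {f. f \<in> borel_measurable M \<and> integrable M (\<lambda>x. (norm (f x))\<^sup>2)}"

definition inner_L2 :: "'a measure \<Rightarrow> ('a \<Rightarrow> complex) \<Rightarrow> ('a \<Rightarrow> complex) \<Rightarrow> complex" where
  "inner_L2 M f g = (LINT x|M. f x * cnj (g x))"

definition norm_L2 :: "'a measure \<Rightarrow> ('a \<Rightarrow> complex) \<Rightarrow> real" where
  "norm_L2 M f = sqrt (LINT x|M. (norm (f x))\<^sup>2)"

definition orthonormal_basis_L2 :: "'a measure \<Rightarrow> 'i set \<Rightarrow> ('i \<Rightarrow> 'a \<Rightarrow> complex) \<Rightarrow> bool" where
  "orthonormal_basis_L2 M I e \<longleftrightarrow>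
     (\<forall>i\<in>I. e i \<in> L2 M) \<and>
     (\<forall>i\<in>I. \<forall>k\<in>I. inner_L2 M (e i) (e k) = (if i = k then 1 else 0)) \<and>
     (\<forall>f\<in>L2 M. \<forall>\<epsilon>>0. \<exists>J c. finite J \<and> J \<subseteq> I \<and> norm_L2 M (\<lambda>x. f x - (\<Sum>i\<in>J. c i * e i x)) < \<epsilon>)"

definition fourier :: "'g::topological_ab_group_add measure \<Rightarrow> ('g \<Rightarrow> complex) \<Rightarrow> 'g dual \<Rightarrow> complex" where
  "fourier \<mu> f \<gamma> = (LINT x|\<mu>. f x * cnj (pairing x \<gamma>))"

text \<open>The extension of \<open>fourier\<close> to \<open>L\<^sup>2\<close> by continuity, as a relation; it determines \<open>F\<close> from
  \<open>f\<close> up to null sets.\<close>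

definition is_fourier_L2 ::
  "'g::topological_ab_group_add measure \<Rightarrow> 'g dual measure \<Rightarrow> ('g \<Rightarrow> complex) \<Rightarrow> ('g dual \<Rightarrow> complex) \<Rightarrow> bool"
where
  "is_fourier_L2 \<mu> \<nu> f F \<longleftrightarrow> f \<in> L2 \<mu> \<and> F \<in> L2 \<nu> \<and>
     (\<exists>h :: nat \<Rightarrow> 'g \<Rightarrow> complex.
        (\<forall>n. integrable \<mu> (h n) \<and> h n \<in> L2 \<mu> \<and> fourier \<mu> (h n) \<in> L2 \<nu>) \<and>
        (\<lambda>n. norm_L2 \<mu> (\<lambda>x. h n x - f x)) \<longlonglongrightarrow> 0 \<and>
        (\<lambda>n. norm_L2 \<nu> (\<lambda>\<gamma>. fourier \<mu> (h n) \<gamma> - F \<gamma>)) \<longlonglongrightarrow> 0)"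

definition fourier_L2 ::
  "'g::topological_ab_group_add measure \<Rightarrow> 'g dual measure \<Rightarrow> ('g \<Rightarrow> complex) \<Rightarrow> 'g dual \<Rightarrow> complex" where
  "fourier_L2 \<mu> \<nu> f = (SOME F. is_fourier_L2 \<mu> \<nu> f F)"


section \<open>Translation and dilation operators, wavelet generators\<close>

definition translation ::
  "'g::topological_ab_group_add measure \<Rightarrow> 'g dual measure \<Rightarrow> 'g set \<Rightarrow> 'g dual set \<Rightarrow> 'g set
    \<Rightarrow> ('g \<Rightarrow> complex) \<Rightarrow> 'g \<Rightarrow> complex" where
  "translation \<mu> \<nu> H D C f =
     (SOME g. g \<in> L2 \<mu> \<and> (AE \<gamma> in \<nu>. fourier_L2 \<mu> \<nu> g \<gamma> = fourier_L2 \<mu> \<nu> f \<gamma> * w_fun H D C \<gamma>))"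

definition dilation ::
  "'g::{topological_ab_group_add,t2_space} measure \<Rightarrow> ('g \<Rightarrow> 'g) \<Rightarrow> ('g \<Rightarrow> complex) \<Rightarrow> 'g \<Rightarrow> complex" where
  "dilation \<mu> A f x = complex_of_real (sqrt (modulus \<mu> A)) * f (A x)"

definition wavelet_generators ::
  "'g::{topological_ab_group_add,t2_space} measure \<Rightarrow> 'g dual measure \<Rightarrow> 'g set \<Rightarrow> 'g dual set
    \<Rightarrow> ('g \<Rightarrow> 'g) set \<Rightarrow> nat \<Rightarrow> (nat \<Rightarrow> 'g \<Rightarrow> complex) \<Rightarrow> bool" where
  "wavelet_generators \<mu> \<nu> H D \<A> N \<psi> \<longleftrightarrow>
     countable \<A> \<and> \<A> \<noteq> {} \<and> \<A> \<subseteq> Aut \<and> (\<forall>j\<in>{1..N}. \<psi> j \<in> L2 \<mu>) \<and>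
     orthonormal_basis_L2 \<mu> ({1..N} \<times> \<A> \<times> quotient_group H)
       (\<lambda>(j, A, C). dilation \<mu> A (translation \<mu> \<nu> H D C (\<psi> j)))"

end

theory Submission
  imports Defs
begin

text \<open>Everything is done on the side of \<open>G\<close>. There the wavelets are explicit: with
  \<open>K n = A\<^sup>-\<^sup>n H\<close> and \<open>q = |A|\<close>, the wavelet for \<open>(j, A\<^sup>n, [s])\<close> is
  \<open>q\<^sup>n\<^sup>/\<^sup>2 (A\<^sup>n x, \<sigma>\<^sub>j)\<close> on the coset of \<open>K n\<close> given by \<open>A\<^sup>n x \<in> s + H\<close>, and \<open>0\<close>
  elsewhere. The \<open>\<sigma>\<^sub>j\<close> together with \<open>0\<close> represent the \<open>q\<close> characters of \<open>H\<close> modulo \<open>K 1\<close>, so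
  orthogonality of characters of this finite group expresses the indicator of a coset of
  \<open>K (n + 1)\<close> by the indicator of a coset of \<open>K n\<close> and the wavelets of scale \<open>n\<close>. Iterating
  towards \<open>n \<rightarrow> -\<infinity>\<close> the remaining average tends to \<open>0\<close> in norm, and the indicators of
  cosets span a dense subspace because the \<open>K n\<close> form a neighbourhood basis of \<open>0\<close>.

  The definitions through the Fourier transform on \<open>L\<^sup>2\<close> are reduced to this by Plancherel's theorem,
  which is checked on indicators of cosets of the \<open>K n\<close> and extended by density.\<close>

text \<open>\<open>G\<close> need not be sigma-compact and \<open>\<mu>\<close> need not be
  sigma-finite, so Fubini is avoided throughout. Plancherel instead compares Gram matrices of
  indicators of cosets, and these agree because \<open>K n\<close> has measure q^-n and its
  annihilator has measure q^n. The second value is the arithmetical core: passing to annihilators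
  preserves the index. That needs characters separating points from an open subgroup; they come from
  Zorn's lemma, and being trivial on an open subgroup makes them continuous.

  A second obstacle is that \<open>fourier_L2\<close> and \<open>translation\<close> are chosen by
  \<open>SOME\<close> and determined only almost everywhere, while \<open>dilation\<close> composes
  with a power of \<open>A\<close>. The explicit wavelets are therefore tied to the defined ones by
  equality almost everywhere, and powers of \<open>A\<close> must preserve null sets. This comes
  with the modulus: the factor q is counted on cosets, passed to open sets by inner regularity and
  to Borel sets by outer regularity.\<close>

section \<open>Subgroups, cosets and annihilators\<close>

lemma add_subgroupD:
  assumes "add_subgroup K"
  shows add_subgroup_zero: "0 \<in> K"
    and add_subgroup_add: "\<And>x y. x \<in> K \<Longrightarrow> y \<in> K \<Longrightarrow> x + y \<in> K"
    and add_subgroup_uminus: "\<And>x. x \<in> K \<Longrightarrow> - x \<in> K"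
    and add_subgroup_diff: "\<And>x y. x \<in> K \<Longrightarrow> y \<in> K \<Longrightarrow> x - y \<in> K"
  using assms unfolding add_subgroup_def by (auto simp: diff_conv_add_uminus simp del: add_uminus_conv_diff)

lemma add_subgroup_add_cancel:
  assumes "add_subgroup K" "k \<in> K"
  shows "k + x \<in> K \<longleftrightarrow> x \<in> K" "x + k \<in> K \<longleftrightarrow> x \<in> K"
  using add_subgroup_add[OF assms(1)] add_subgroup_diff[OF assms(1)] assms(2)
  by (metis add.commute add_diff_cancel_left')+

lemma mem_coset_iff: "x \<in> coset c K \<longleftrightarrow> x - c \<in> K"
  unfolding coset_def by (metis add.commute add_diff_cancel_left' diff_add_cancel image_iff)

lemma coset_eq_iff:
  assumes "add_subgroup K"
  shows "coset c K = coset d K \<longleftrightarrow> c - d \<in> K"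
proof
  assume "coset c K = coset d K"
  moreover have "c \<in> coset c K" using add_subgroup_zero[OF assms] by (simp add: mem_coset_iff)
  ultimately show "c - d \<in> K" by (simp add: mem_coset_iff)
next
  assume cd: "c - d \<in> K"
  have "x - c \<in> K \<longleftrightarrow> x - d \<in> K" for x
    using add_subgroup_add_cancel(2)[OF assms cd, of "x - c"] by simp
  then show "coset c K = coset d K"
    by (auto simp: mem_coset_iff)
qed

lemma open_coset:
  fixes K :: "'g::topological_ab_group_add set"
  assumes "open K"
  shows "open (coset c K)"
proof -
  have "coset c K = (\<lambda>x. x - c) -` K" by (auto simp: mem_coset_iff)
  moreover have "open ((\<lambda>x. x - c) -` K)"
    by (intro open_vimage assms continuous_intros)
  ultimately show ?thesis by simp
qed

text \<open>The complement is a union of open cosets. Closedness lets the complements of the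
  \<open>K n\<close> serve as an open cover in \<open>K_basis\<close>.\<close>

lemma closed_open_subgroup:
  fixes K :: "'g::topological_ab_group_add set"
  assumes "add_subgroup K" "open K"
  shows "closed K"
proof -
  have "- K = (\<Union>c\<in>- K. coset c K)"
  proof safe
    fix x assume "x \<notin> K"
    then show "x \<in> (\<Union>c\<in>- K. coset c K)"
      using add_subgroup_zero[OF assms(1)] by (auto simp: mem_coset_iff intro!: bexI[of _ x])
  next
    fix x c assume x: "c \<notin> K" "x \<in> coset c K" "x \<in> K"
    then have "x - (x - c) \<in> K"
      using add_subgroup_diff[OF assms(1), of x "x - c"] by (simp add: mem_coset_iff)
    then show False using x by simp
  qed
  then have "open (- K)" using open_coset[OF assms(2)] by (metis open_UN)
  then show ?thesis by (simp add: closed_def)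
qed

lemma pairing_uminus_left: "pairing (- x) \<gamma> = cnj (pairing x \<gamma>)"
proof -
  have "pairing x \<gamma> * pairing (- x) \<gamma> = pairing x \<gamma> * cnj (pairing x \<gamma>)"
    by (simp flip: pairing_add_left complex_norm_square)
  then show ?thesis by simp
qed

lemma pairing_diff_left: "pairing (x - y) \<gamma> = pairing x \<gamma> * cnj (pairing y \<gamma>)"
  using pairing_add_left[of x "- y" \<gamma>] by (simp add: pairing_uminus_left)

lemma pairing_diff_right: "pairing x (\<gamma> - \<gamma>') = pairing x \<gamma> * cnj (pairing x \<gamma>')"
  using pairing_add_right[of x \<gamma> "- \<gamma>'"] by (simp add: pairing_uminus_right)

lemma add_subgroup_annihilator: "add_subgroup (annihilator K)"
  by (auto simp: add_subgroup_def annihilator_def pairing_add_right pairing_uminus_right)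

lemma annihilator_antimono: "K \<subseteq> L \<Longrightarrow> annihilator L \<subseteq> annihilator K"
  by (auto simp: annihilator_def)

lemma continuous_pairing_right: "continuous_on UNIV (\<lambda>\<gamma>. pairing x \<gamma>)"
proof -
  have "((\<lambda>\<gamma>. pairing x \<gamma>) \<longlongrightarrow> pairing x \<gamma>) (nhds \<gamma>)" for \<gamma> :: "'a dual"
  proof (rule tendstoI)
    fix e :: real assume "e > 0"
    then have "\<forall>\<^sub>F \<gamma>' in nhds \<gamma>. \<gamma>' \<in> unif_nbhd \<gamma> {x} e"
      by (intro eventually_nhds_in_open open_unif_nbhd self_in_unif_nbhd) auto
    then show "\<forall>\<^sub>F \<gamma>' in nhds \<gamma>. dist (pairing x \<gamma>') (pairing x \<gamma>) < e"
      by (rule eventually_mono) (simp add: unif_nbhd_def dist_norm)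
  qed
  then show ?thesis
    by (auto simp: continuous_on_def intro: filterlim_mono[OF _ order_refl] at_within_le_nhds)
qed

lemma closed_annihilator: "closed (annihilator K)"
proof -
  have "annihilator K = (\<Inter>x\<in>K. {\<gamma>. pairing x \<gamma> = 1})" by (auto simp: annihilator_def)
  then show ?thesis by (auto intro!: closed_Collect_eq continuous_pairing_right)
qed

section \<open>Characters separate points modulo open subgroups\<close>

text \<open>Partial characters are encoded by their graphs, so that Zorn's lemma applies to inclusion.\<close>

definition partial_char :: "('g::ab_group_add \<times> complex) set \<Rightarrow> bool" where
  "partial_char \<Gamma> \<longleftrightarrow> (0, 1) \<in> \<Gamma> \<and> (\<forall>x z. (x, z) \<in> \<Gamma> \<longrightarrow> norm z = 1 \<and> (- x, inverse z) \<in> \<Gamma>) \<and>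
     (\<forall>x z y w. (x, z) \<in> \<Gamma> \<longrightarrow> (y, w) \<in> \<Gamma> \<longrightarrow> (x + y, z * w) \<in> \<Gamma>) \<and>
     (\<forall>z. (0, z) \<in> \<Gamma> \<longrightarrow> z = 1)"

lemma partial_charD:
  assumes "partial_char \<Gamma>"
  shows partial_char_zero: "(0, 1) \<in> \<Gamma>"
    and partial_char_norm: "\<And>x z. (x, z) \<in> \<Gamma> \<Longrightarrow> norm z = 1"
    and partial_char_uminus: "\<And>x z. (x, z) \<in> \<Gamma> \<Longrightarrow> (- x, inverse z) \<in> \<Gamma>"
    and partial_char_add: "\<And>x z y w. (x, z) \<in> \<Gamma> \<Longrightarrow> (y, w) \<in> \<Gamma> \<Longrightarrow> (x + y, z * w) \<in> \<Gamma>"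
    and partial_char_at_zero: "\<And>z. (0, z) \<in> \<Gamma> \<Longrightarrow> z = 1"
  using assms unfolding partial_char_def by blast+

text \<open>The quotient of two values at x is a value at 0, so the clause about 0 in
  \<open>partial_char\<close> already encodes single-valuedness of the graph.\<close>

lemma partial_char_unique:
  assumes "partial_char \<Gamma>" "(x, z) \<in> \<Gamma>" "(x, w) \<in> \<Gamma>"
  shows "z = w"
proof -
  have "(x + - x, z * inverse w) \<in> \<Gamma>"
    using partial_char_add partial_char_uminus assms by blast
  then have "z * inverse w = 1" using partial_char_at_zero[OF assms(1)] by simp
  then show ?thesis by (metis inverse_unique inverse_inverse_eq)
qed

definition zmult :: "int \<Rightarrow> 'g::ab_group_add \<Rightarrow> 'g" where
  "zmult n x = (if n \<ge> 0 then ((+) x ^^ nat n) 0 else - ((+) x ^^ nat (- n)) 0)"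

lemma zmult_0 [simp]: "zmult 0 x = 0" by (simp add: zmult_def)

lemma zmult_plus_1: "zmult (n + 1) x = x + zmult n x"
proof (cases "n \<ge> 0")
  case True
  then have "nat (n + 1) = Suc (nat n)" by simp
  then show ?thesis using True by (simp add: zmult_def)
next
  case False
  then have "nat (- n) = Suc (nat (- (n + 1)))" by simp
  then show ?thesis using False by (cases "n = -1") (auto simp: zmult_def)
qed

lemma zmult_1 [simp]: "zmult 1 x = x" using zmult_plus_1[of 0 x] by simp

lemma zmult_add: "zmult (m + n) x = zmult m x + zmult n x"
proof (induction m rule: int_induct[where k = 0])
  case base then show ?case by simp
next
  case (step1 i)
  then show ?case using zmult_plus_1[of "i + n" x] zmult_plus_1[of i x] by (simp add: add_ac)
next
  case (step2 i)
  then show ?case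
    using zmult_plus_1[of "i - 1 + n" x] zmult_plus_1[of "i - 1" x] by (simp add: algebra_simps)
qed

lemma zmult_minus: "zmult (- n) x = - zmult n x"
  using zmult_add[of n "- n" x] by (simp add: eq_neg_iff_add_eq_0 add.commute)

lemma zmult_mult: "zmult (m * n) x = zmult m (zmult n x)"
proof (induction m rule: int_induct[where k = 0])
  case base then show ?case by simp
next
  case (step1 i)
  then show ?case by (simp add: distrib_right zmult_add)
next
  case (step2 i)
  then show ?case using zmult_plus_1[of "i - 1" "zmult n x"] zmult_add[of "(i - 1) * n" n x]
    by (simp add: algebra_simps)
qed

lemma partial_char_zmult:
  assumes "partial_char \<Gamma>" "(x, z) \<in> \<Gamma>"
  shows "(zmult n x, z powi n) \<in> \<Gamma>"
proof -
  have z: "z \<noteq> 0" using partial_char_norm[OF assms] by auto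
  show ?thesis
  proof (induction n rule: int_induct[where k = 0])
    case base then show ?case using partial_char_zero[OF assms(1)] by simp
  next
    case (step1 i)
    then show ?case
      using partial_char_add[OF assms step1(2)] z by (simp add: zmult_plus_1 power_int_add mult.commute)
  next
    case (step2 i)
    have "zmult i x + - x = zmult (i - 1) x"
      using zmult_plus_1[of "i - 1" x] by simp
    moreover have "z powi i * inverse z = z powi (i - 1)"
      using z by (simp add: power_int_diff field_simps)
    ultimately show ?case
      using partial_char_add[OF assms(1) step2(2) partial_char_uminus[OF assms]] by simp
  qed
qed

text \<open>The extension sends \<open>y\<close> to an \<open>m\<close>-th root of the value at the least positive multiple
  \<open>m y\<close> in the domain; since \<open>m \<ge> 2\<close>, the root can be chosen different from \<open>1\<close>. If there is no
  such multiple, \<open>y\<close> is sent to \<open>-1\<close>.\<close>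

lemma partial_char_extend:
  assumes \<Gamma>: "partial_char \<Gamma>" and y: "y \<notin> fst ` \<Gamma>"
  shows "\<exists>\<Gamma>' \<zeta>. partial_char \<Gamma>' \<and> \<Gamma> \<subseteq> \<Gamma>' \<and> (y, \<zeta>) \<in> \<Gamma>' \<and> \<zeta> \<noteq> 1"
proof -
  \<comment> \<open>The only constraint on a value at y comes from the multiples of y that already
    lie in the domain.\<close>
  have "\<exists>\<zeta>. norm \<zeta> = 1 \<and> \<zeta> \<noteq> 1 \<and> (\<forall>n z. (zmult n y, z) \<in> \<Gamma> \<longrightarrow> z = \<zeta> powi n)"
  proof (cases "\<exists>n>0. zmult (int n) y \<in> fst ` \<Gamma>")
    case False
    have "n = 0" if "(zmult n y, z) \<in> \<Gamma>" for n z
    proof (rule ccontr)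
      assume "n \<noteq> 0"
      then consider "n > 0" | "- n > 0" by linarith
      then have "\<exists>k>0. zmult (int k) y \<in> fst ` \<Gamma>"
      proof cases
        case 1
        then show ?thesis using that by (intro exI[of _ "nat n"]) force
      next
        case 2
        moreover have "zmult (- n) y \<in> fst ` \<Gamma>"
          using partial_char_uminus[OF \<Gamma> that] by (force simp: zmult_minus)
        ultimately show ?thesis by (intro exI[of _ "nat (- n)"]) auto
      qed
      then show False using False by blast
    qed
    then show ?thesis
      using partial_char_at_zero[OF \<Gamma>] by (intro exI[of _ "-1"]) fastforce
  next
    case True
    define m where "m = (LEAST n. n > 0 \<and> zmult (int n) y \<in> fst ` \<Gamma>)"
    have m: "m > 0" "zmult (int m) y \<in> fst ` \<Gamma>"
      using LeastI_ex[OF True] by (auto simp: m_def)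
    have least: "m \<le> n" if "n > 0" "zmult (int n) y \<in> fst ` \<Gamma>" for n
      unfolding m_def by (rule Least_le) (use that in blast)
    from m(2) obtain c where c: "(zmult (int m) y, c) \<in> \<Gamma>" by force
    have "m \<noteq> 1" using m(2) y by (metis of_nat_1 zmult_1)
    with m have m2: "m \<ge> 2" by simp
    \<comment> \<open>If c is not 1, no root of c is 1 and any root will do. If c = 1, a primitive
      m-th root of unity is taken.\<close>
    obtain \<zeta> where \<zeta>: "\<zeta> ^ m = c" "\<zeta> \<noteq> 1"
    proof (cases "c = 1")
      case True
      have "cis (2 * pi / real m) ^ m = 1" using m by (simp add: Complex.DeMoivre)
      moreover have "cis (2 * pi / real m) \<noteq> 1"
      proof
        assume 1: "cis (2 * pi / real m) = 1"
        then have "cos (2 * pi / real m) = 1" by (metis Re_complex_of_real cis.simps(1) of_real_1)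
        then obtain k :: int where "2 * pi / real m = of_int k * (2 * pi)"
          by (auto simp: cos_one_2pi_int)
        then have "1 = real_of_int k * real m" using m by (simp add: field_simps)
        then have "k * int m = 1" by (metis of_int_eq_iff of_int_mult of_int_of_nat_eq of_int_1)
        then show False using m2 by (simp add: zmult_eq_1_iff)
      qed
      ultimately show ?thesis using that True by blast
    next
      case False
      have "c \<noteq> 0" using partial_char_norm[OF \<Gamma> c] by auto
      then have "exp (ln c / of_nat m) ^ m = c" using m by (simp flip: exp_of_nat_mult)
      moreover from this False have "exp (ln c / of_nat m) \<noteq> 1" by auto
      ultimately show ?thesis using that by blast
    qed
    have "norm \<zeta> ^ m = 1" using \<zeta>(1) partial_char_norm[OF \<Gamma> c] by (metis norm_power)
    then have n\<zeta>: "norm \<zeta> = 1" using m(1) power_eq_1_iff[of "norm \<zeta>" m] by auto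
    have "z = \<zeta> powi n" if nz: "(zmult n y, z) \<in> \<Gamma>" for n z
    proof -
      \<comment> \<open>Division with remainder by m: the multiple r y also lies in the domain and r
        < m, so minimality of m forces r = 0.\<close>
      define k where "k = n div int m"
      define r where "r = n mod int m"
      have n: "n = k * int m + r" by (simp add: k_def r_def)
      have kc: "(zmult (k * int m) y, c powi k) \<in> \<Gamma>"
        using partial_char_zmult[OF \<Gamma> c, of k] by (simp add: zmult_mult)
      have "zmult r y = zmult n y + - zmult (k * int m) y"
        using n by (simp add: zmult_add)
      then have "zmult r y \<in> fst ` \<Gamma>"
        using partial_char_add[OF \<Gamma> nz partial_char_uminus[OF \<Gamma> kc]] by force
      moreover have "r \<ge> 0" "r < int m" using m(1) by (auto simp: r_def)
      ultimately have "r = 0" using least[of "nat r"] by (cases "r = 0") auto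
      with n kc have "(zmult n y, c powi k) \<in> \<Gamma>" by simp
      then have "z = c powi k" using partial_char_unique[OF \<Gamma> nz] by simp
      also have "\<dots> = \<zeta> powi n"
        using n \<open>r = 0\<close> \<zeta>(1) by (simp add: mult.commute[of k] power_int_mult)
      finally show ?thesis .
    qed
    with n\<zeta> \<zeta>(2) show ?thesis by blast
  qed
  then obtain \<zeta> where \<zeta>: "norm \<zeta> = 1" "\<zeta> \<noteq> 1" "\<And>n z. (zmult n y, z) \<in> \<Gamma> \<Longrightarrow> z = \<zeta> powi n"
    by blast
  have \<zeta>0: "\<zeta> \<noteq> 0" using \<zeta>(1) by auto
  define \<Gamma>' where "\<Gamma>' = {(x + zmult n y, z * \<zeta> powi n) | x z n. (x, z) \<in> \<Gamma>}"
  have mem: "(x + zmult n y, z * \<zeta> powi n) \<in> \<Gamma>'" if "(x, z) \<in> \<Gamma>" for x z n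
    using that by (auto simp: \<Gamma>'_def)
  have "partial_char \<Gamma>'"
    unfolding partial_char_def
  proof (intro conjI allI impI)
    show "(0, 1) \<in> \<Gamma>'" using mem[OF partial_char_zero[OF \<Gamma>], of 0] by simp
  next
    fix x z assume "(x, z) \<in> \<Gamma>'"
    then obtain a b n where a: "(a, b) \<in> \<Gamma>" "x = a + zmult n y" "z = b * \<zeta> powi n"
      by (auto simp: \<Gamma>'_def)
    show "norm z = 1" using a partial_char_norm[OF \<Gamma> a(1)] \<zeta>(1)
      by (simp add: norm_mult norm_power_int)
    show "(- x, inverse z) \<in> \<Gamma>'"
      using mem[OF partial_char_uminus[OF \<Gamma> a(1)], of "- n"] a(2,3)
      by (simp add: zmult_minus power_int_minus inverse_mult_distrib add.commute)
  next
    fix x z x' z' assume "(x, z) \<in> \<Gamma>'" "(x', z') \<in> \<Gamma>'"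
    then obtain a b n a' b' n' where a: "(a, b) \<in> \<Gamma>" "x = a + zmult n y" "z = b * \<zeta> powi n"
      "(a', b') \<in> \<Gamma>" "x' = a' + zmult n' y" "z' = b' * \<zeta> powi n'"
      by (auto simp: \<Gamma>'_def)
    show "(x + x', z * z') \<in> \<Gamma>'"
      using mem[OF partial_char_add[OF \<Gamma> a(1,4)], of "n + n'"] a \<zeta>0
      by (simp add: zmult_add power_int_add algebra_simps)
  next
    \<comment> \<open>This clause is the well-definedness of the extension: a relation a + n y = 0
      puts n y = - a into the old domain, where the choice of \<open>\<zeta>\<close> prescribes the
      value.\<close>
    fix z assume "(0, z) \<in> \<Gamma>'"
    then obtain a b n where a: "(a, b) \<in> \<Gamma>" "0 = a + zmult n y" "z = b * \<zeta> powi n"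
      by (auto simp: \<Gamma>'_def)
    then have "(zmult n y, inverse b) \<in> \<Gamma>"
      using partial_char_uminus[OF \<Gamma> a(1)] by (metis minus_unique)
    from \<zeta>(3)[OF this] show "z = 1"
      using a(3) partial_char_norm[OF \<Gamma> a(1)] by (metis norm_zero right_inverse zero_neq_one)
  qed
  moreover have "\<Gamma> \<subseteq> \<Gamma>'" using mem[of _ _ 0] by auto
  moreover have "(y, \<zeta>) \<in> \<Gamma>'" using mem[OF partial_char_zero[OF \<Gamma>], of 1] by simp
  ultimately show ?thesis using \<zeta>(2) by blast
qed

text \<open>A maximal extension is total, since \<open>partial_char_extend\<close> could adjoin a
  missing point. Unions of chains stay partial characters because each clause involves at most two
  points of the graph.\<close>

lemma partial_char_total:
  assumes "partial_char \<Gamma>"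
  shows "\<exists>\<Gamma>'. partial_char \<Gamma>' \<and> \<Gamma> \<subseteq> \<Gamma>' \<and> fst ` \<Gamma>' = UNIV"
proof -
  let ?S = "{\<Gamma>'. partial_char \<Gamma>' \<and> \<Gamma> \<subseteq> \<Gamma>'}"
  have "\<exists>M\<in>?S. \<forall>X\<in>?S. M \<subseteq> X \<longrightarrow> X = M"
  proof (rule subset_Zorn_nonempty)
    show "?S \<noteq> {}" using assms by auto
  next
    fix C assume C: "C \<noteq> {}" "subset.chain ?S C"
    then have pc: "partial_char X" "\<Gamma> \<subseteq> X" if "X \<in> C" for X
      using that by (auto simp: subset.chain_def)
    have "partial_char (\<Union>C)"
      unfolding partial_char_def
    proof (intro conjI allI impI)
      show "(0, 1) \<in> \<Union>C" using C(1) pc(1) partial_char_zero by blast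
    next
      fix x z assume "(x, z) \<in> \<Union>C"
      then show "norm z = 1" "(- x, inverse z) \<in> \<Union>C"
        using pc(1) partial_char_norm partial_char_uminus by blast+
    next
      fix x z y w assume "(x, z) \<in> \<Union>C" "(y, w) \<in> \<Union>C"
      then obtain X Y where XY: "X \<in> C" "Y \<in> C" "(x, z) \<in> X" "(y, w) \<in> Y" by blast
      then have "X \<subseteq> Y \<or> Y \<subseteq> X" using C(2) unfolding subset.chain_def by blast
      then show "(x + y, z * w) \<in> \<Union>C"
        using XY pc(1) partial_char_add by (metis Union_iff subsetD)
    next
      fix z assume "(0, z) \<in> \<Union>C"
      then show "z = 1" using pc(1) partial_char_at_zero by blast
    qed
    moreover have "\<Gamma> \<subseteq> \<Union>C" using C(1) pc(2) by blast
    ultimately show "\<Union>C \<in> ?S" by blast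
  qed
  then obtain M where M: "partial_char M" "\<Gamma> \<subseteq> M"
    and max: "\<And>X. partial_char X \<Longrightarrow> \<Gamma> \<subseteq> X \<Longrightarrow> M \<subseteq> X \<Longrightarrow> X = M" by auto
  have "fst ` M = UNIV"
  proof (rule ccontr)
    assume "fst ` M \<noteq> UNIV"
    then obtain y where y: "y \<notin> fst ` M" by blast
    from partial_char_extend[OF M(1) y] obtain X \<zeta> where X: "partial_char X" "M \<subseteq> X" "(y, \<zeta>) \<in> X"
      by blast
    then have "X = M" using max M(2) by auto
    with X(3) y show False by force
  qed
  with M show ?thesis by blast
qed

text \<open>The trivial character of K is extended to x with a value other than 1 before it is
  extended to the whole group. Continuity is automatic, as the result is constant on the open cosets
  of K.\<close>

lemma character_separates:
  fixes K :: "'g::topological_ab_group_add set"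
  assumes K: "add_subgroup K" "open K" and x: "x \<notin> K"
  shows "\<exists>\<gamma>\<in>annihilator K. pairing x \<gamma> \<noteq> 1"
proof -
  have "partial_char (K \<times> {1})"
    using add_subgroupD[OF K(1)] by (auto simp: partial_char_def)
  moreover have "x \<notin> fst ` (K \<times> {1::complex})" using x by auto
  ultimately obtain \<Gamma>0 \<zeta> where 0: "partial_char \<Gamma>0" "K \<times> {1} \<subseteq> \<Gamma>0" "(x, \<zeta>) \<in> \<Gamma>0" "\<zeta> \<noteq> 1"
    using partial_char_extend by blast
  obtain \<Gamma> where \<Gamma>: "partial_char \<Gamma>" "\<Gamma>0 \<subseteq> \<Gamma>" "fst ` \<Gamma> = UNIV"
    using partial_char_total[OF 0(1)] by blast
  define \<xi> where "\<xi> x = (THE z. (x, z) \<in> \<Gamma>)" for x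
  have \<xi>: "\<xi> x = z \<longleftrightarrow> (x, z) \<in> \<Gamma>" for x z
  proof -
    have "\<exists>z. (x, z) \<in> \<Gamma>" using \<Gamma>(3) by (metis UNIV_I imageE prod.collapse)
    then have "\<exists>!z. (x, z) \<in> \<Gamma>" using partial_char_unique[OF \<Gamma>(1)] by blast
    from the1_equality[OF this] theI'[OF this] show ?thesis unfolding \<xi>_def by blast
  qed
  have add: "\<xi> (x + y) = \<xi> x * \<xi> y" for x y
    using partial_char_add[OF \<Gamma>(1)] \<xi> by blast
  have norm: "norm (\<xi> x) = 1" for x
    using partial_char_norm[OF \<Gamma>(1)] \<xi> by blast
  have one: "\<xi> k = 1" if "k \<in> K" for k
    using that 0(2) \<Gamma>(2) \<xi> by blast
  have "continuous_on UNIV \<xi>"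
    unfolding continuous_on_def
  proof (intro ballI topological_tendstoI)
    fix x S assume "open S" "\<xi> x \<in> S"
    have "\<forall>\<^sub>F y in nhds x. y \<in> coset x K"
      using add_subgroup_zero[OF K(1)]
      by (intro eventually_nhds_in_open open_coset K(2)) (simp add: mem_coset_iff)
    then have "\<forall>\<^sub>F y in nhds x. \<xi> y \<in> S"
    proof (rule eventually_mono)
      fix y assume "y \<in> coset x K"
      then have "\<xi> (x + (y - x)) = \<xi> x" unfolding add by (simp add: one mem_coset_iff)
      then show "\<xi> y \<in> S" using \<open>\<xi> x \<in> S\<close> by simp
    qed
    then show "\<forall>\<^sub>F y in at x within UNIV. \<xi> y \<in> S"
      by (simp add: eventually_at_filter eventually_mono)
  qed
  with add norm have p: "pairing y (Dual \<xi>) = \<xi> y" for y by (intro pairing_Dual)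
  then have "Dual \<xi> \<in> annihilator K" using one by (simp add: annihilator_def)
  moreover have "\<xi> x = \<zeta>" using 0(3) \<Gamma>(2) \<xi> by blast
  ultimately show ?thesis using p 0(4) by metis
qed

text \<open>The double annihilator theorem for open subgroups. It turns conditions on characters
  back into membership, both in the finite character sums and in the inversion integral over the
  dual.\<close>

lemma annihilator_detects:
  fixes K :: "'g::topological_ab_group_add set"
  assumes "add_subgroup K" "open K"
  shows "(\<forall>\<gamma>\<in>annihilator K. pairing x \<gamma> = 1) \<longleftrightarrow> x \<in> K"
  using character_separates[OF assms] by (auto simp: annihilator_def)

section \<open>Transversals and duality of indices\<close>

definition transversal :: "'g::ab_group_add set \<Rightarrow> 'g set \<Rightarrow> 'g set \<Rightarrow> bool" where
  "transversal R K L \<longleftrightarrow> R \<subseteq> L \<and> (\<forall>x\<in>L. \<exists>!r. r \<in> R \<and> x - r \<in> K)"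

lemma transversal_exists:
  fixes K L :: "'g::ab_group_add set"
  assumes K: "add_subgroup K"
  shows "\<exists>R. transversal R K L"
proof -
  define \<rho> where "\<rho> x = (SOME y. y \<in> L \<and> x - y \<in> K)" for x
  have \<rho>: "\<rho> x \<in> L" "x - \<rho> x \<in> K" if "x \<in> L" for x
    using someI[of "\<lambda>y. y \<in> L \<and> x - y \<in> K" x] that add_subgroup_zero[OF K] by (auto simp: \<rho>_def)
  have "transversal (\<rho> ` L) K L"
    unfolding transversal_def
  proof (intro conjI ballI ex1I)
    show "\<rho> ` L \<subseteq> L" using \<rho> by auto
  next
    fix x assume "x \<in> L"
    then show "\<rho> x \<in> \<rho> ` L" "x - \<rho> x \<in> K" using \<rho> by auto
  next
    fix x r assume x: "x \<in> L" and r: "r \<in> \<rho> ` L \<and> x - r \<in> K"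
    then obtain y where y: "y \<in> L" "r = \<rho> y" by auto
    have "x - y \<in> K" using add_subgroup_diff[OF K, of "x - r" "y - r"] r \<rho>(2)[OF y(1)] y(2) by simp
    \<comment> \<open>The predicates defining \<open>\<rho> x\<close> and \<open>\<rho> y\<close>
      coincide, so \<open>SOME\<close> selects the same element for both.\<close>
    then have "x - z \<in> K \<longleftrightarrow> y - z \<in> K" for z
      using add_subgroup_add_cancel(1)[OF K, of "x - y" "y - z"] by simp
    then have "\<rho> x = \<rho> y" by (simp add: \<rho>_def)
    then show "r = \<rho> x" using y by simp
  qed
  then show ?thesis by blast
qed

lemma transversal_unique:
  "transversal R K L \<Longrightarrow> x \<in> L \<Longrightarrow> r \<in> R \<Longrightarrow> x - r \<in> K \<Longrightarrow> r' \<in> R \<Longrightarrow> x - r' \<in> K \<Longrightarrow> r = r'"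
  unfolding transversal_def by blast

lemma transversal_union:
  assumes "transversal R K L" "add_subgroup L" "K \<subseteq> L"
  shows "L = (\<Union>r\<in>R. coset r K)"
proof safe
  fix x assume "x \<in> L"
  then show "x \<in> (\<Union>r\<in>R. coset r K)" using assms(1) by (auto simp: transversal_def mem_coset_iff)
next
  fix x r assume "r \<in> R" "x \<in> coset r K"
  then have "x - r \<in> L" "r \<in> L" using assms by (auto simp: transversal_def mem_coset_iff)
  then show "x \<in> L" using add_subgroup_add[OF assms(2), of "x - r" r] by simp
qed

lemma transversal_disjoint:
  assumes "transversal R K L" "add_subgroup L" "K \<subseteq> L"
  shows "disjoint_family_on (\<lambda>r. coset r K) R"
  unfolding disjoint_family_on_def
proof (intro ballI impI equals0I)
  fix r s x assume "r \<in> R" "s \<in> R" "r \<noteq> s" and x: "x \<in> coset r K \<inter> coset s K"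
  moreover from this have "x \<in> L" using transversal_union[OF assms] by auto
  ultimately show False using transversal_unique[OF assms(1)] by (auto simp: mem_coset_iff)
qed

lemma finite_transversal:
  fixes K L :: "'g::topological_ab_group_add set"
  assumes R: "transversal R K L" and L: "add_subgroup L" "K \<subseteq> L" "compact L" and K: "add_subgroup K" "open K"
  shows "finite R"
proof -
  have "L \<subseteq> (\<Union>r\<in>R. coset r K)" using transversal_union[OF R L(1,2)] by simp
  then obtain F where F: "F \<subseteq> R" "finite F" "L \<subseteq> (\<Union>r\<in>F. coset r K)"
    using compactE_image[OF L(3), of R "\<lambda>r. coset r K"] open_coset[OF K(2)] by blast
  have "R \<subseteq> F"
  proof
    fix r assume r: "r \<in> R"
    then have "r \<in> L" using R by (auto simp: transversal_def)
    then obtain f where "f \<in> F" "r - f \<in> K" using F(3) by (auto simp: mem_coset_iff)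
    moreover have "r - r \<in> K" using add_subgroup_zero[OF K(1)] by simp
    ultimately show "r \<in> F" using transversal_unique[OF R \<open>r \<in> L\<close>] r F(1) by (metis subsetD)
  qed
  with F(2) show ?thesis by (rule rev_finite_subset)
qed

text \<open>If \<open>\<xi> l\<close> differs from 1 for some l in L, translating by l and reducing
  modulo K permutes R and multiplies the sum by \<open>\<xi> l\<close>. Arbitrary multiplicative
  functions are allowed so that the lemma serves characters of G as well as evaluations on the
  dual.\<close>

lemma sum_character_transversal:
  fixes \<xi> :: "'g::ab_group_add \<Rightarrow> complex"
  assumes R: "transversal R K L" "finite R" and L: "add_subgroup L" "K \<subseteq> L" and K: "add_subgroup K"
    and \<xi>: "\<And>x y. \<xi> (x + y) = \<xi> x * \<xi> y" "\<And>x. x \<in> K \<Longrightarrow> \<xi> x = 1"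
  shows "(\<Sum>r\<in>R. \<xi> r) = (if \<forall>x\<in>L. \<xi> x = 1 then of_nat (card R) else 0)"
proof (cases "\<forall>x\<in>L. \<xi> x = 1")
  case True
  then have "\<xi> r = 1" if "r \<in> R" for r using that R(1) by (auto simp: transversal_def)
  then show ?thesis using True by simp
next
  case False
  then obtain l where l: "l \<in> L" "\<xi> l \<noteq> 1" by blast
  define \<rho> where "\<rho> x = (THE r. r \<in> R \<and> x - r \<in> K)" for x
  have \<rho>: "\<rho> x \<in> R" "x - \<rho> x \<in> K" if "x \<in> L" for x
  proof -
    have "\<exists>!r. r \<in> R \<and> x - r \<in> K" using R(1) that by (auto simp: transversal_def)
    from theI'[OF this] show "\<rho> x \<in> R" "x - \<rho> x \<in> K" by (auto simp: \<rho>_def)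
  qed
  have RL: "l + r \<in> L" "r \<in> L" if "r \<in> R" for r
    using R(1) that l(1) add_subgroup_add[OF L(1)] by (auto simp: transversal_def)
  have inj: "inj_on (\<lambda>r. \<rho> (l + r)) R"
  proof (rule inj_onI)
    fix r s assume rs: "r \<in> R" "s \<in> R" "\<rho> (l + r) = \<rho> (l + s)"
    have "(l + r - \<rho> (l + r)) - (l + s - \<rho> (l + s)) \<in> K"
      by (intro add_subgroup_diff[OF K] \<rho>(2)[OF RL(1)] rs)
    then have "r - s \<in> K" using rs(3) by (simp add: algebra_simps)
    moreover have "r - r \<in> K" using add_subgroup_zero[OF K] by simp
    ultimately show "r = s" using transversal_unique[OF R(1) RL(2)[OF rs(1)]] rs by blast
  qed
  have "bij_betw (\<lambda>r. \<rho> (l + r)) R R"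
    using inj endo_inj_surj[OF R(2) _ inj] \<rho>(1) RL(1) by (auto simp: bij_betw_def)
  then have "(\<Sum>r\<in>R. \<xi> r) = (\<Sum>r\<in>R. \<xi> (\<rho> (l + r)))"
    by (rule sum.reindex_bij_betw[symmetric])
  also have "\<dots> = (\<Sum>r\<in>R. \<xi> l * \<xi> r)"
  proof (rule sum.cong)
    fix r assume r: "r \<in> R"
    have "\<xi> (l + r) = \<xi> (\<rho> (l + r) + (l + r - \<rho> (l + r)))" by simp
    also have "\<dots> = \<xi> (\<rho> (l + r))" unfolding \<xi>(1)[of "\<rho> (l + r)"] using \<rho>(2) RL r \<xi>(2) by simp
    finally show "\<xi> (\<rho> (l + r)) = \<xi> l * \<xi> r" by (simp add: \<xi>(1))
  qed simp
  finally have "(\<Sum>r\<in>R. \<xi> r) = \<xi> l * (\<Sum>r\<in>R. \<xi> r)" unfolding sum_distrib_left[symmetric] .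
  with l(2) have "(\<Sum>r\<in>R. \<xi> r) = 0" by simp
  with False show ?thesis by auto
qed

text \<open>The preceding lemma in the dual group, applied to evaluation at x, which is trivial on
  \<open>annihilator L\<close> because x lies in L.\<close>

lemma sum_dual_transversal:
  fixes K L :: "'g::topological_ab_group_add set"
  assumes "transversal T (annihilator L) (annihilator K)" "finite T" "K \<subseteq> L"
    and "add_subgroup K" "open K" "x \<in> L"
  shows "(\<Sum>t\<in>T. pairing x t) = (if x \<in> K then of_nat (card T) else 0)"
proof -
  have "(\<Sum>t\<in>T. pairing x t) = (if \<forall>\<gamma>\<in>annihilator K. pairing x \<gamma> = 1 then of_nat (card T) else 0)"
    by (rule sum_character_transversal[OF assms(1,2)])
      (use assms in \<open>auto simp: add_subgroup_annihilator annihilator_antimono pairing_add_right\<close>,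
       auto simp: annihilator_def)
  then show ?thesis by (simp add: annihilator_detects[OF assms(4,5)])
qed

text \<open>The cardinalities agree by summing the character table over T and R in both orders, but
  T must first be known to be finite. For that, characters in T are orthogonal as vectors indexed by
  R, which limits their number to the dimension \<open>card R\<close>.\<close>

lemma card_dual_transversal:
  fixes K L :: "'g::topological_ab_group_add set"
  assumes R: "transversal R K L" "finite R" and T: "transversal T (annihilator L) (annihilator K)"
    and KL: "K \<subseteq> L" "add_subgroup K" "open K" "add_subgroup L"
  shows "finite T" and "card T = card R"
proof -
  have TK: "T \<subseteq> annihilator K" using T by (auto simp: transversal_def)
  have sumR: "(\<Sum>r\<in>R. pairing r \<gamma>) = (if \<gamma> \<in> annihilator L then of_nat (card R) else 0)"
    if "\<gamma> \<in> annihilator K" for \<gamma>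
    using sum_character_transversal[OF R KL(4,1,2), of "\<lambda>x. pairing x \<gamma>"] that
    by (simp add: pairing_add_left annihilator_def)
  \<comment> \<open>The representative of K itself: every character in \<open>annihilator K\<close>
    has the value 1 there.\<close>
  obtain r0 where r0: "r0 \<in> R" "r0 \<in> K"
  proof -
    have "0 \<in> L" using add_subgroup_zero[OF KL(4)] .
    then obtain r where "r \<in> R" "0 - r \<in> K" using R(1) unfolding transversal_def by blast
    then show ?thesis using that add_subgroup_uminus[OF KL(2), of "- r"] by simp
  qed
  have bound: "card F \<le> card R" if F: "finite F" "F \<subseteq> T" for F
  proof -
    have orth: "(\<Sum>r\<in>R. pairing r t * cnj (pairing r u)) = (if t = u then of_nat (card R) else 0)"
      if tu: "t \<in> F" "u \<in> F" for t u
    proof -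
      have tu': "t \<in> T" "u \<in> T" "t \<in> annihilator K" "u \<in> annihilator K" using tu F(2) TK by auto
      have "t - u \<in> annihilator L \<longleftrightarrow> t = u"
        using transversal_unique[OF T tu'(3) tu'(2) _ tu'(1)] add_subgroup_zero[OF add_subgroup_annihilator]
        by (metis diff_self)
      moreover have "t - u \<in> annihilator K"
        using tu' by (intro add_subgroup_diff add_subgroup_annihilator)
      ultimately show ?thesis using sumR[of "t - u"] by (simp add: pairing_diff_right)
    qed
    \<comment> \<open>By orthogonality the squared norm of the sum of the vectors in F is |F| |R|,
      while its entry at \<open>r0\<close> alone contributes |F|^2.\<close>
    have "(\<Sum>r\<in>R. complex_of_real ((norm (\<Sum>t\<in>F. pairing r t))\<^sup>2))
        = (\<Sum>r\<in>R. \<Sum>t\<in>F. \<Sum>u\<in>F. pairing r t * cnj (pairing r u))"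
      by (simp only: complex_norm_square cnj_sum sum_product)
    also have "\<dots> = (\<Sum>t\<in>F. \<Sum>u\<in>F. \<Sum>r\<in>R. pairing r t * cnj (pairing r u))"
      by (subst sum.swap, rule sum.cong[OF refl], subst sum.swap, rule refl)
    also have "\<dots> = (\<Sum>t\<in>F. \<Sum>u\<in>F. if t = u then of_nat (card R) else 0)"
      using orth by (intro sum.cong refl) auto
    also have "\<dots> = complex_of_real (real (card F) * real (card R))" using F(1) by simp
    finally have "(\<Sum>r\<in>R. (norm (\<Sum>t\<in>F. pairing r t))\<^sup>2) = real (card F) * real (card R)"
      unfolding of_real_sum[symmetric] of_real_eq_iff .
    moreover have "(norm (\<Sum>t\<in>F. pairing r0 t))\<^sup>2 \<le> (\<Sum>r\<in>R. (norm (\<Sum>t\<in>F. pairing r t))\<^sup>2)"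
      using R(2) r0(1) by (intro member_le_sum) auto
    moreover have "(\<Sum>t\<in>F. pairing r0 t) = of_nat (card F)"
      using r0(2) F(2) TK by (subst sum.cong[OF refl, of _ _ "\<lambda>_. 1"]) (auto simp: annihilator_def)
    ultimately have "real (card F) * real (card F) \<le> real (card F) * real (card R)"
      by (simp add: power2_eq_square)
    then show ?thesis
      by (cases "card F = 0") (auto simp: mult_le_cancel_left)
  qed
  show fin: "finite T"
  proof (rule ccontr)
    assume "infinite T"
    then obtain F where "F \<subseteq> T" "finite F" "card F = Suc (card R)"
      using infinite_arbitrarily_large by metis
    with bound show False by fastforce
  qed
  have sumT: "(\<Sum>t\<in>T. pairing r t) = (if r \<in> K then of_nat (card T) else 0)" if "r \<in> R" for r
    using sum_dual_transversal[OF T fin KL(1,2,3)] that R(1) by (auto simp: transversal_def)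
  have "0 \<in> annihilator K" by (simp add: annihilator_def)
  then obtain t0 where t0: "t0 \<in> T" "- t0 \<in> annihilator L"
    and u0: "\<And>t. t \<in> T \<Longrightarrow> - t \<in> annihilator L \<Longrightarrow> t = t0"
    using T unfolding transversal_def by (metis diff_0)
  have t0': "t \<in> annihilator L \<longleftrightarrow> t = t0" if "t \<in> T" for t
    using that t0 u0 add_subgroup_uminus[OF add_subgroup_annihilator] by (metis minus_minus)
  have r0': "r \<in> K \<longleftrightarrow> r = r0" if "r \<in> R" for r
    using that r0 transversal_unique[OF R(1), of 0 r r0] add_subgroup_zero[OF KL(4)]
      add_subgroup_uminus[OF KL(2)] by auto
  \<comment> \<open>Summing over R first leaves only the representative \<open>t0\<close> of the
    trivial class and gives |R|; summing over T first leaves only \<open>r0\<close> and gives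
    |T|.\<close>
  have "(\<Sum>t\<in>T. \<Sum>r\<in>R. pairing r t) = (\<Sum>t\<in>T. if t = t0 then of_nat (card R) else 0)"
    using TK t0' by (intro sum.cong refl) (auto simp: sumR)
  also have "\<dots> = of_nat (card R)" using fin t0 by simp
  finally have 1: "(\<Sum>t\<in>T. \<Sum>r\<in>R. pairing r t) = of_nat (card R)" .
  have "(\<Sum>r\<in>R. \<Sum>t\<in>T. pairing r t) = (\<Sum>r\<in>R. if r = r0 then of_nat (card T) else 0)"
    using r0' by (intro sum.cong refl) (auto simp: sumT)
  also have "\<dots> = of_nat (card T)" using R(2) r0 by simp
  finally have "(of_nat (card T) :: complex) = of_nat (card R)" using 1 sum.swap by metis
  then show "card T = card R" by simp
qed

section \<open>The seminormed space of square-integrable functions\<close>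

lemma L2D:
  assumes "f \<in> L2 M"
  shows L2_measurable: "f \<in> borel_measurable M"
    and L2_integrable: "integrable M (\<lambda>x. (norm (f x))\<^sup>2)"
  using assms by (auto simp: L2_def)

lemma L2_bound:
  assumes "g \<in> borel_measurable M" "integrable M h" "\<And>x. (norm (g x))\<^sup>2 \<le> h x"
  shows "g \<in> L2 M"
  unfolding L2_def
proof (intro CollectI conjI assms(1))
  show "integrable M (\<lambda>x. (norm (g x))\<^sup>2)"
    by (rule Bochner_Integration.integrable_bound[OF assms(2)])
      (use assms(1,3) in \<open>auto intro!: AE_I2 order_trans[OF assms(3)]\<close>)
qed

text \<open>The weight t stays free: t = 1 gives closure of \<open>L2\<close> under sums, and an
  optimised t gives the triangle inequality without Cauchy-Schwarz.\<close>

lemma norm_add_sq_le: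
  fixes a b :: complex
  assumes "t > 0"
  shows "(norm (a + b))\<^sup>2 \<le> (1 + t) * (norm a)\<^sup>2 + (1 + 1 / t) * (norm b)\<^sup>2"
proof -
  have "(norm (a + b))\<^sup>2 \<le> (norm a + norm b)\<^sup>2"
    by (intro power_mono norm_triangle_ineq) auto
  also have "\<dots> = (norm a)\<^sup>2 + (norm b)\<^sup>2 + 2 * norm a * norm b" by (simp add: power2_sum)
  also have "2 * norm a * norm b \<le> t * (norm a)\<^sup>2 + (norm b)\<^sup>2 / t"
  proof -
    have "0 \<le> (t * norm a - norm b)\<^sup>2 / t" using assms by simp
    also have "\<dots> = t * (norm a)\<^sup>2 + (norm b)\<^sup>2 / t - 2 * norm a * norm b"
      using assms by (simp add: power2_diff field_simps power2_eq_square)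
    finally show ?thesis by simp
  qed
  finally show ?thesis by (simp add: algebra_simps)
qed

lemma L2_add:
  assumes "f \<in> L2 M" "g \<in> L2 M"
  shows "(\<lambda>x. f x + g x) \<in> L2 M"
proof (rule L2_bound[where h = "\<lambda>x. 2 * (norm (f x))\<^sup>2 + 2 * (norm (g x))\<^sup>2"])
  show "(norm (f x + g x))\<^sup>2 \<le> 2 * (norm (f x))\<^sup>2 + 2 * (norm (g x))\<^sup>2" for x
    using norm_add_sq_le[of 1 "f x" "g x"] by simp
qed (use assms[THEN L2_measurable] assms[THEN L2_integrable] in auto)

lemma L2_scale:
  assumes "f \<in> L2 M"
  shows "(\<lambda>x. c * f x) \<in> L2 M"
  by (rule L2_bound[where h = "\<lambda>x. (norm c)\<^sup>2 * (norm (f x))\<^sup>2"])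
    (use L2D[OF assms] in \<open>auto simp: norm_mult power_mult_distrib\<close>)

lemma L2_diff: "f \<in> L2 M \<Longrightarrow> g \<in> L2 M \<Longrightarrow> (\<lambda>x. f x - g x) \<in> L2 M"
  using L2_add[of f M "\<lambda>x. (-1) * g x"] L2_scale[of g M "-1"] by simp

lemma L2_zero: "(\<lambda>_. 0) \<in> L2 M" by (simp add: L2_def)

lemma L2_sum: "(\<And>i. i \<in> J \<Longrightarrow> f i \<in> L2 M) \<Longrightarrow> (\<lambda>x. \<Sum>i\<in>J. f i x) \<in> L2 M"
  by (induction J rule: infinite_finite_induct) (auto intro: L2_add L2_zero)

lemma norm_L2_nonneg [simp]: "norm_L2 M f \<ge> 0" by (simp add: norm_L2_def)

lemma norm_L2_sq: "(norm_L2 M f)\<^sup>2 = (LINT x|M. (norm (f x))\<^sup>2)" by (simp add: norm_L2_def)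

lemma norm_L2_zero [simp]: "norm_L2 M (\<lambda>_. 0) = 0" by (simp add: norm_L2_def)

lemma norm_L2_scale: "norm_L2 M (\<lambda>x. c * f x) = norm c * norm_L2 M f"
  by (simp add: norm_L2_def norm_mult power_mult_distrib real_sqrt_mult)

lemma norm_L2_minus_commute: "norm_L2 M (\<lambda>x. f x - g x) = norm_L2 M (\<lambda>x. g x - f x)"
  by (simp add: norm_L2_def norm_minus_commute)

lemma norm_L2_cong_AE:
  assumes "f \<in> borel_measurable M" "g \<in> borel_measurable M" "AE x in M. f x = g x"
  shows "norm_L2 M f = norm_L2 M g"
  unfolding norm_L2_def by (rule arg_cong[of _ _ sqrt], rule integral_cong_AE) (use assms in auto)

lemma L2_cong_AE:
  assumes "f \<in> L2 M" "g \<in> borel_measurable M" "AE x in M. f x = g x"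
  shows "g \<in> L2 M"
proof -
  have "integrable M (\<lambda>x. (norm (f x))\<^sup>2) \<longleftrightarrow> integrable M (\<lambda>x. (norm (g x))\<^sup>2)"
    by (rule integrable_cong_AE) (use assms L2_measurable[OF assms(1)] in auto)
  with assms show ?thesis by (simp add: L2_def)
qed

lemma norm_L2_eq_0_iff:
  assumes "f \<in> L2 M"
  shows "norm_L2 M f = 0 \<longleftrightarrow> (AE x in M. f x = 0)"
  unfolding norm_L2_def using integral_nonneg_eq_0_iff_AE[OF L2_integrable[OF assms]] by auto

lemma norm_L2_triangle:
  assumes "f \<in> L2 M" "g \<in> L2 M"
  shows "norm_L2 M (\<lambda>x. f x + g x) \<le> norm_L2 M f + norm_L2 M g"
proof (rule field_le_epsilon)
  fix e :: real assume e: "e > 0"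
  \<comment> \<open>The optimal weight is the ratio of the two norms. Enlarging both by e / 2 keeps
    the ratio meaningful when a norm is 0.\<close>
  define a b u v where "a = norm_L2 M f" "b = norm_L2 M g" "u = a + e / 2" "v = b + e / 2"
  note [simp] = L2_integrable[OF assms(1)] L2_integrable[OF assms(2)]
  have pos: "a \<ge> 0" "b \<ge> 0" "u > 0" "v > 0" "a \<le> u" "b \<le> v"
    using e by (auto simp: a_b_u_v_def add_nonneg_pos)
  have "(norm_L2 M (\<lambda>x. f x + g x))\<^sup>2
      \<le> (LINT x|M. (1 + v / u) * (norm (f x))\<^sup>2 + (1 + 1 / (v / u)) * (norm (g x))\<^sup>2)"
    unfolding norm_L2_sq using pos
    by (intro integral_mono L2_integrable[OF L2_add[OF assms]] norm_add_sq_le) auto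
  also have "\<dots> = (1 + v / u) * a\<^sup>2 + (1 + u / v) * b\<^sup>2"
    by (simp add: a_b_u_v_def(1,2) norm_L2_sq)
  also have "\<dots> \<le> (1 + v / u) * u\<^sup>2 + (1 + u / v) * v\<^sup>2"
    using pos by (intro add_mono mult_left_mono power_mono) auto
  also have "\<dots> = (u + v)\<^sup>2" using pos by (simp add: field_simps power2_eq_square)
  finally have "norm_L2 M (\<lambda>x. f x + g x) \<le> u + v"
    using pos by (simp add: power2_le_iff_abs_le)
  then show "norm_L2 M (\<lambda>x. f x + g x) \<le> norm_L2 M f + norm_L2 M g + e"
    by (simp add: a_b_u_v_def)
qed

lemma norm_L2_triangle_diff:
  assumes "f \<in> L2 M" "g \<in> L2 M" "h \<in> L2 M"
  shows "norm_L2 M (\<lambda>x. f x - h x) \<le> norm_L2 M (\<lambda>x. f x - g x) + norm_L2 M (\<lambda>x. g x - h x)"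
  using norm_L2_triangle[OF L2_diff[OF assms(1,2)] L2_diff[OF assms(2,3)]] by simp

lemma norm_L2_tendsto:
  assumes "\<And>n. f n \<in> L2 M" "g \<in> L2 M" "(\<lambda>n. norm_L2 M (\<lambda>x. f n x - g x)) \<longlonglongrightarrow> 0"
  shows "(\<lambda>n. norm_L2 M (f n)) \<longlonglongrightarrow> norm_L2 M g"
proof -
  have "\<bar>norm_L2 M (f n) - norm_L2 M g\<bar> \<le> norm_L2 M (\<lambda>x. f n x - g x)" for n
    using norm_L2_triangle[OF L2_diff[OF assms(1)[of n] assms(2)] assms(2)]
      norm_L2_triangle[OF L2_diff[OF assms(2) assms(1)[of n]] assms(1)[of n]]
      norm_L2_minus_commute[of M g "f n"] by simp
  then have "(\<lambda>n. norm_L2 M (f n) - norm_L2 M g) \<longlonglongrightarrow> 0"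
    by (intro Lim_null_comparison[OF _ assms(3)]) auto
  then show ?thesis by (simp add: LIM_zero_iff)
qed

lemma L2_mult_integrable:
  assumes "f \<in> L2 M" "g \<in> L2 M"
  shows "integrable M (\<lambda>x. f x * cnj (g x))"
proof (rule Bochner_Integration.integrable_bound)
  show "integrable M (\<lambda>x. (norm (f x))\<^sup>2 + (norm (g x))\<^sup>2)"
    using assms[THEN L2_integrable] by auto
  have "norm (f x * cnj (g x)) \<le> (norm (f x))\<^sup>2 + (norm (g x))\<^sup>2" for x
  proof -
    have "2 * (norm (f x) * norm (g x)) \<le> (norm (f x))\<^sup>2 + (norm (g x))\<^sup>2"
      using sum_squares_bound[of "norm (f x)" "norm (g x)"] by (simp add: mult.assoc)
    moreover have "0 \<le> norm (f x) * norm (g x)" by simp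
    ultimately show ?thesis unfolding norm_mult complex_mod_cnj by linarith
  qed
  then show "AE x in M. norm (f x * cnj (g x)) \<le> norm ((norm (f x))\<^sup>2 + (norm (g x))\<^sup>2)"
    by (auto intro!: AE_I2)
  have "(\<lambda>x. cnj (g x)) \<in> borel_measurable M"
    by (rule borel_measurable_continuous_on[OF _ L2_measurable[OF assms(2)]]) (intro continuous_intros)
  then show "(\<lambda>x. f x * cnj (g x)) \<in> borel_measurable M"
    using assms[THEN L2_measurable] by auto
qed

text \<open>Norms of finite combinations depend only on the Gram matrix, so isometry of a linear map
  on a span can be checked on inner products of generators.\<close>

lemma norm_L2_sum_sq:
  assumes "\<And>i. i \<in> J \<Longrightarrow> e i \<in> L2 M"
  shows "complex_of_real ((norm_L2 M (\<lambda>x. \<Sum>i\<in>J. a i * e i x))\<^sup>2)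
      = (\<Sum>i\<in>J. \<Sum>k\<in>J. a i * cnj (a k) * inner_L2 M (e i) (e k))"
proof -
  have "complex_of_real ((norm_L2 M (\<lambda>x. \<Sum>i\<in>J. a i * e i x))\<^sup>2)
      = (LINT x|M. complex_of_real ((norm (\<Sum>i\<in>J. a i * e i x))\<^sup>2))"
    unfolding norm_L2_sq by (rule integral_complex_of_real[symmetric])
  also have "\<dots> = (LINT x|M. (\<Sum>i\<in>J. \<Sum>k\<in>J. (a i * cnj (a k)) * (e i x * cnj (e k x))))"
    unfolding complex_norm_square cnj_sum sum_product by (simp add: mult_ac)
  also have "\<dots> = (\<Sum>i\<in>J. \<Sum>k\<in>J. (a i * cnj (a k)) * (LINT x|M. e i x * cnj (e k x)))"
  proof -
    have int: "integrable M (\<lambda>x. (a i * cnj (a k)) * (e i x * cnj (e k x)))" if "i \<in> J" "k \<in> J" for i k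
      by (intro integrable_mult_right L2_mult_integrable assms that)
    have "(LINT x|M. (\<Sum>i\<in>J. \<Sum>k\<in>J. (a i * cnj (a k)) * (e i x * cnj (e k x))))
        = (\<Sum>i\<in>J. LINT x|M. (\<Sum>k\<in>J. (a i * cnj (a k)) * (e i x * cnj (e k x))))"
      by (rule Bochner_Integration.integral_sum) (rule Bochner_Integration.integrable_sum, rule int)
    also have "\<dots> = (\<Sum>i\<in>J. \<Sum>k\<in>J. LINT x|M. (a i * cnj (a k)) * (e i x * cnj (e k x)))"
      by (rule sum.cong[OF refl], rule Bochner_Integration.integral_sum, rule int)
    finally show ?thesis by simp
  qed
  finally show ?thesis by (simp add: inner_L2_def)
qed

lemma nn_integral_norm_L2:
  assumes "f \<in> L2 M"
  shows "(\<integral>\<^sup>+x. ennreal ((norm (f x))\<^sup>2) \<partial>M) = ennreal ((norm_L2 M f)\<^sup>2)"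
  unfolding norm_L2_sq by (rule nn_integral_eq_integral[OF L2_integrable[OF assms]]) simp

text \<open>Fatou's lemma for the squared moduli. It supplies the limit in the completeness proof
  and bounds Fourier transforms that are known as pointwise limits.\<close>

lemma L2_fatou:
  fixes u :: "nat \<Rightarrow> 'a \<Rightarrow> complex"
  assumes "\<And>n. u n \<in> L2 M" "f \<in> borel_measurable M" "AE x in M. (\<lambda>n. u n x) \<longlonglongrightarrow> f x"
    and "\<And>n. norm_L2 M (u n) \<le> c n" "c \<longlonglongrightarrow> C"
  shows "f \<in> L2 M" and "norm_L2 M f \<le> C"
proof -
  have m: "u n \<in> borel_measurable M" for n using assms(1) by (rule L2_measurable)
  have C: "C \<ge> 0"
    by (rule LIMSEQ_le_const[OF assms(5)]) (use order_trans[OF norm_L2_nonneg assms(4)] in auto)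
  have "(\<integral>\<^sup>+x. ennreal ((norm (f x))\<^sup>2) \<partial>M) = (\<integral>\<^sup>+x. liminf (\<lambda>n. ennreal ((norm (u n x))\<^sup>2)) \<partial>M)"
  proof (rule nn_integral_cong_AE, rule AE_mp[OF assms(3)], rule AE_I2, rule impI)
    fix x assume "(\<lambda>n. u n x) \<longlonglongrightarrow> f x"
    then have "(\<lambda>n. ennreal ((norm (u n x))\<^sup>2)) \<longlonglongrightarrow> ennreal ((norm (f x))\<^sup>2)"
      by (intro tendsto_ennrealI tendsto_intros)
    then show "ennreal ((norm (f x))\<^sup>2) = liminf (\<lambda>n. ennreal ((norm (u n x))\<^sup>2))"
      by (rule lim_imp_Liminf[OF trivial_limit_sequentially, symmetric])
  qed
  also have "\<dots> \<le> liminf (\<lambda>n. \<integral>\<^sup>+x. ennreal ((norm (u n x))\<^sup>2) \<partial>M)"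
    by (rule nn_integral_liminf) (use m in measurable)
  also have "\<dots> \<le> liminf (\<lambda>n. ennreal ((c n)\<^sup>2))"
    using assms(4) by (intro Liminf_mono always_eventually allI)
      (simp add: nn_integral_norm_L2[OF assms(1)] ennreal_leI power_mono)
  also have "\<dots> = ennreal (C\<^sup>2)"
    by (intro lim_imp_Liminf tendsto_ennrealI tendsto_power assms(5)) simp
  finally have le: "(\<integral>\<^sup>+x. ennreal ((norm (f x))\<^sup>2) \<partial>M) \<le> ennreal (C\<^sup>2)" .
  then have "integrable M (\<lambda>x. (norm (f x))\<^sup>2)"
    using assms(2) by (intro integrableI_bounded) (auto simp: le_less_trans)
  with assms(2) show f: "f \<in> L2 M" by (simp add: L2_def)
  from le have "(norm_L2 M f)\<^sup>2 \<le> C\<^sup>2" by (simp add: nn_integral_norm_L2[OF f] ennreal_le_iff)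
  then show "norm_L2 M f \<le> C" using C by (simp add: power2_le_iff_abs_le)
qed

text \<open>Riesz-Fischer for sequences with geometrically decaying increments, which suffices
  because approximants can be chosen that fast. The limit is taken pointwise almost everywhere, and
  Fatou on the tails makes it a limit in norm.\<close>

lemma L2_complete_fast:
  fixes F :: "nat \<Rightarrow> 'a \<Rightarrow> complex"
  assumes F: "\<And>n. F n \<in> L2 M" and fast: "\<And>n. norm_L2 M (\<lambda>x. F (Suc n) x - F n x) \<le> (1 / 2) ^ n"
  shows "\<exists>G\<in>L2 M. (\<lambda>n. norm_L2 M (\<lambda>x. F n x - G x)) \<longlonglongrightarrow> 0"
proof -
  define \<Delta> where "\<Delta> n = (\<lambda>x. F (Suc n) x - F n x)" for n
  have \<Delta>: "\<Delta> n \<in> L2 M" for n unfolding \<Delta>_def by (intro L2_diff F)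
  have m\<Delta>: "\<Delta> n \<in> borel_measurable M" for n using \<Delta> by (rule L2_measurable)
  text \<open>The weights \<open>2\<^sup>n\<close> keep the sum of the squares integrable and yet force geometric decay of
    the increments at almost every point.\<close>
  have "(\<integral>\<^sup>+x. (\<Sum>n. ennreal (2 ^ n * (norm (\<Delta> n x))\<^sup>2)) \<partial>M)
      = (\<Sum>n. \<integral>\<^sup>+x. ennreal (2 ^ n * (norm (\<Delta> n x))\<^sup>2) \<partial>M)"
    by (rule nn_integral_suminf) (use m\<Delta> in measurable)
  also have "\<dots> = (\<Sum>n. ennreal (2 ^ n * (norm_L2 M (\<Delta> n))\<^sup>2))"
    using m\<Delta> by (simp add: ennreal_mult nn_integral_cmult nn_integral_norm_L2[OF \<Delta>])
  also have "\<dots> \<le> (\<Sum>n. ennreal ((1 / 2) ^ n))"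
  proof (rule suminf_le)
    fix n
    have "2 ^ n * (norm_L2 M (\<Delta> n))\<^sup>2 \<le> 2 ^ n * ((1 / 2) ^ n)\<^sup>2"
      using fast[of n] by (intro mult_left_mono power_mono) (auto simp: \<Delta>_def)
    also have "\<dots> = (1 / 2) ^ n" by (simp add: power2_eq_square power_one_over field_simps)
    finally show "ennreal (2 ^ n * (norm_L2 M (\<Delta> n))\<^sup>2) \<le> ennreal ((1 / 2) ^ n)"
      by (rule ennreal_leI)
  qed auto
  also have "\<dots> < \<infinity>"
    by (subst suminf_ennreal2) (auto intro!: summable_geometric)
  finally have fin: "(\<integral>\<^sup>+x. (\<Sum>n. ennreal (2 ^ n * (norm (\<Delta> n x))\<^sup>2)) \<partial>M) \<noteq> \<infinity>" by auto
  have "AE x in M. (\<Sum>n. ennreal (2 ^ n * (norm (\<Delta> n x))\<^sup>2)) \<noteq> \<infinity>"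
    by (rule nn_integral_PInf_AE[OF _ fin]) (use m\<Delta> in measurable)
  then have conv: "AE x in M. convergent (\<lambda>n. F n x)"
  proof (rule AE_mp, intro AE_I2 impI)
    fix x assume S: "(\<Sum>n. ennreal (2 ^ n * (norm (\<Delta> n x))\<^sup>2)) \<noteq> \<infinity>"
    have "\<exists>c\<ge>0. S = ennreal c" if "S \<noteq> \<infinity>" for S
      using that by (cases S) auto
    from this[OF S] obtain c where c: "(\<Sum>n. ennreal (2 ^ n * (norm (\<Delta> n x))\<^sup>2)) = ennreal c" "c \<ge> 0"
      by (elim exE conjE)
    have "norm (\<Delta> n x) \<le> sqrt c * sqrt (1 / 2) ^ n" for n
    proof -
      have "ennreal (2 ^ n * (norm (\<Delta> n x))\<^sup>2) \<le> ennreal c"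
        unfolding c(1)[symmetric]
        by (rule order_trans[OF _ sum_le_suminf[of _ "{n}"]]) (simp_all only: sum.insert finite.intros empty_iff
            not_False_eq_True sum.empty add_0_right order_refl summableI zero_le)
      then have "2 ^ n * (norm (\<Delta> n x))\<^sup>2 \<le> c" using c(2) by (simp add: ennreal_le_iff)
      then have "(norm (\<Delta> n x))\<^sup>2 \<le> c * (1 / 2) ^ n"
        unfolding power_one_over by (simp only: times_divide_eq_right mult_1_right) (subst pos_le_divide_eq, auto simp: mult.commute)
      then have "norm (\<Delta> n x) \<le> sqrt (c * (1 / 2) ^ n)" by (rule real_le_rsqrt)
      then show ?thesis by (simp add: real_sqrt_mult real_sqrt_power)
    qed
    moreover have "sqrt (1 / 2) < (1 :: real)" by simp
    then have "summable (\<lambda>n. sqrt c * sqrt (1 / 2) ^ n)"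
      by (intro summable_mult summable_geometric) simp
    ultimately have "summable (\<lambda>n. \<Delta> n x)"
      by (rule summable_comparison_test'[rotated])
    then have "convergent (\<lambda>n. \<Sum>k<n. F (Suc k) x - F k x)"
      by (simp add: \<Delta>_def summable_iff_convergent)
    then have "convergent (\<lambda>n. F n x - F 0 x)" by (simp add: sum_lessThan_telescope[of "\<lambda>k. F k x"])
    from convergent_add[OF this convergent_const[of "F 0 x"]] show "convergent (\<lambda>n. F n x)" by simp
  qed
  define G where "G x = lim (\<lambda>n. F n x)" for x
  have mG: "G \<in> borel_measurable M"
    unfolding G_def by (rule borel_measurable_lim_metric) (rule L2_measurable[OF F])
  have lim: "AE x in M. (\<lambda>n. F n x) \<longlonglongrightarrow> G x"
    using conv by eventually_elim (simp add: G_def convergent_LIMSEQ_iff)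
  \<comment> \<open>The subtracted term is the remainder of the geometric series; it makes the
    induction close and is dropped afterwards.\<close>
  have tail: "norm_L2 M (\<lambda>x. F (n + m) x - F n x) \<le> 2 * (1 / 2) ^ n - 2 * (1 / 2) ^ (n + m)" for n m
  proof (induction m)
    case (Suc m)
    have "norm_L2 M (\<lambda>x. F (n + Suc m) x - F n x)
        \<le> norm_L2 M (\<lambda>x. F (Suc (n + m)) x - F (n + m) x) + norm_L2 M (\<lambda>x. F (n + m) x - F n x)"
      using norm_L2_triangle_diff[OF F[of "Suc (n + m)"] F[of "n + m"] F[of n]] by simp
    also have "\<dots> \<le> (1 / 2) ^ (n + m) + (2 * (1 / 2) ^ n - 2 * (1 / 2) ^ (n + m))"
      by (intro add_mono fast Suc)
    finally show ?case by simp
  qed simp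
  have bound: "(\<lambda>x. G x - F n x) \<in> L2 M" "norm_L2 M (\<lambda>x. G x - F n x) \<le> 2 * (1 / 2) ^ n" for n
  proof -
    have m: "(\<lambda>x. G x - F n x) \<in> borel_measurable M" by (intro borel_measurable_diff mG L2_measurable[OF F])
    have l: "AE x in M. (\<lambda>m. F (n + m) x - F n x) \<longlonglongrightarrow> G x - F n x"
      using lim
    proof eventually_elim
      case (elim x)
      have "(\<lambda>m. F (n + m) x) \<longlonglongrightarrow> G x"
        using LIMSEQ_ignore_initial_segment[OF elim, of n] by (simp add: add.commute)
      then show ?case by (intro tendsto_diff tendsto_const)
    qed
    have b: "norm_L2 M (\<lambda>x. F (n + m) x - F n x) \<le> 2 * (1 / 2) ^ n" for m
      by (rule order_trans[OF tail]) simp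
    show "(\<lambda>x. G x - F n x) \<in> L2 M" "norm_L2 M (\<lambda>x. G x - F n x) \<le> 2 * (1 / 2) ^ n"
      by (rule L2_fatou[OF L2_diff[OF F F] m l b tendsto_const])+
  qed
  have "G \<in> L2 M" using L2_add[OF bound(1)[of 0] F[of 0]] by simp
  moreover have "(\<lambda>n. norm_L2 M (\<lambda>x. F n x - G x)) \<longlonglongrightarrow> 0"
  proof (rule Lim_null_comparison)
    show "\<forall>\<^sub>F n in sequentially. norm (norm_L2 M (\<lambda>x. F n x - G x)) \<le> 2 * (1 / 2) ^ n"
      using bound(2) norm_L2_minus_commute[of M G] by simp
    show "(\<lambda>n. 2 * (1 / 2) ^ n) \<longlonglongrightarrow> (0 :: real)"
      by (intro tendsto_mult_right_zero LIMSEQ_realpow_zero) auto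
  qed
  ultimately show ?thesis by blast
qed

subsection \<open>Closed linear spans\<close>

definition lin_span :: "'i set \<Rightarrow> ('i \<Rightarrow> 'a \<Rightarrow> complex) \<Rightarrow> ('a \<Rightarrow> complex) set" where
  "lin_span I e = {f. \<exists>J c. finite J \<and> J \<subseteq> I \<and> f = (\<lambda>x. \<Sum>i\<in>J. c i * e i x)}"

lemma lin_span_base: "i \<in> I \<Longrightarrow> e i \<in> lin_span I e"
  unfolding lin_span_def by (intro CollectI exI[of _ "{i}"] exI[of _ "\<lambda>_. 1"]) auto

lemma lin_span_zero: "(\<lambda>_. 0) \<in> lin_span I e"
  unfolding lin_span_def by (intro CollectI exI[of _ "{}"]) auto

lemma lin_span_scale:
  assumes "f \<in> lin_span I e"
  shows "(\<lambda>x. a * f x) \<in> lin_span I e"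
proof -
  from assms obtain J c where "finite J" "J \<subseteq> I" "f = (\<lambda>x. \<Sum>i\<in>J. c i * e i x)"
    by (auto simp: lin_span_def)
  then show ?thesis
    unfolding lin_span_def
    by (intro CollectI exI[of _ J] exI[of _ "\<lambda>i. a * c i"]) (auto simp: sum_distrib_left mult.assoc)
qed

lemma lin_span_add:
  assumes "f \<in> lin_span I e" "g \<in> lin_span I e"
  shows "(\<lambda>x. f x + g x) \<in> lin_span I e"
proof -
  from assms obtain J c K d where J: "finite J" "J \<subseteq> I" "f = (\<lambda>x. \<Sum>i\<in>J. c i * e i x)"
    and K: "finite K" "K \<subseteq> I" "g = (\<lambda>x. \<Sum>i\<in>K. d i * e i x)"
    by (auto simp: lin_span_def)
  have "f x + g x = (\<Sum>i\<in>J \<union> K. ((if i \<in> J then c i else 0) + (if i \<in> K then d i else 0)) * e i x)" for x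
  proof -
    have "f x = (\<Sum>i\<in>J \<union> K. (if i \<in> J then c i else 0) * e i x)"
      unfolding J(3) using J(1) K(1) by (intro sum.mono_neutral_cong_left) auto
    moreover have "g x = (\<Sum>i\<in>J \<union> K. (if i \<in> K then d i else 0) * e i x)"
      unfolding K(3) using J(1) K(1) by (intro sum.mono_neutral_cong_left) auto
    ultimately show ?thesis by (simp add: distrib_right sum.distrib)
  qed
  then show ?thesis
    unfolding lin_span_def using J(1,2) K(1,2) by (intro CollectI exI conjI[OF _ conjI]) auto
qed

lemma lin_span_sum:
  "(\<And>i. i \<in> J \<Longrightarrow> f i \<in> lin_span I e) \<Longrightarrow> (\<lambda>x. \<Sum>i\<in>J. f i x) \<in> lin_span I e"
  by (induction J rule: infinite_finite_induct) (auto intro: lin_span_add lin_span_zero)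

lemma lin_span_L2: "(\<And>i. i \<in> I \<Longrightarrow> e i \<in> L2 M) \<Longrightarrow> f \<in> lin_span I e \<Longrightarrow> f \<in> L2 M"
  by (auto simp: lin_span_def intro!: L2_sum L2_scale)

text \<open>Transitivity of approximation: it is enough to approximate each generator, here the
  indicators of cosets by combinations of wavelets.\<close>

lemma lin_span_approx_lin_span:
  assumes e: "\<And>i. i \<in> I \<Longrightarrow> e i \<in> L2 M" and e': "\<And>i. i \<in> I' \<Longrightarrow> e' i \<in> L2 M"
    and approx: "\<And>i \<epsilon>. i \<in> I \<Longrightarrow> \<epsilon> > 0 \<Longrightarrow> \<exists>s\<in>lin_span I' e'. norm_L2 M (\<lambda>x. e i x - s x) < \<epsilon>"
    and f: "f \<in> lin_span I e" and \<epsilon>: "\<epsilon> > 0"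
  shows "\<exists>s\<in>lin_span I' e'. norm_L2 M (\<lambda>x. f x - s x) < \<epsilon>"
proof -
  from f obtain J c where J: "finite J" "J \<subseteq> I" and f: "f = (\<lambda>x. \<Sum>i\<in>J. c i * e i x)"
    by (auto simp: lin_span_def)
  have "\<forall>\<epsilon>>0. \<exists>s\<in>lin_span I' e'. norm_L2 M (\<lambda>x. (\<Sum>i\<in>J. c i * e i x) - s x) < \<epsilon>"
    using J
  proof (induction J rule: finite_induct)
    case empty
    then show ?case using lin_span_zero[of I' e'] by (auto intro!: bexI[of _ "\<lambda>_. 0"])
  next
    case (insert j J)
    show ?case
    proof (intro allI impI)
      fix \<epsilon> :: real assume \<epsilon>: "\<epsilon> > 0"
      with insert obtain s where s: "s \<in> lin_span I' e'"
        "norm_L2 M (\<lambda>x. (\<Sum>i\<in>J. c i * e i x) - s x) < \<epsilon> / 2"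
        by (auto dest: spec[of _ "\<epsilon> / 2"])
      \<comment> \<open>Adding 1 to the modulus of the coefficient avoids a case distinction for
        coefficient 0.\<close>
      have pos: "\<epsilon> / 2 / (norm (c j) + 1) > 0" using \<epsilon> by (simp add: add_nonneg_pos)
      with approx[of j "\<epsilon> / 2 / (norm (c j) + 1)"] insert(4) obtain t where t: "t \<in> lin_span I' e'"
        "norm_L2 M (\<lambda>x. e j x - t x) < \<epsilon> / 2 / (norm (c j) + 1)"
        by auto
      have L: "(\<lambda>x. e j x - t x) \<in> L2 M" "(\<lambda>x. (\<Sum>i\<in>J. c i * e i x) - s x) \<in> L2 M"
        using insert(4) e s(1) t(1) lin_span_L2[of I' e', OF e']
        by (auto intro!: L2_diff L2_sum L2_scale)
      have "norm_L2 M (\<lambda>x. (\<Sum>i\<in>insert j J. c i * e i x) - (c j * t x + s x))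
        = norm_L2 M (\<lambda>x. c j * (e j x - t x) + ((\<Sum>i\<in>J. c i * e i x) - s x))"
        using insert(1,2) by (simp add: algebra_simps)
      also have "\<dots> \<le> norm (c j) * norm_L2 M (\<lambda>x. e j x - t x)
          + norm_L2 M (\<lambda>x. (\<Sum>i\<in>J. c i * e i x) - s x)"
        using norm_L2_triangle[OF L2_scale[OF L(1), of "c j"] L(2)] by (simp add: norm_L2_scale)
      also have "norm (c j) * norm_L2 M (\<lambda>x. e j x - t x)
          \<le> (norm (c j) + 1) * (\<epsilon> / 2 / (norm (c j) + 1))"
        using t(2) by (intro mult_mono) auto
      also have "(norm (c j) + 1) * (\<epsilon> / 2 / (norm (c j) + 1)) = \<epsilon> / 2"
        by (rule nonzero_mult_div_cancel_left[of "norm (c j) + 1" "\<epsilon> / 2", simplified times_divide_eq_right[symmetric]])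
          (use norm_ge_zero[of "c j"] in linarith)
      finally have "norm_L2 M (\<lambda>x. (\<Sum>i\<in>insert j J. c i * e i x) - (c j * t x + s x)) < \<epsilon>"
        using s(2) by simp
      moreover have "(\<lambda>x. c j * t x + s x) \<in> lin_span I' e'"
        by (intro lin_span_add lin_span_scale s t)
      ultimately show "\<exists>s\<in>lin_span I' e'. norm_L2 M (\<lambda>x. (\<Sum>i\<in>insert j J. c i * e i x) - s x) < \<epsilon>"
        by (rule bexI)
    qed
  qed
  with \<epsilon> f show ?thesis by blast
qed

section \<open>Translation-invariant measures\<close>

text \<open>Isolates what the lemmas of this section rest on, so that they apply alike to
  \<open>\<mu>\<close> on G and to \<open>\<nu>\<close> on the dual.\<close>

definition translation_invariant :: "'g::topological_ab_group_add measure \<Rightarrow> bool" where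
  "translation_invariant M \<longleftrightarrow> sets M = sets borel \<and> (\<forall>c. \<forall>B\<in>sets borel. emeasure M ((+) c ` B) = emeasure M B)"

lemma haar_measure_translation_invariant: "haar_measure M \<Longrightarrow> translation_invariant M"
  by (auto simp: haar_measure_def translation_invariant_def)

context
  fixes M :: "'g::topological_ab_group_add measure"
  assumes M: "translation_invariant M"
begin

lemma sets_translation_invariant: "sets M = sets borel"
  using M by (simp add: translation_invariant_def)

lemma space_translation_invariant [simp]: "space M = UNIV"
  using sets_eq_imp_space_eq[OF sets_translation_invariant] by simp

lemma measurable_translation_invariant: "borel_measurable M = borel_measurable borel"
  by (rule measurable_cong_sets) (simp_all add: sets_translation_invariant)

lemma continuous_translation: "continuous_on UNIV (\<lambda>x. c + x :: 'g)"
  by (intro continuous_intros)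

lemma translation_measurable: "(\<lambda>x. c + x) \<in> measurable M M"
proof -
  have "(\<lambda>x::'g. c + x) \<in> measurable borel borel"
    by (intro borel_measurable_continuous_onI continuous_translation)
  then show ?thesis
    using measurable_cong_sets[OF sets_translation_invariant sets_translation_invariant] by blast
qed

lemma distr_translation: "distr M M (\<lambda>x. c + x) = M"
proof (rule measure_eqI)
  fix B assume B: "B \<in> sets (distr M M (\<lambda>x. c + x))"
  have eq: "(\<lambda>x. c + x) -` B = (+) (- c) ` B"
    by (auto intro!: image_eqI[of _ _ "c + _"])
  have "emeasure (distr M M (\<lambda>x. c + x)) B = emeasure M ((\<lambda>x. c + x) -` B)"
    using B by (subst emeasure_distr) (auto intro: translation_measurable)
  also have "\<dots> = emeasure M B"
    unfolding eq using B M by (simp only: translation_invariant_def sets_distr)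
  finally show "emeasure (distr M M (\<lambda>x. c + x)) B = emeasure M B" .
qed simp

lemma integral_translation:
  fixes f :: "'g \<Rightarrow> complex"
  assumes "f \<in> borel_measurable M"
  shows "(LINT x|M. f (c + x)) = (LINT x|M. f x)"
  using integral_distr[OF translation_measurable assms, of c] by (simp add: distr_translation)

text \<open>Translation by c fixes the integral and also multiplies it by z. Orthogonality of
  wavelets at different scales or with different characters amounts to finding such a c.\<close>

lemma integral_twisted_eq_0:
  fixes f :: "'g \<Rightarrow> complex"
  assumes "f \<in> borel_measurable M" "\<And>x. f (c + x) = z * f x" "z \<noteq> 1"
  shows "(LINT x|M. f x) = 0"
  using integral_translation[OF assms(1), of c] assms(2,3) by simp

lemma sets_coset:
  fixes U :: "'g set"
  assumes "U \<in> sets borel"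
  shows "coset c U \<in> sets borel"
proof -
  have "coset c U = (\<lambda>x. - c + x) -` U" by (auto simp: mem_coset_iff)
  also have "\<dots> \<in> sets M"
    using measurable_sets[OF translation_measurable, of U "- c"] assms
    by (simp add: sets_translation_invariant)
  finally show ?thesis by (simp add: sets_translation_invariant)
qed

lemma emeasure_coset: "U \<in> sets borel \<Longrightarrow> emeasure M (coset c U) = emeasure M U"
  using M by (simp add: translation_invariant_def coset_def)

lemma measure_coset: "U \<in> sets borel \<Longrightarrow> measure M (coset c U) = measure M U"
  by (simp add: measure_def emeasure_coset)

text \<open>If \<open>\<xi>\<close> is nontrivial on U, translation by an element of U fixes the
  coset and twists the integral; otherwise \<open>\<xi>\<close> is constant on the coset. The
  general form covers conjugated characters of G and evaluations on the dual.\<close>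

lemma integral_coset_character:
  fixes \<xi> :: "'g \<Rightarrow> complex"
  assumes U: "U \<in> sets borel" "add_subgroup U"
    and \<xi>: "\<xi> \<in> borel_measurable borel" "\<And>x y. \<xi> (x + y) = \<xi> x * \<xi> y"
  shows "(LINT x|M. indicator (coset c U) x * \<xi> x)
    = (if \<forall>u\<in>U. \<xi> u = 1 then \<xi> c * of_real (measure M U) else 0)"
proof (cases "\<forall>u\<in>U. \<xi> u = 1")
  case True
  have "indicator (coset c U) x * \<xi> x = \<xi> c * of_real (indicator (coset c U) x)" for x
  proof (cases "x \<in> coset c U")
    case x: True
    then have "\<xi> (c + (x - c)) = \<xi> c" unfolding \<xi>(2)[of c] using True by (simp add: mem_coset_iff)
    with x show ?thesis by simp
  qed simp
  then have "(LINT x|M. indicator (coset c U) x * \<xi> x)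
      = \<xi> c * (LINT x|M. of_real (indicator (coset c U) x))"
    by simp
  also have "\<dots> = \<xi> c * of_real (measure M U)"
    by (simp only: integral_complex_of_real) (simp add: measure_coset[OF U(1)])
  finally show ?thesis using True by simp
next
  case False
  then obtain u where u: "u \<in> U" "\<xi> u \<noteq> 1" by blast
  have "(LINT x|M. indicator (coset c U) x * \<xi> x) = 0"
  proof (rule integral_twisted_eq_0[where c = u and z = "\<xi> u"])
    show "(\<lambda>x. indicator (coset c U) x * \<xi> x) \<in> borel_measurable M"
      using sets_coset[OF U(1)] \<xi>(1) unfolding measurable_translation_invariant
      by (intro borel_measurable_times borel_measurable_indicator) auto
    fix x
    have "u + x \<in> coset c U \<longleftrightarrow> x \<in> coset c U"
      using add_subgroup_add_cancel(1)[OF U(2) u(1), of "x - c"] by (simp add: mem_coset_iff add_diff_eq)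
    then show "indicator (coset c U) (u + x) * \<xi> (u + x) = \<xi> u * (indicator (coset c U) x * \<xi> x)"
      by (simp add: \<xi>(2) indicator_def)
  qed (rule u)
  with False show ?thesis by auto
qed

lemma emeasure_transversal:
  assumes R: "transversal R K L" "finite R" and L: "add_subgroup L" "K \<subseteq> L" and K: "K \<in> sets borel"
  shows "emeasure M L = of_nat (card R) * emeasure M K"
proof -
  have "emeasure M L = emeasure M (\<Union>r\<in>R. coset r K)"
    using transversal_union[OF R(1) L] by simp
  also have "\<dots> = (\<Sum>r\<in>R. emeasure M (coset r K))"
    using sets_coset[OF K] R(2) transversal_disjoint[OF R(1) L]
    by (intro sum_emeasure[symmetric]) (auto simp: sets_translation_invariant)
  also have "\<dots> = of_nat (card R) * emeasure M K"
    by (simp add: emeasure_coset[OF K])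
  finally show ?thesis .
qed

end

section \<open>Powers of automorphisms\<close>

lemma AutD:
  assumes "A \<in> Aut"
  shows Aut_add: "\<And>x y. A (x + y) = A x + A y"
    and Aut_bij: "bij A"
    and Aut_continuous: "continuous_on UNIV A"
proof -
  from assms have A: "Modules.additive A" "homeomorphism UNIV UNIV A (inv A)" by (auto simp: Aut_def)
  show "A (x + y) = A x + A y" for x y using additive.add[OF A(1)] .
  show "bij A" using A(2) by (metis bij_betw_def homeomorphism_def inj_on_inverseI UNIV_I)
  show "continuous_on UNIV A" using A(2) by (simp add: homeomorphism_def)
qed

lemma Aut_inv:
  assumes "A \<in> Aut"
  shows "inv A \<in> Aut"
proof -
  have b: "bij A" using Aut_bij[OF assms] .
  have "inv A (x + y) = inv A x + inv A y" for x y
  proof -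
    have "A (inv A x + inv A y) = x + y"
      by (simp add: Aut_add[OF assms] surj_f_inv_f[OF bij_is_surj[OF b]])
    then show ?thesis using inv_f_f[OF bij_is_inj[OF b], of "inv A x + inv A y"] by simp
  qed
  moreover have "homeomorphism UNIV UNIV (inv A) (inv (inv A))"
    using assms b by (auto simp: Aut_def inv_inv_eq intro: homeomorphism_symD)
  ultimately show ?thesis by (auto simp: Aut_def Modules.additive_def)
qed

lemma Aut_comp:
  assumes "A \<in> Aut" "B \<in> Aut"
  shows "A \<circ> B \<in> Aut"
proof -
  have "homeomorphism UNIV UNIV (A \<circ> B) (inv B \<circ> inv A)"
    using assms homeomorphism_compose[of UNIV UNIV B "inv B" UNIV A "inv A"] by (auto simp: Aut_def)
  moreover have "inv (A \<circ> B) = inv B \<circ> inv A"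
    using assms by (intro o_inv_distrib Aut_bij)
  ultimately show ?thesis using Aut_add[OF assms(1)] Aut_add[OF assms(2)]
    by (auto simp: Aut_def Modules.additive_def)
qed

lemma Aut_id: "id \<in> Aut"
  by (auto simp: Aut_def Modules.additive_def inv_id homeomorphism_def)

lemma Aut_funpow: "A \<in> Aut \<Longrightarrow> A ^^ n \<in> Aut"
  by (induction n) (auto intro: Aut_comp Aut_id)

lemma Aut_aut_power: "A \<in> Aut \<Longrightarrow> aut_power A n \<in> Aut"
  by (auto simp: aut_power_def intro: Aut_funpow Aut_inv)

lemma aut_power_0 [simp]: "aut_power A 0 x = x" by (simp add: aut_power_def)

lemma aut_power_plus_1:
  assumes "bij A"
  shows "aut_power A (n + 1) x = A (aut_power A n x)"
proof (cases "n \<ge> 0")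
  case True
  then have "nat (n + 1) = Suc (nat n)" by simp
  then show ?thesis using True by (simp add: aut_power_def)
next
  case False
  then have n: "nat (- n) = Suc (nat (- (n + 1)))" by simp
  have "A (aut_power A n x) = (inv A ^^ nat (- (n + 1))) x"
    unfolding aut_power_def n using False assms by (simp add: bij_is_surj surj_f_inv_f)
  then show ?thesis using False by (cases "n = -1") (auto simp: aut_power_def)
qed

lemma aut_power_1 [simp]: "bij A \<Longrightarrow> aut_power A 1 x = A x"
  using aut_power_plus_1[of A 0 x] by simp

lemma aut_power_add:
  assumes "bij A"
  shows "aut_power A (m + n) x = aut_power A m (aut_power A n x)"
proof (induction m rule: int_induct[where k = 0])
  case base then show ?case by simp
next
  case (step1 i)
  have "i + 1 + n = (i + n) + 1" by simp
  then show ?case by (simp only: aut_power_plus_1[OF assms] step1(2))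
next
  case (step2 i)
  have "i - 1 + n + 1 = i + n" "i - 1 + 1 = i" by simp_all
  then have "A (aut_power A (i - 1 + n) x) = A (aut_power A (i - 1) (aut_power A n x))"
    by (metis aut_power_plus_1[OF assms] step2(2))
  then show ?case using assms by (simp only: bij_is_inj inj_eq)
qed

lemma aut_power_image_eq_vimage:
  assumes "bij A"
  shows "aut_power A n ` S = {x. aut_power A (- n) x \<in> S}"
proof -
  have "aut_power A n (aut_power A (- n) x) = x" "aut_power A (- n) (aut_power A n x) = x" for x
    using aut_power_add[OF assms, of n "- n" x] aut_power_add[OF assms, of "- n" n x] by auto
  then show ?thesis by (auto intro!: image_eqI[where x = "aut_power A (- n) _"])
qed

lemma open_image_Aut:
  assumes "A \<in> Aut" "open U"
  shows "open (A ` U)"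
proof -
  have "A ` U = inv A -` U" using Aut_bij[OF assms(1)] by (auto simp: bij_inv_eq_iff surj_f_inv_f bij_is_surj bij_is_inj intro!: image_eqI[where x = "inv A _"])
  with Aut_continuous[OF Aut_inv[OF assms(1)]] assms(2) show ?thesis by (simp add: open_vimage)
qed

text \<open>Downwards the recurrence has to cancel q, which is legitimate in the extended reals
  because q is positive and finite.\<close>

lemma powi_recurrence_ennreal:
  fixes q :: nat
  assumes q: "q > 0" and e0: "e 0 = (1::ennreal)" and step: "\<And>n::int. e (n + 1) = of_nat q * e n"
  shows "e n = ennreal (real q powi n)"
proof (induction n rule: int_induct[where k = 0])
  case base then show ?case using e0 by simp
next
  case (step1 i)
  then show ?case using q
    by (simp add: step power_int_add ennreal_mult mult.commute flip: ennreal_of_nat_eq_real_of_nat)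
next
  case (step2 i)
  have "of_nat q * e (i - 1) = e i" using step[of "i - 1"] by simp
  also have "\<dots> = ennreal (real q * real q powi (i - 1))"
    using step2 q by (simp add: power_int_diff)
  also have "\<dots> = of_nat q * ennreal (real q powi (i - 1))"
    by (simp add: ennreal_mult ennreal_of_nat_eq_real_of_nat)
  finally show ?case using q by (simp add: ennreal_mult_cancel_left)
qed

section \<open>The filtration by the subgroups \<open>K n\<close>, their annihilators and the
  measures of both\<close>

locale expansive_lca =
  fixes H :: "'g::{topological_ab_group_add,t2_space} set"
    and \<mu> :: "'g measure" and \<nu> :: "'g dual measure" and A :: "'g \<Rightarrow> 'g"
  assumes subgroup_H: "add_subgroup H" and compact_H: "compact H" and open_H: "open H"
    and haar_\<mu>: "haar_measure \<mu>" and \<mu>_H: "emeasure \<mu> H = 1"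
    and haar_\<nu>: "haar_measure \<nu>" and \<nu>_H: "emeasure \<nu> (annihilator H) = 1"
    and Aut_A: "A \<in> Aut" and expansive_A: "expansive H A"
begin

lemmas TI_\<mu> = haar_measure_translation_invariant[OF haar_\<mu>]
lemmas TI_\<nu> = haar_measure_translation_invariant[OF haar_\<nu>]
lemmas sets_\<mu> [simp] = sets_translation_invariant[OF TI_\<mu>]
lemmas sets_\<nu> [simp] = sets_translation_invariant[OF TI_\<nu>]
lemmas space_\<mu> [simp] = space_translation_invariant[OF TI_\<mu>]
lemmas space_\<nu> [simp] = space_translation_invariant[OF TI_\<nu>]
lemmas meas_\<mu> = measurable_translation_invariant[OF TI_\<mu>]
lemmas meas_\<nu> = measurable_translation_invariant[OF TI_\<nu>]
lemmas bij_A = Aut_bij[OF Aut_A]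
lemmas Aut_power = Aut_aut_power[OF Aut_A]

lemma outer_regular: "B \<in> sets borel \<Longrightarrow> emeasure \<mu> B = (INF U\<in>{U. open U \<and> B \<subseteq> U}. emeasure \<mu> U)"
  and inner_regular: "open U \<Longrightarrow> emeasure \<mu> U = (SUP K\<in>{K. compact K \<and> K \<subseteq> U}. emeasure \<mu> K)"
  using haar_\<mu> by (auto simp: haar_measure_def)

lemma power_diff: "aut_power A n (x - y) = aut_power A n x - aut_power A n y"
  using Aut_add[OF Aut_power, of n "x - y" y] by (simp add: eq_diff_eq)

lemma power_0_arg [simp]: "aut_power A n 0 = 0"
  using power_diff[of n 0 0] by simp

lemma power_cancel [simp]:
  "aut_power A (- n) (aut_power A n x) = x" "aut_power A n (aut_power A (- n) x) = x"
  using aut_power_add[OF bij_A, of "- n" n x] aut_power_add[OF bij_A, of n "- n" x] by auto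

text \<open>As a preimage under the n-th power, membership is tested in \<open>H\<close> directly;
  the subgroups shrink as n grows.\<close>

definition K :: "int \<Rightarrow> 'g set" where
  "K n = {x. aut_power A n x \<in> H}"

lemma K_0 [simp]: "K 0 = H" by (simp add: K_def)

lemma K_eq_image: "K n = aut_power A (- n) ` H"
  by (simp add: K_def aut_power_image_eq_vimage[OF bij_A])

lemma subgroup_K: "add_subgroup (K n)"
proof -
  have "aut_power A n (- x) = - aut_power A n x" for x using power_diff[of n 0 x] by simp
  then show ?thesis using subgroup_H unfolding add_subgroup_def K_def
    by (simp add: Aut_add[OF Aut_power])
qed

lemma open_K: "open (K n)"
proof -
  have "K n = aut_power A n -` H" by (auto simp: K_def)
  then show ?thesis using open_vimage[OF open_H Aut_continuous[OF Aut_power]] by simp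
qed

lemma borel_K [simp]: "K n \<in> sets borel"
  using open_K by (rule borel_open)

lemma borel_coset_K [simp]: "coset c (K n) \<in> sets borel"
  by (intro borel_open open_coset open_K)

lemma mem_K_shift: "x \<in> K (m + n) \<longleftrightarrow> aut_power A m x \<in> K n"
proof -
  have "aut_power A (n + m) x = aut_power A n (aut_power A m x)" by (rule aut_power_add[OF bij_A])
  then show ?thesis by (simp add: K_def add.commute)
qed

lemma K_plus_1_subset: "K (n + 1) \<subseteq> K n"
proof
  fix x assume "x \<in> K (n + 1)"
  then have "A (aut_power A n x) \<in> H" by (simp add: K_def aut_power_plus_1[OF bij_A])
  then have "A (aut_power A n x) \<in> A ` H" using expansive_A by (auto simp: expansive_def)
  then show "x \<in> K n" using bij_A by (auto simp: K_def dest: injD[OF bij_is_inj])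
qed

lemma K_antimono: "m \<le> n \<Longrightarrow> K n \<subseteq> K m"
proof (induction n rule: int_ge_induct)
  case (step i)
  then show ?case using K_plus_1_subset[of i] by blast
qed simp

lemma K_1_psubset: "\<exists>x\<in>H. x \<notin> K 1"
proof -
  obtain h where "h \<in> H" "A h \<notin> H" using expansive_A by (auto simp: expansive_def)
  then show ?thesis by (auto simp: K_def aut_power_1[OF bij_A])
qed

lemma Inter_K: "(\<Inter>n::nat. K (int n)) = {0}"
proof -
  have "(\<Inter>n::nat. K (int n)) = (\<Inter>n\<in>{..0}. aut_power A n ` H)"
  proof safe
    fix x and n :: int assume x: "x \<in> (\<Inter>n::nat. K (int n))" and n: "n \<le> 0"
    then have "x \<in> K (int (nat (- n)))" by blast
    then show "x \<in> aut_power A n ` H" using n by (simp add: K_eq_image)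
  next
    fix x and n :: nat assume "x \<in> (\<Inter>n\<in>{..0}. aut_power A n ` H)"
    from INT_D[OF this, of "- int n"] have "x \<in> aut_power A (- int n) ` H" by simp
    then show "x \<in> K (int n)" by (simp add: K_eq_image)
  qed
  then show ?thesis using expansive_A by (simp add: expansive_def)
qed

text \<open>Since the \<open>K n\<close> meet only in 0, the complements cover the compact set
  \<open>H - U\<close>; finitely many suffice, and by nestedness the largest index does.\<close>

lemma K_basis:
  assumes U: "open U" "0 \<in> U"
  shows "\<exists>n::nat. K (int n) \<subseteq> U"
proof -
  have cov: "H - U \<subseteq> (\<Union>n\<in>(UNIV::nat set). - K (int n))"
  proof
    fix x assume "x \<in> H - U"
    then have "x \<notin> (\<Inter>n::nat. K (int n))" unfolding Inter_K using U(2) by auto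
    then show "x \<in> (\<Union>n\<in>(UNIV::nat set). - K (int n))" by simp
  qed
  obtain C where C: "finite C" "H - U \<subseteq> (\<Union>n\<in>C. - K (int n))"
    by (rule compactE_image[OF compact_diff[OF compact_H U(1)] _ cov])
      (auto intro: open_Compl closed_open_subgroup subgroup_K open_K)
  \<comment> \<open>Inserting 0 keeps the maximum defined when the finite cover is empty.\<close>
  define N where "N = Max (insert 0 C)"
  have "K (int N) \<subseteq> U"
  proof (rule ccontr)
    assume "\<not> K (int N) \<subseteq> U"
    then obtain x where x: "x \<in> K (int N)" "x \<notin> U" by blast
    then have "x \<in> H" using K_antimono[of 0 "int N"] by auto
    with x C obtain n where n: "n \<in> C" "x \<notin> K (int n)" by blast
    have "n \<le> N" using n C(1) by (simp add: N_def)
    then show False using K_antimono[of "int n" "int N"] x n by auto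
  qed
  then show ?thesis by blast
qed

definition R0 :: "'g set" where "R0 = (SOME R. transversal R (K 1) H)"

text \<open>The index of \<open>K 1\<close> in \<open>H\<close>. All counting is done with it;
  \<open>modulus_A\<close> later identifies it with the modulus of \<open>A\<close>.\<close>

definition q :: nat where "q = card R0"

lemma transversal_R0: "transversal R0 (K 1) H"
  unfolding R0_def by (rule someI_ex, rule transversal_exists[OF subgroup_K])

lemma K_1_subset: "K 1 \<subseteq> H" using K_plus_1_subset[of 0] by simp

lemma finite_R0: "finite R0"
  by (rule finite_transversal[OF transversal_R0 subgroup_H K_1_subset compact_H subgroup_K open_K])

text \<open>An element of \<open>H\<close> outside \<open>K 1\<close> and 0 cannot share a
  representative. The bound gives at least one wavelet and the geometric decay of the coarse
  averages.\<close>

lemma q_ge_2: "q \<ge> 2"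
proof (rule ccontr)
  assume "\<not> 2 \<le> q"
  then have "card R0 \<le> Suc 0" by (simp add: q_def)
  then have one: "r = s" if "r \<in> R0" "s \<in> R0" for r s
    using that card_le_Suc0_iff_eq[OF finite_R0] by blast
  obtain x where x: "x \<in> H" "x \<notin> K 1" using K_1_psubset by blast
  obtain r where r: "r \<in> R0" "x - r \<in> K 1" using transversal_R0 x(1) unfolding transversal_def by blast
  obtain s where s: "s \<in> R0" "0 - s \<in> K 1"
    using transversal_R0 add_subgroup_zero[OF subgroup_H] unfolding transversal_def by blast
  have "(x - r) - (0 - s) \<in> K 1" by (rule add_subgroup_diff[OF subgroup_K r(2) s(2)])
  then show False using one[OF r(1) s(1)] x(2) by simp
qed

lemma q_pos [simp]: "q > 0" and q_neq_0 [simp]: "q \<noteq> 0" using q_ge_2 by auto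

lemma transversal_K:
  shows "transversal (aut_power A (- n) ` R0) (K (n + 1)) (K n)" (is "transversal ?R _ _")
    and "finite (aut_power A (- n) ` R0)" and "card (aut_power A (- n) ` R0) = q"
proof -
  have inj: "inj (aut_power A (- n))" by (rule injI) (metis power_cancel(2))
  show "finite ?R" using finite_R0 by simp
  show "card ?R = q" using card_image[OF inj_on_subset[OF inj subset_UNIV]] by (simp add: q_def)
  have iff: "x - aut_power A (- n) r \<in> K (n + 1) \<longleftrightarrow> aut_power A n x - r \<in> K 1" for x r
    by (simp add: mem_K_shift power_diff)
  show "transversal ?R (K (n + 1)) (K n)"
    unfolding transversal_def
  proof (intro conjI ballI)
    show "?R \<subseteq> K n" using transversal_R0 by (auto simp: K_eq_image transversal_def)
    fix x assume "x \<in> K n"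
    then have "aut_power A n x \<in> H" by (simp add: K_def)
    then have "\<exists>!r. r \<in> R0 \<and> aut_power A n x - r \<in> K 1"
      using transversal_R0 unfolding transversal_def by blast
    then obtain r where r: "r \<in> R0" "aut_power A n x - r \<in> K 1"
      "\<And>s. s \<in> R0 \<Longrightarrow> aut_power A n x - s \<in> K 1 \<Longrightarrow> s = r" by blast
    show "\<exists>!r. r \<in> ?R \<and> x - r \<in> K (n + 1)"
    proof (rule ex1I)
      show "aut_power A (- n) r \<in> ?R \<and> x - aut_power A (- n) r \<in> K (n + 1)"
        using r(1,2) iff by blast
    next
      fix s assume "s \<in> ?R \<and> x - s \<in> K (n + 1)"
      then obtain t where "s = aut_power A (- n) t" "t \<in> R0" "x - s \<in> K (n + 1)" by blast
      with iff r(3) show "s = aut_power A (- n) r" by blast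
    qed
  qed
qed

lemma emeasure_K: "emeasure \<mu> (K n) = ennreal (real q powi (- n))"
proof -
  \<comment> \<open>The recurrence is run on negated indices, because the measure of
    \<open>K n\<close> falls as n grows.\<close>
  have "emeasure \<mu> (K (- n)) = ennreal (real q powi n)" for n
  proof (rule powi_recurrence_ennreal)
    fix n
    have "K (- (n + 1) + 1) = K (- n)" by simp
    then show "emeasure \<mu> (K (- (n + 1))) = of_nat q * emeasure \<mu> (K (- n))"
      using emeasure_transversal[OF TI_\<mu> transversal_K(1,2) subgroup_K K_plus_1_subset borel_K, of "- (n + 1)"]
      by (simp only: transversal_K(3))
  qed (simp_all add: \<mu>_H)
  from this[of "- n"] show ?thesis by simp
qed

lemma borel_annihilator [simp]: "annihilator S \<in> sets borel"
  by (intro borel_closed closed_annihilator)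

text \<open>Each step enlarges the annihilator by the factor by which \<open>K n\<close> shrinks, so
  the two measures stay reciprocal. This reciprocity is the normalisation behind Plancherel.\<close>

lemma emeasure_annihilator_K: "emeasure \<nu> (annihilator (K n)) = ennreal (real q powi n)"
proof (rule powi_recurrence_ennreal)
  fix n
  obtain T where T: "transversal T (annihilator (K n)) (annihilator (K (n + 1)))"
    using transversal_exists[OF add_subgroup_annihilator] by blast
  note c = card_dual_transversal[OF transversal_K(1,2) T K_plus_1_subset subgroup_K open_K subgroup_K]
  show "emeasure \<nu> (annihilator (K (n + 1))) = of_nat q * emeasure \<nu> (annihilator (K n))"
    using emeasure_transversal[OF TI_\<nu> T c(1) add_subgroup_annihilator annihilator_antimono[OF K_plus_1_subset] borel_annihilator]
    by (simp only: c(2) transversal_K(3))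
qed (simp_all add: \<nu>_H)

lemma measure_K: "measure \<mu> (K n) = real q powi (- n)"
  by (simp add: measure_def emeasure_K)

lemma measure_annihilator_K: "measure \<nu> (annihilator (K n)) = real q powi n"
  by (simp add: measure_def emeasure_annihilator_K)

lemma emeasure_coset_K: "emeasure \<mu> (coset c (K n)) = ennreal (real q powi (- n))"
  by (simp add: emeasure_coset[OF TI_\<mu>] emeasure_K)

subsection \<open>Approximation of compact sets by cosets\<close>

text \<open>Each point of C has its own scale fitting into U; the finest of finitely many scales
  then works at every point. A common scale matters because cosets of one subgroup are equal or
  disjoint, which makes the measure of the union a sum.\<close>

lemma compact_cover:
  assumes "compact C" "open U" "C \<subseteq> U"
  shows "\<exists>n F. finite F \<and> F \<subseteq> range (\<lambda>c. coset c (K n)) \<and> C \<subseteq> \<Union>F \<and> \<Union>F \<subseteq> U"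
proof -
  have "\<exists>n::nat. coset x (K (int n)) \<subseteq> U" if x: "x \<in> C" for x
  proof -
    have "open ((\<lambda>y. x + y) -` U)" by (intro open_vimage assms continuous_intros)
    then obtain n :: nat where "K (int n) \<subseteq> (\<lambda>y. x + y) -` U"
      using K_basis[of "(\<lambda>y. x + y) -` U"] x assms(3) by auto
    then show ?thesis by (intro exI[of _ n]) (auto simp: coset_def)
  qed
  then obtain f :: "'g \<Rightarrow> nat" where f: "\<And>x. x \<in> C \<Longrightarrow> coset x (K (int (f x))) \<subseteq> U" by metis
  have self: "x \<in> coset x (K n)" for x n
    using add_subgroup_zero[OF subgroup_K] by (simp add: mem_coset_iff)
  obtain X where X: "X \<subseteq> C" "finite X" "C \<subseteq> (\<Union>x\<in>X. coset x (K (int (f x))))"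
    by (rule compactE_image[OF assms(1), of C "\<lambda>x. coset x (K (int (f x)))"])
      (use self in \<open>auto intro: open_coset open_K\<close>)
  define n where "n = int (Max (insert 0 (f ` X)))"
  have sub: "coset y (K n) \<subseteq> U" if "y \<in> C" for y
  proof -
    from that X(3) obtain x where x: "x \<in> X" "y \<in> coset x (K (int (f x)))" by blast
    have "K n \<subseteq> K (int (f x))"
      using X(2) x(1) by (intro K_antimono) (simp add: n_def)
    then have "coset y (K n) \<subseteq> coset y (K (int (f x)))" by (auto simp: mem_coset_iff)
    also have "\<dots> = coset x (K (int (f x)))"
      using x(2) by (simp add: coset_eq_iff[OF subgroup_K] mem_coset_iff)
    also have "\<dots> \<subseteq> U" using f x(1) X(1) by blast
    finally show ?thesis .
  qed
  obtain Y where Y: "Y \<subseteq> C" "finite Y" "C \<subseteq> (\<Union>y\<in>Y. coset y (K n))"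
    by (rule compactE_image[OF assms(1), of C "\<lambda>x. coset x (K n)"])
      (use self in \<open>auto intro: open_coset open_K\<close>)
  \<comment> \<open>Passing from points to the set of their cosets removes repetitions, so the
    family is disjoint.\<close>
  show ?thesis
    by (rule exI[of _ n], rule exI[of _ "(\<lambda>y. coset y (K n)) ` Y"]) (use Y sub in auto)
qed

lemma disjoint_cosets:
  assumes "F \<subseteq> range (\<lambda>c. coset c (K n))"
  shows "disjoint_family_on (\<lambda>C. C) F"
  unfolding disjoint_family_on_def
proof (intro ballI impI equals0I)
  fix C C' x assume C: "C \<in> F" "C' \<in> F" "C \<noteq> C'" and x: "x \<in> C \<inter> C'"
  from C assms obtain c c' where c: "C = coset c (K n)" "C' = coset c' (K n)" by blast
  then have "C = coset x (K n)" "C' = coset x (K n)"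
    using x by (auto simp: coset_eq_iff[OF subgroup_K] mem_coset_iff
        intro: add_subgroup_uminus[OF subgroup_K, of "_ - _", simplified])
  then show False using C(3) by simp
qed

subsection \<open>The modulus\<close>

lemma A_image_coset: "A ` coset c (K n) = coset (A c) (K (n - 1))"
proof -
  have "A ` K n = K (n - 1)"
  proof -
    have "A ` K n = aut_power A 1 ` K n" using aut_power_1[OF bij_A] by (intro image_cong) auto
    also have "\<dots> = {x. aut_power A (- 1) x \<in> K n}" by (rule aut_power_image_eq_vimage[OF bij_A])
    also have "\<dots> = K (n - 1)" using mem_K_shift[of _ "- 1" n] by auto
    finally show ?thesis .
  qed
  then show ?thesis by (auto simp: coset_def Aut_add[OF Aut_A] image_image) (metis image_iff imageI Aut_add[OF Aut_A])
qed

lemma emeasure_A_cosets: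
  assumes "finite F" "F \<subseteq> range (\<lambda>c. coset c (K n))"
  shows "emeasure \<mu> (A ` \<Union>F) = of_nat q * emeasure \<mu> (\<Union>F)"
proof -
  have inj: "inj A" using bij_A by (rule bij_is_inj)
  have dis: "disjoint_family_on (\<lambda>C. A ` C) F"
    using disjoint_cosets[OF assms(2)] inj
    unfolding disjoint_family_on_def by (simp flip: image_Int)
  have qn: "ennreal (real q powi (- (n - 1))) = of_nat q * ennreal (real q powi (- n))"
    by (simp add: power_int_diff power_int_minus ennreal_of_nat_eq_real_of_nat divide_inverse flip: ennreal_mult)
  have "emeasure \<mu> (A ` \<Union>F) = emeasure \<mu> (\<Union>C\<in>F. A ` C)" by (simp add: image_Union)
  also have "\<dots> = (\<Sum>C\<in>F. emeasure \<mu> (A ` C))"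
    by (intro sum_emeasure[symmetric] dis assms(1)) (use assms(2) in \<open>auto simp: A_image_coset\<close>)
  also have "\<dots> = (\<Sum>C\<in>F. of_nat q * emeasure \<mu> C)"
  proof (rule sum.cong[OF refl])
    fix C assume "C \<in> F"
    with assms(2) obtain c where "C = coset c (K n)" by blast
    then show "emeasure \<mu> (A ` C) = of_nat q * emeasure \<mu> C"
      by (simp only: A_image_coset emeasure_coset_K qn)
  qed
  also have "\<dots> = of_nat q * (\<Sum>C\<in>F. emeasure \<mu> C)" by (simp add: sum_distrib_left)
  also have "(\<Sum>C\<in>F. emeasure \<mu> C) = emeasure \<mu> (\<Union>C\<in>F. C)"
    by (intro sum_emeasure disjoint_cosets[OF assms(2)] assms(1)) (use assms(2) in auto)
  finally show ?thesis by simp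
qed

text \<open>Inner regularity reduces both inequalities to compact subsets, and between a compact set
  and an open set around it there is a finite union of cosets, where the factor q is known.\<close>

lemma emeasure_A_open:
  assumes U: "open U"
  shows "emeasure \<mu> (A ` U) = of_nat q * emeasure \<mu> U"
proof (rule antisym)
  have AU: "open (A ` U)" using open_image_Aut[OF Aut_A U] .
  show "emeasure \<mu> (A ` U) \<le> of_nat q * emeasure \<mu> U"
    unfolding inner_regular[OF AU]
  proof (rule SUP_least, clarify)
    fix C assume C: "compact C" "C \<subseteq> A ` U"
    have "compact (inv A ` C)"
      by (rule compact_continuous_image[OF continuous_on_subset[OF Aut_continuous[OF Aut_inv[OF Aut_A]]] C(1)]) simp
    moreover have "inv A ` C \<subseteq> U" using C(2) bij_A by (auto simp: bij_is_inj)
    ultimately have "\<exists>n F. finite F \<and> F \<subseteq> range (\<lambda>c. coset c (K n)) \<and> inv A ` C \<subseteq> \<Union>F \<and> \<Union>F \<subseteq> U"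
      by (intro compact_cover U)
    then obtain n F where F: "finite F" "F \<subseteq> range (\<lambda>c. coset c (K n))" "inv A ` C \<subseteq> \<Union>F" "\<Union>F \<subseteq> U"
      by (elim exE conjE)
    have "C \<subseteq> A ` \<Union>F"
    proof
      fix x assume "x \<in> C"
      then have "inv A x \<in> \<Union>F" using F(3) by blast
      moreover have "A (inv A x) = x" by (rule surj_f_inv_f[OF bij_is_surj[OF bij_A]])
      ultimately show "x \<in> A ` \<Union>F" by (intro image_eqI[of _ _ "inv A x"]) auto
    qed
    moreover have "open (\<Union>F)" using F(2) by (auto intro!: open_Union open_coset open_K)
    ultimately have "emeasure \<mu> C \<le> emeasure \<mu> (A ` \<Union>F)"
      by (intro emeasure_mono) (simp_all add: borel_open open_image_Aut[OF Aut_A])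
    also have "\<dots> = of_nat q * emeasure \<mu> (\<Union>F)" by (rule emeasure_A_cosets[OF F(1,2)])
    also have "\<dots> \<le> of_nat q * emeasure \<mu> U"
      using F(4) U by (intro mult_left_mono emeasure_mono) auto
    finally show "emeasure \<mu> C \<le> of_nat q * emeasure \<mu> U" .
  qed
  have "of_nat q * emeasure \<mu> C \<le> emeasure \<mu> (A ` U)" if C: "compact C" "C \<subseteq> U" for C
  proof -
    obtain n F where F: "finite F" "F \<subseteq> range (\<lambda>c. coset c (K n))" "C \<subseteq> \<Union>F" "\<Union>F \<subseteq> U"
      using compact_cover[OF C(1) U C(2)] by (elim exE conjE)
    have "open (\<Union>F)" using F(2) by (auto intro!: open_Union open_coset open_K)
    then have "of_nat q * emeasure \<mu> C \<le> of_nat q * emeasure \<mu> (\<Union>F)"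
      using F(3) by (intro mult_left_mono emeasure_mono) auto
    also have "\<dots> = emeasure \<mu> (A ` \<Union>F)" by (rule emeasure_A_cosets[OF F(1,2), symmetric])
    also have "\<dots> \<le> emeasure \<mu> (A ` U)"
      using F(4) AU by (intro emeasure_mono image_mono) auto
    finally show ?thesis .
  qed
  then show "of_nat q * emeasure \<mu> U \<le> emeasure \<mu> (A ` U)"
    unfolding inner_regular[OF U] SUP_mult_left_ennreal by (auto intro!: SUP_least)
qed

lemma borel_image_Aut:
  assumes "B \<in> Aut" "U \<in> sets borel"
  shows "B ` U \<in> sets borel"
proof -
  have b: "bij B" using Aut_bij[OF assms(1)] .
  have "inv B \<in> borel \<rightarrow>\<^sub>M borel"
    by (intro borel_measurable_continuous_onI Aut_continuous Aut_inv assms)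
  from measurable_sets[OF this assms(2)] have "inv B -` U \<in> sets borel" by simp
  moreover have "B ` U = inv B -` U"
    using b by (auto simp: bij_is_inj bij_is_surj surj_f_inv_f intro!: image_eqI[where x = "inv B _"])
  ultimately show ?thesis by simp
qed

lemma emeasure_A:
  assumes B: "B \<in> sets borel"
  shows "emeasure \<mu> (A ` B) = of_nat q * emeasure \<mu> B"
proof (rule antisym)
  have AB: "A ` B \<in> sets borel" using borel_image_Aut[OF Aut_A B] .
  \<comment> \<open>Dividing by q puts the claim in the form of a lower bound for every open U
    around B, so that outer regularity of B applies.\<close>
  have "emeasure \<mu> (A ` B) / of_nat q \<le> emeasure \<mu> U" if U: "open U" "B \<subseteq> U" for U
  proof -
    have "emeasure \<mu> (A ` B) \<le> emeasure \<mu> (A ` U)"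
      using U open_image_Aut[OF Aut_A U(1)] by (intro emeasure_mono image_mono) auto
    also have "\<dots> = of_nat q * emeasure \<mu> U" by (rule emeasure_A_open[OF U(1)])
    finally show ?thesis
      by (intro divide_le_posI_ennreal) (auto simp: of_nat_0_less_iff)
  qed
  then have "emeasure \<mu> (A ` B) / of_nat q \<le> emeasure \<mu> B"
    unfolding outer_regular[OF B] by (auto intro!: INF_greatest)
  then have "of_nat q * (emeasure \<mu> (A ` B) / of_nat q) \<le> of_nat q * emeasure \<mu> B"
    by (intro mult_left_mono) auto
  then show "emeasure \<mu> (A ` B) \<le> of_nat q * emeasure \<mu> B"
    by (subst (asm) ennreal_times_divide, subst (asm) mult.commute, subst (asm) ennreal_mult_divide_eq) auto
  show "of_nat q * emeasure \<mu> B \<le> emeasure \<mu> (A ` B)"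
    unfolding outer_regular[OF AB]
  proof (rule INF_greatest, clarify)
    fix W assume W: "open W" "A ` B \<subseteq> W"
    define U where "U = inv A ` W"
    have AU: "A ` U = W" using bij_A by (simp add: U_def image_comp surj_iff[THEN iffD1] bij_is_surj)
    have "open U" unfolding U_def by (rule open_image_Aut[OF Aut_inv[OF Aut_A] W(1)])
    moreover have "B \<subseteq> U"
    proof
      fix x assume "x \<in> B"
      then have "A x \<in> A ` U" using W(2) AU by blast
      then show "x \<in> U" using bij_A by (auto dest: injD[OF bij_is_inj])
    qed
    ultimately have "of_nat q * emeasure \<mu> B \<le> of_nat q * emeasure \<mu> U"
      by (intro mult_left_mono emeasure_mono) auto
    also have "\<dots> = emeasure \<mu> W" using emeasure_A_open[OF \<open>open U\<close>] AU by simp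
    finally show "of_nat q * emeasure \<mu> B \<le> emeasure \<mu> W" .
  qed
qed

lemma emeasure_power:
  assumes B: "B \<in> sets borel"
  shows "emeasure \<mu> (aut_power A n ` B) = ennreal (real q powi n) * emeasure \<mu> B"
proof (induction n rule: int_induct[where k = 0])
  case base
  have "aut_power A 0 ` B = B" by force
  then show ?case by simp
next
  case (step1 i)
  have "aut_power A (i + 1) ` B = A ` aut_power A i ` B"
    unfolding image_image by (intro image_cong refl aut_power_plus_1[OF bij_A])
  then have "emeasure \<mu> (aut_power A (i + 1) ` B) = of_nat q * (ennreal (real q powi i) * emeasure \<mu> B)"
    using emeasure_A[OF borel_image_Aut[OF Aut_power B]] step1(2) by simp
  then show ?case
    by (simp add: power_int_add ennreal_mult ennreal_of_nat_eq_real_of_nat mult_ac)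
next
  case (step2 i)
  have "aut_power A i x = A (aut_power A (i - 1) x)" for x
    using aut_power_plus_1[OF bij_A, of "i - 1" x] by simp
  then have "aut_power A i ` B = A ` aut_power A (i - 1) ` B"
    unfolding image_image by (intro image_cong refl)
  then have "of_nat q * emeasure \<mu> (aut_power A (i - 1) ` B) = ennreal (real q powi i) * emeasure \<mu> B"
    using emeasure_A[OF borel_image_Aut[OF Aut_power B], of "i - 1"] step2(2) by simp
  also have "real q powi i = real q * real q powi (i - 1)" by (simp add: power_int_diff)
  also have "ennreal \<dots> * emeasure \<mu> B = of_nat q * (ennreal (real q powi (i - 1)) * emeasure \<mu> B)"
    by (simp add: ennreal_mult ennreal_of_nat_eq_real_of_nat mult.assoc)
  finally show ?case using q_pos by (auto simp: ennreal_mult_cancel_left)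
qed

lemma modulus_power: "modulus \<mu> (aut_power A n) = real q powi n"
  unfolding modulus_def
proof (rule the_equality)
  show "0 < real q powi n \<and> (\<forall>U\<in>sets borel. emeasure \<mu> (aut_power A n ` U) = ennreal (real q powi n) * emeasure \<mu> U)"
    using emeasure_power by simp
next
  fix c assume c: "0 < c \<and> (\<forall>U\<in>sets borel. emeasure \<mu> (aut_power A n ` U) = ennreal c * emeasure \<mu> U)"
  \<comment> \<open>Testing on the single set \<open>H\<close> of measure 1 determines the
    constant.\<close>
  have "H \<in> sets borel" using open_H by simp
  then have "ennreal c * emeasure \<mu> H = ennreal (real q powi n) * emeasure \<mu> H"
    using c emeasure_power[of H n] by metis
  then show "c = real q powi n" using c by (simp add: \<mu>_H)
qed

lemma modulus_A: "modulus \<mu> A = real q"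
proof -
  have "aut_power A 1 = A" using aut_power_1[OF bij_A] by blast
  then show ?thesis using modulus_power[of 1] by simp
qed

text \<open>Translates are known only almost everywhere, and \<open>dilation\<close> composes them
  with a power of \<open>A\<close>.\<close>

lemma AE_power:
  assumes "AE x in \<mu>. P x"
  shows "AE x in \<mu>. P (aut_power A n x)"
proof -
  obtain N where N: "{x. \<not> P x} \<subseteq> N" "emeasure \<mu> N = 0" "N \<in> sets borel"
    using AE_E[OF assms] by auto
  show ?thesis
  proof (rule AE_I)
    show "{x \<in> space \<mu>. \<not> P (aut_power A n x)} \<subseteq> aut_power A (- n) ` N"
      using N(1) by (auto intro!: image_eqI[where x = "aut_power A n _"])
    show "emeasure \<mu> (aut_power A (- n) ` N) = 0" using emeasure_power[OF N(3)] N(2) by simp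
    show "aut_power A (- n) ` N \<in> sets \<mu>" using borel_image_Aut[OF Aut_power N(3)] by simp
  qed
qed

end

section \<open>Indicators times unimodular functions, and step functions\<close>

text \<open>Indicators of cosets, their Fourier transforms, the atoms and the wavelets all have this
  shape up to a constant factor.\<close>

lemma indicator_mult_unimodular_L2:
  fixes g :: "'a \<Rightarrow> complex"
  assumes "S \<in> sets M" "emeasure M S < \<infinity>" "g \<in> borel_measurable M" "\<And>x. norm (g x) = 1"
  shows "integrable M (\<lambda>x. indicator S x * g x)" and "(\<lambda>x. indicator S x * g x) \<in> L2 M"
    and "norm_L2 M (\<lambda>x. indicator S x * g x) = sqrt (measure M S)"
proof -
  have meas: "(\<lambda>x. indicator S x * g x) \<in> borel_measurable M"
    by (intro borel_measurable_times borel_measurable_indicator assms)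
  have int: "integrable M (indicator S :: _ \<Rightarrow> real)" using assms by simp
  have sq: "(norm (indicator S x * g x))\<^sup>2 = indicator S x" for x
    using assms(4) by (simp add: indicator_def norm_mult)
  show "integrable M (\<lambda>x. indicator S x * g x)"
    by (rule Bochner_Integration.integrable_bound[OF int meas])
      (use assms(4) in \<open>auto simp: indicator_def norm_mult intro!: AE_I2\<close>)
  show "(\<lambda>x. indicator S x * g x) \<in> L2 M" using meas int by (simp add: L2_def sq)
  show "norm_L2 M (\<lambda>x. indicator S x * g x) = sqrt (measure M S)"
    unfolding norm_L2_def sq using sets.sets_into_space[OF assms(1)] by (simp add: Int_absorb2)
qed

lemma inner_L2_commute: "inner_L2 M f g = cnj (inner_L2 M g f)"
proof -
  have "(\<lambda>x. f x * cnj (g x)) = (\<lambda>x. cnj (g x * cnj (f x)))" by (simp add: mult.commute)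
  then show ?thesis unfolding inner_L2_def by (simp only: Bochner_Integration.integral_cnj)
qed

context expansive_lca
begin

lemma meas_pairing: "(\<lambda>x. pairing x \<gamma>) \<in> borel_measurable borel"
  by (intro borel_measurable_continuous_onI continuous_pairing)

lemma meas_pairing_right: "(\<lambda>\<gamma>. pairing x \<gamma>) \<in> borel_measurable borel"
  by (intro borel_measurable_continuous_onI continuous_pairing_right)

lemma meas_cnj_pairing: "(\<lambda>x. cnj (pairing x \<gamma>)) \<in> borel_measurable borel"
  by (intro borel_measurable_continuous_onI continuous_on_cnj continuous_pairing)

lemma meas_cnj_pairing_right: "(\<lambda>\<gamma>. cnj (pairing x \<gamma>)) \<in> borel_measurable borel"
  by (intro borel_measurable_continuous_onI continuous_on_cnj continuous_pairing_right)

definition step :: "int \<times> 'g \<Rightarrow> 'g \<Rightarrow> complex" where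
  "step = (\<lambda>(n, c). indicator (coset c (K n)))"

abbreviation "Step \<equiv> lin_span UNIV step"

lemma indicator_L12:
  assumes "B \<in> sets borel" "emeasure \<mu> B < \<infinity>"
  shows "integrable \<mu> (indicator B :: 'g \<Rightarrow> complex)" "(indicator B :: 'g \<Rightarrow> complex) \<in> L2 \<mu>"
  using indicator_mult_unimodular_L2(1,2)[of B \<mu> "\<lambda>_. 1"] assms by (auto simp: meas_\<mu>)

lemma step_L12: "integrable \<mu> (step i)" "step i \<in> L2 \<mu>"
  by (cases i; simp add: step_def indicator_L12 emeasure_coset_K)+

lemma Step_L2: "s \<in> Step \<Longrightarrow> s \<in> L2 \<mu>"
  by (rule lin_span_L2[OF step_L12(2)])

lemma Step_integrable: "s \<in> Step \<Longrightarrow> integrable \<mu> s"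
  by (auto simp: lin_span_def intro!: Bochner_Integration.integrable_sum integrable_mult_right step_L12)

subsection \<open>Density of step functions\<close>

text \<open>The same step function must be close in both norms: closeness in mean of order 2
  controls \<open>norm_L2\<close>, closeness in mean of order 1 controls the Fourier transform at
  every point.\<close>

definition approximable :: "('g \<Rightarrow> complex) \<Rightarrow> bool" where
  "approximable f \<longleftrightarrow> integrable \<mu> f \<and> f \<in> L2 \<mu> \<and>
     (\<forall>\<epsilon>>0. \<exists>s\<in>Step. norm_L2 \<mu> (\<lambda>x. f x - s x) < \<epsilon> \<and> (LINT x|\<mu>. norm (f x - s x)) < \<epsilon>)"

text \<open>Regularity gives an open U around B and a compact C in U, both with measure close to
  that of U. A union V of cosets between C and U then differs from B only within U - B and U -
  V.\<close>

lemma approximable_indicator: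
  assumes B: "B \<in> sets borel" "emeasure \<mu> B < \<infinity>"
  shows "approximable (indicator B)"
  unfolding approximable_def
proof (intro conjI allI impI indicator_L12 B)
  fix \<epsilon> :: real assume \<epsilon>: "\<epsilon> > 0"
  \<comment> \<open>The integral of the modulus of the error is below 2 \<open>\<delta>\<close>. A
    difference of indicators has modulus 0 or 1, so this also bounds the square of the other norm,
    whence the square of \<open>\<epsilon>\<close>.\<close>
  define \<delta> where "\<delta> = min \<epsilon> (\<epsilon>\<^sup>2) / 2"
  have \<delta>: "\<delta> > 0" "2 * \<delta> \<le> \<epsilon>" "2 * \<delta> \<le> \<epsilon>\<^sup>2" using \<epsilon> by (auto simp: \<delta>_def)
  have "\<exists>U\<in>{U. open U \<and> B \<subseteq> U}. emeasure \<mu> U < emeasure \<mu> B + ennreal \<delta>"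
    using B(2) \<delta>(1) by (intro INF_approx_ennreal outer_regular[OF B(1)]) auto
  then obtain U where U: "open U" "B \<subseteq> U" "emeasure \<mu> U < emeasure \<mu> B + ennreal \<delta>"
    by auto
  have finU: "emeasure \<mu> U < \<infinity>" using U(3) B(2) by (metis ennreal_add_less_top ennreal_less_top infinity_ennreal_def order.strict_trans)
  have "\<exists>C\<in>{C. compact C \<and> C \<subseteq> U}. emeasure \<mu> U < emeasure \<mu> C + ennreal \<delta>"
    using finU \<delta>(1) by (intro SUP_approx_ennreal inner_regular[OF U(1)]) auto
  then obtain C where C: "compact C" "C \<subseteq> U" "emeasure \<mu> U < emeasure \<mu> C + ennreal \<delta>" by auto
  obtain n F where F: "finite F" "F \<subseteq> range (\<lambda>c. coset c (K n))" "C \<subseteq> \<Union>F" "\<Union>F \<subseteq> U"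
    using compact_cover[OF C(1) U(1) C(2)] by (elim exE conjE)
  define V where "V = \<Union>F"
  have oV: "open V" unfolding V_def using F(2) by (auto intro!: open_Union open_coset open_K)
  have ind: "(indicator V :: 'g \<Rightarrow> complex) = (\<lambda>x. \<Sum>C\<in>F. indicator C x)"
    unfolding V_def using indicator_UN_disjoint[OF F(1) disjoint_cosets[OF F(2)]] by (auto simp: fun_eq_iff)
  have V: "indicator V \<in> Step"
    unfolding ind
  proof (rule lin_span_sum)
    fix C assume "C \<in> F"
    with F(2) obtain c where "C = coset c (K n)" by blast
    then show "indicator C \<in> Step" using lin_span_base[of "(n, c)" UNIV step] by (simp add: step_def)
  qed
  have fin: "emeasure \<mu> B \<noteq> \<infinity>" "emeasure \<mu> V \<noteq> \<infinity>" "emeasure \<mu> U \<noteq> \<infinity>"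
    using B finU emeasure_mono[of V U \<mu>] F(4) U(1) by (auto simp: V_def top_unique)
  have "emeasure \<mu> U < emeasure \<mu> V + ennreal \<delta>"
    using C(3) emeasure_mono[of C V \<mu>] F(3) oV by (auto simp: V_def intro: order_less_le_trans add_right_mono)
  then have mV: "measure \<mu> U < measure \<mu> V + \<delta>"
    using fin \<delta> by (simp add: emeasure_eq_ennreal_measure ennreal_less_iff flip: ennreal_plus)
  have mB: "measure \<mu> U < measure \<mu> B + \<delta>"
    using U(3) fin \<delta> by (simp add: emeasure_eq_ennreal_measure ennreal_less_iff flip: ennreal_plus)
  have dB: "measure \<mu> (U - B) = measure \<mu> U - measure \<mu> B"
    using fin U B by (intro measure_Diff) auto
  have dV: "measure \<mu> (U - V) = measure \<mu> U - measure \<mu> V"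
    using fin U oV F(4) by (intro measure_Diff) (auto simp: V_def)
  have finD: "emeasure \<mu> (U - B) < \<infinity>" "emeasure \<mu> (U - V) < \<infinity>"
    using le_less_trans[OF emeasure_mono[of "U - B" U \<mu>] finU] le_less_trans[OF emeasure_mono[of "U - V" U \<mu>] finU] U(1) by auto
  have iL2: "integrable \<mu> (\<lambda>x. indicator B x - indicator V x :: complex)"
    using indicator_L12(1)[OF B] Step_integrable[OF V] by (rule Bochner_Integration.integrable_diff)
  have "(LINT x|\<mu>. norm (indicator B x - indicator V x :: complex))
      \<le> (LINT x|\<mu>. indicator (U - B) x + indicator (U - V) x)"
  proof (rule integral_mono)
    show "integrable \<mu> (\<lambda>x. indicator (U - B) x + indicator (U - V) x :: real)"
      using finD U(1) B(1) oV by (intro Bochner_Integration.integrable_add integrable_real_indicator) auto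
    show "integrable \<mu> (\<lambda>x. norm (indicator B x - indicator V x :: complex))" using iL2 by simp
    show "norm (indicator B x - indicator V x :: complex) \<le> indicator (U - B) x + indicator (U - V) x" for x
      using U(2) F(4) by (auto simp: indicator_def V_def)
  qed
  also have "\<dots> = measure \<mu> (U - B) + measure \<mu> (U - V)"
    using finD U(1) B(1) oV by (subst Bochner_Integration.integral_add) auto
  also have "\<dots> < 2 * \<delta>" using mV mB unfolding dB dV by linarith
  finally have lt: "(LINT x|\<mu>. norm (indicator B x - indicator V x :: complex)) < 2 * \<delta>" .
  have "(norm (indicator B x - indicator V x :: complex))\<^sup>2 = norm (indicator B x - indicator V x :: complex)" for x
    by (auto simp: indicator_def)
  then have "(norm_L2 \<mu> (\<lambda>x. indicator B x - indicator V x))\<^sup>2 = (LINT x|\<mu>. norm (indicator B x - indicator V x :: complex))"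
    unfolding norm_L2_sq by simp
  with lt \<delta>(3) have "(norm_L2 \<mu> (\<lambda>x. indicator B x - indicator V x))\<^sup>2 < \<epsilon>\<^sup>2" by linarith
  then have "norm_L2 \<mu> (\<lambda>x. indicator B x - indicator V x) < \<epsilon>"
    using \<epsilon> power_less_imp_less_base[of _ 2 \<epsilon>] by auto
  with V lt \<delta>(2) show "\<exists>s\<in>Step. norm_L2 \<mu> (\<lambda>x. indicator B x - s x) < \<epsilon> \<and> (LINT x|\<mu>. norm (indicator B x - s x)) < \<epsilon>"
    by (intro bexI[of _ "indicator V"]) auto
qed

lemma approximable_add:
  assumes f: "approximable f" and g: "approximable g"
  shows "approximable (\<lambda>x. f x + g x)"
  unfolding approximable_def
proof (intro conjI allI impI)
  have i: "integrable \<mu> f" "integrable \<mu> g" and L: "f \<in> L2 \<mu>" "g \<in> L2 \<mu>"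
    using f g by (auto simp: approximable_def)
  show "integrable \<mu> (\<lambda>x. f x + g x)" using i by simp
  show "(\<lambda>x. f x + g x) \<in> L2 \<mu>" using L by (rule L2_add)
  fix \<epsilon> :: real assume \<epsilon>: "\<epsilon> > 0"
  then obtain s where s: "s \<in> Step" "norm_L2 \<mu> (\<lambda>x. f x - s x) < \<epsilon> / 2" "(LINT x|\<mu>. norm (f x - s x)) < \<epsilon> / 2"
    using f unfolding approximable_def by (metis half_gt_zero)
  obtain t where t: "t \<in> Step" "norm_L2 \<mu> (\<lambda>x. g x - t x) < \<epsilon> / 2" "(LINT x|\<mu>. norm (g x - t x)) < \<epsilon> / 2"
    using g \<epsilon> unfolding approximable_def by (metis half_gt_zero)
  have eq: "f x + g x - (s x + t x) = (f x - s x) + (g x - t x)" for x by simp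
  have "norm_L2 \<mu> (\<lambda>x. f x + g x - (s x + t x)) \<le> norm_L2 \<mu> (\<lambda>x. f x - s x) + norm_L2 \<mu> (\<lambda>x. g x - t x)"
    unfolding eq by (intro norm_L2_triangle L2_diff L Step_L2 s t)
  moreover have "(LINT x|\<mu>. norm (f x + g x - (s x + t x)))
      \<le> (LINT x|\<mu>. norm (f x - s x) + norm (g x - t x))"
    unfolding eq using i Step_integrable[OF s(1)] Step_integrable[OF t(1)]
    by (intro integral_mono norm_triangle_ineq) auto
  moreover have "(LINT x|\<mu>. norm (f x - s x) + norm (g x - t x))
      = (LINT x|\<mu>. norm (f x - s x)) + (LINT x|\<mu>. norm (g x - t x))"
    using i Step_integrable[OF s(1)] Step_integrable[OF t(1)] by (intro Bochner_Integration.integral_add) auto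
  ultimately show "\<exists>u\<in>Step. norm_L2 \<mu> (\<lambda>x. f x + g x - u x) < \<epsilon> \<and> (LINT x|\<mu>. norm (f x + g x - u x)) < \<epsilon>"
    using s t by (intro bexI[of _ "\<lambda>x. s x + t x"] lin_span_add) auto
qed

lemma approximable_scale:
  assumes f: "approximable f"
  shows "approximable (\<lambda>x. c * f x)"
  unfolding approximable_def
proof (intro conjI allI impI)
  show "integrable \<mu> (\<lambda>x. c * f x)" "(\<lambda>x. c * f x) \<in> L2 \<mu>"
    using f by (auto simp: approximable_def intro: L2_scale)
  fix \<epsilon> :: real assume "\<epsilon> > 0"
  moreover have c: "norm c + 1 > 0" using norm_ge_zero[of c] by linarith
  ultimately have "\<epsilon> / (norm c + 1) > 0" by simp
  then obtain s where s: "s \<in> Step" "norm_L2 \<mu> (\<lambda>x. f x - s x) < \<epsilon> / (norm c + 1)"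
    "(LINT x|\<mu>. norm (f x - s x)) < \<epsilon> / (norm c + 1)"
    using f unfolding approximable_def by metis
  have le: "norm c * a < \<epsilon>" if "a < \<epsilon> / (norm c + 1)" "a \<ge> 0" for a
  proof -
    have "norm c * a \<le> (norm c + 1) * a" using that(2) by (intro mult_right_mono) auto
    also have "\<dots> < \<epsilon>" using that(1) c by (simp add: pos_less_divide_eq mult.commute)
    finally show ?thesis .
  qed
  have eq: "c * f x - c * s x = c * (f x - s x)" for x by (simp add: right_diff_distrib)
  show "\<exists>u\<in>Step. norm_L2 \<mu> (\<lambda>x. c * f x - u x) < \<epsilon> \<and> (LINT x|\<mu>. norm (c * f x - u x)) < \<epsilon>"
  proof (rule bexI[of _ "\<lambda>x. c * s x"])
    show "norm_L2 \<mu> (\<lambda>x. c * f x - c * s x) < \<epsilon> \<and> (LINT x|\<mu>. norm (c * f x - c * s x)) < \<epsilon>"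
      unfolding eq norm_L2_scale norm_mult using le[OF s(2)] le[OF s(3)] by simp
  qed (rule lin_span_scale[OF s(1)])
qed

lemma approximable_zero: "approximable (\<lambda>_. 0)"
  unfolding approximable_def using lin_span_zero[of UNIV step] by (auto simp: L2_zero intro!: bexI[of _ "\<lambda>_. 0"])

lemma approximable_simple:
  assumes u: "simple_function \<mu> u" "u \<in> L2 \<mu>"
  shows "approximable u"
proof -
  have fin: "finite (range u)" using simple_functionD(1)[OF u(1)] by simp
  have meas: "u -` {y} \<in> sets borel" for y using simple_functionD(2)[OF u(1), of "{y}"] by simp
  \<comment> \<open>Chebyshev's argument; the value 0 is left out because its level set may have
    infinite measure.\<close>
  have fm: "emeasure \<mu> (u -` {y}) < \<infinity>" if "y \<noteq> 0" for y
  proof -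
    have "integrable \<mu> (indicator (u -` {y}) :: 'g \<Rightarrow> real)"
    proof (rule Bochner_Integration.integrable_bound)
      show "integrable \<mu> (\<lambda>x. (norm (u x))\<^sup>2 / (norm y)\<^sup>2)" using L2_integrable[OF u(2)] by simp
      show "(indicator (u -` {y}) :: 'g \<Rightarrow> real) \<in> borel_measurable \<mu>"
        unfolding meas_\<mu> by (intro borel_measurable_indicator meas)
      show "AE x in \<mu>. norm (indicator (u -` {y}) x :: real) \<le> norm ((norm (u x))\<^sup>2 / (norm y)\<^sup>2)"
        using that by (auto simp: indicator_def intro!: AE_I2)
    qed
    then show ?thesis by (simp add: integrable_indicator_iff)
  qed
  have "approximable (\<lambda>x. \<Sum>y\<in>Y. y * indicator (u -` {y}) x)" if "finite Y" "0 \<notin> Y" for Y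
    using that
  proof (induction Y rule: finite_induct)
    case (insert y Y)
    show ?case unfolding sum.insert[OF insert(1,2)]
      by (rule approximable_add[OF approximable_scale[OF approximable_indicator[OF meas fm]] insert(3)])
        (use insert(4) in auto)
  qed (simp add: approximable_zero)
  from this[of "range u - {0}"] fin
  have a: "approximable (\<lambda>x. \<Sum>y\<in>range u - {0}. y * indicator (u -` {y}) x)" by simp
  have "(\<Sum>y\<in>range u - {0}. y * indicator (u -` {y}) x) = u x" for x
  proof -
    have "(\<Sum>y\<in>range u - {0}. y * indicator (u -` {y}) x) = (\<Sum>y\<in>range u - {0}. if y = u x then u x else 0)"
      by (rule sum.cong) (auto simp: indicator_def)
    also have "\<dots> = u x" using fin by (simp add: sum.delta')
    finally show ?thesis .
  qed
  with a show ?thesis by simp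
qed

text \<open>Simple functions dominated by a multiple of f converge to f in both norms by dominated
  convergence. Closeness in mean of order 1 can only be claimed when f is integrable, hence the
  implication.\<close>

lemma step_dense:
  assumes f: "f \<in> L2 \<mu>" and \<epsilon>: "\<epsilon> > 0"
  shows "\<exists>s\<in>Step. norm_L2 \<mu> (\<lambda>x. f x - s x) < \<epsilon> \<and> (integrable \<mu> f \<longrightarrow> (LINT x|\<mu>. norm (f x - s x)) < \<epsilon>)"
proof -
  note mf = L2_measurable[OF f]
  obtain u where u: "\<And>i. simple_function \<mu> (u i)" "\<And>x. (\<lambda>i. u i x) \<longlonglongrightarrow> f x" "\<And>i x. norm (u i x) \<le> 2 * norm (f x)"
    using borel_measurable_implies_sequence_metric[OF mf, of 0] unfolding norm_conv_dist by (auto simp: dist_commute)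
  have mu: "u i \<in> borel_measurable \<mu>" for i using u(1) by (rule borel_measurable_simple_function)
  have int4: "integrable \<mu> (\<lambda>x. 4 * (norm (f x))\<^sup>2)" using L2_integrable[OF f] by simp
  have "u i \<in> L2 \<mu>" for i
    by (rule L2_bound[OF mu int4]) (use power_mono[OF u(3) norm_ge_zero, where n = 2] in \<open>simp add: power_mult_distrib\<close>)
  then have app: "approximable (u i)" for i using u(1) by (intro approximable_simple)
  \<comment> \<open>The simple functions are bounded by 2 |f|, which gives the dominating functions
    3 |f| and, after squaring, 9 |f|^2.\<close>
  have diff: "norm (f x - u i x) \<le> 3 * norm (f x)" for i x
    using norm_triangle_ineq4[of "f x" "u i x"] u(3)[of i x] by linarith
  have lim: "(\<lambda>i. norm (f x - u i x)) \<longlonglongrightarrow> 0" for x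
    using tendsto_norm[OF tendsto_diff[OF tendsto_const u(2)], of "f x" x] by simp
  have "(\<lambda>i. LINT x|\<mu>. (norm (f x - u i x))\<^sup>2) \<longlonglongrightarrow> (LINT x|\<mu>. 0)"
  proof (rule integral_dominated_convergence)
    show "integrable \<mu> (\<lambda>x. 9 * (norm (f x))\<^sup>2)" using L2_integrable[OF f] by simp
    show "AE x in \<mu>. (\<lambda>i. (norm (f x - u i x))\<^sup>2) \<longlonglongrightarrow> 0"
      using tendsto_power[OF lim, of _ 2] by simp
    show "AE x in \<mu>. norm ((norm (f x - u i x))\<^sup>2) \<le> 9 * (norm (f x))\<^sup>2" for i
      using power_mono[OF diff norm_ge_zero, where n = 2] by (simp add: power_mult_distrib)
  qed (use mf mu in auto)
  from tendsto_real_sqrt[OF this] have "(\<lambda>i. norm_L2 \<mu> (\<lambda>x. f x - u i x)) \<longlonglongrightarrow> 0"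
    by (simp add: norm_L2_def)
  then have ev1: "\<forall>\<^sub>F i in sequentially. norm_L2 \<mu> (\<lambda>x. f x - u i x) < \<epsilon> / 2"
    using \<epsilon> by (intro order_tendstoD(2)) auto
  have ev2: "\<forall>\<^sub>F i in sequentially. integrable \<mu> f \<longrightarrow> (LINT x|\<mu>. norm (f x - u i x)) < \<epsilon> / 2"
  proof (cases "integrable \<mu> f")
    case True
    have "(\<lambda>i. LINT x|\<mu>. norm (f x - u i x)) \<longlonglongrightarrow> (LINT x|\<mu>. 0)"
    proof (rule integral_dominated_convergence)
      show "integrable \<mu> (\<lambda>x. 3 * norm (f x))" using True by simp
    qed (use mf mu lim diff in auto)
    then show ?thesis using \<epsilon> True order_tendstoD(2)[of _ 0 sequentially "\<epsilon> / 2"] by simp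
  qed simp
  obtain i where i: "norm_L2 \<mu> (\<lambda>x. f x - u i x) < \<epsilon> / 2"
    "integrable \<mu> f \<Longrightarrow> (LINT x|\<mu>. norm (f x - u i x)) < \<epsilon> / 2"
    using eventually_happens'[OF sequentially_bot eventually_conj[OF ev1 ev2]] by blast
  obtain s where s: "s \<in> Step" "norm_L2 \<mu> (\<lambda>x. u i x - s x) < \<epsilon> / 2" "(LINT x|\<mu>. norm (u i x - s x)) < \<epsilon> / 2"
    using app[of i] \<epsilon> unfolding approximable_def by (metis half_gt_zero)
  have ui: "integrable \<mu> (u i)" "u i \<in> L2 \<mu>" using app[of i] by (auto simp: approximable_def)
  have "norm_L2 \<mu> (\<lambda>x. f x - s x) < \<epsilon>"
    using norm_L2_triangle_diff[OF f ui(2) Step_L2[OF s(1)]] i(1) s(2) by linarith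
  moreover have "(LINT x|\<mu>. norm (f x - s x)) < \<epsilon>" if fi: "integrable \<mu> f"
  proof -
    note si = Step_integrable[OF s(1)]
    have "(LINT x|\<mu>. norm (f x - s x)) \<le> (LINT x|\<mu>. norm (f x - u i x) + norm (u i x - s x))"
      using fi ui(1) si by (intro integral_mono) (auto intro: norm_triangle_le_diff order_trans[OF _ norm_triangle_ineq])
    also have "\<dots> = (LINT x|\<mu>. norm (f x - u i x)) + (LINT x|\<mu>. norm (u i x - s x))"
      using fi ui(1) si by (intro Bochner_Integration.integral_add) auto
    finally show ?thesis using i(2)[OF fi] s(3) by linarith
  qed
  ultimately show ?thesis using s(1) by blast
qed

subsection \<open>The Plancherel theorem\<close>

lemma integrable_mult_pairing:
  assumes "integrable \<mu> f"
  shows "integrable \<mu> (\<lambda>x. f x * cnj (pairing x \<gamma>))"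
  by (rule Bochner_Integration.integrable_bound[OF assms])
    (use borel_measurable_integrable[OF assms] meas_cnj_pairing in
      \<open>auto simp: meas_\<mu> norm_mult intro!: borel_measurable_times\<close>)

lemma fourier_diff:
  assumes "integrable \<mu> f" "integrable \<mu> g"
  shows "fourier \<mu> (\<lambda>x. f x - g x) \<gamma> = fourier \<mu> f \<gamma> - fourier \<mu> g \<gamma>"
  unfolding fourier_def left_diff_distrib
  by (intro Bochner_Integration.integral_diff integrable_mult_pairing assms)

lemma norm_fourier_le:
  assumes "integrable \<mu> f"
  shows "norm (fourier \<mu> f \<gamma>) \<le> (LINT x|\<mu>. norm (f x))"
proof -
  have "norm (fourier \<mu> f \<gamma>) \<le> (LINT x|\<mu>. norm (f x * cnj (pairing x \<gamma>)))"
    unfolding fourier_def by (rule integral_norm_bound)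
  then show ?thesis by (simp add: norm_mult)
qed

lemma fourier_coset_character:
  assumes "U \<in> sets borel" "add_subgroup U"
  shows "fourier \<mu> (\<lambda>x. pairing x \<sigma> * indicator (coset c U) x) \<gamma>
    = (if \<gamma> - \<sigma> \<in> annihilator U then cnj (pairing c (\<gamma> - \<sigma>)) * of_real (measure \<mu> U) else 0)"
proof -
  have "fourier \<mu> (\<lambda>x. pairing x \<sigma> * indicator (coset c U) x) \<gamma>
      = (LINT x|\<mu>. indicator (coset c U) x * cnj (pairing x (\<gamma> - \<sigma>)))"
    unfolding fourier_def by (intro Bochner_Integration.integral_cong) (auto simp: pairing_diff_right mult_ac)
  also have "\<dots> = (if \<forall>u\<in>U. cnj (pairing u (\<gamma> - \<sigma>)) = 1
      then cnj (pairing c (\<gamma> - \<sigma>)) * of_real (measure \<mu> U) else 0)"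
    by (rule integral_coset_character[OF TI_\<mu> assms meas_cnj_pairing]) (simp add: pairing_add_left)
  also have "(\<forall>u\<in>U. cnj (pairing u (\<gamma> - \<sigma>)) = 1) \<longleftrightarrow> \<gamma> - \<sigma> \<in> annihilator U"
    by (auto simp: annihilator_def)
  finally show ?thesis .
qed

text \<open>Fourier inversion for a coset of an annihilator. With \<open>\<sigma>\<close> = 0 it
  evaluates inner products of transformed steps; with n = 0 it gives the pointwise formula for the
  generators.\<close>

lemma integral_annihilator_K_pairing:
  "(LINT \<gamma>|\<nu>. indicator (coset \<sigma> (annihilator (K n))) \<gamma> * pairing x \<gamma>)
    = (if x \<in> K n then pairing x \<sigma> * of_real (real q powi n) else 0)"
  using integral_coset_character[OF TI_\<nu> borel_annihilator add_subgroup_annihilator meas_pairing_right[of x], of \<sigma> "K n"]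
  by (simp add: pairing_add_right annihilator_detects[OF subgroup_K open_K] measure_annihilator_K)

lemma fourier_step:
  "fourier \<mu> (step (n, c)) = (\<lambda>\<gamma>. of_real (real q powi (- n)) * (indicator (annihilator (K n)) \<gamma> * cnj (pairing c \<gamma>)))"
proof
  fix \<gamma>
  have "step (n, c) = (\<lambda>x. pairing x 0 * indicator (coset c (K n)) x)" by (simp add: step_def)
  then show "fourier \<mu> (step (n, c)) \<gamma> = of_real (real q powi (- n)) * (indicator (annihilator (K n)) \<gamma> * cnj (pairing c \<gamma>))"
    by (simp only: fourier_coset_character[OF borel_K subgroup_K]) (simp add: measure_K indicator_def)
qed

lemma fourier_step_L2: "fourier \<mu> (step i) \<in> L2 \<nu>"
proof (cases i)
  case (Pair n c)
  have "(\<lambda>\<gamma>. indicator (annihilator (K n)) \<gamma> * cnj (pairing c \<gamma>)) \<in> L2 \<nu>"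
    by (rule indicator_mult_unimodular_L2)
      (simp_all add: emeasure_annihilator_K meas_\<nu> meas_cnj_pairing_right)
  then show ?thesis unfolding Pair fourier_step by (rule L2_scale)
qed

text \<open>The finer coset lies inside the coarser one or misses it, while on the dual side the
  annihilators are nested the other way. Both inner products are q^-n or 0 according to whether c -
  d lies in \<open>K m\<close>; on the dual side q^-n q^-m is multiplied by the measure q^m.\<close>

lemma inner_step_le:
  assumes "m \<le> n"
  shows "inner_L2 \<nu> (fourier \<mu> (step (n, c))) (fourier \<mu> (step (m, d))) = inner_L2 \<mu> (step (n, c)) (step (m, d))"
proof -
  have sub: "K n \<subseteq> K m" using assms by (rule K_antimono)
  have asub: "annihilator (K m) \<subseteq> annihilator (K n)" using sub by (rule annihilator_antimono)
  have q0: "real q \<noteq> 0" using q_pos by simp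
  have "inner_L2 \<nu> (fourier \<mu> (step (n, c))) (fourier \<mu> (step (m, d)))
      = (LINT \<gamma>|\<nu>. of_real (real q powi (- n) * real q powi (- m)) *
          (indicator (coset 0 (annihilator (K m))) \<gamma> * pairing (d - c) \<gamma>))"
    unfolding inner_L2_def fourier_step using asub
    by (intro Bochner_Integration.integral_cong)
      (auto simp: indicator_def mem_coset_iff pairing_diff_left)
  also have "\<dots> = of_real (real q powi (- n) * real q powi (- m)) *
      (if d - c \<in> K m then of_real (real q powi m) else 0)"
    by (simp only: integral_mult_right_zero integral_annihilator_K_pairing pairing_zero_right mult_1_left)
  also have "\<dots> = (if c - d \<in> K m then of_real (real q powi (- n)) else 0)"
  proof -
    have "d - c \<in> K m \<longleftrightarrow> c - d \<in> K m" using add_subgroup_uminus[OF subgroup_K, of "_ - _" m] by (metis minus_diff_eq)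
    moreover have "real q powi (- m) * real q powi m = 1" using q0 by (simp add: power_int_minus)
    then have "complex_of_real (real q powi (- n) * real q powi (- m)) * of_real (real q powi m)
        = of_real (real q powi (- n))"
      by (simp only: of_real_mult[symmetric] mult.assoc mult_1_right)
    ultimately show ?thesis by (simp only: mult_zero_right split: if_split) simp
  qed
  also have "\<dots> = inner_L2 \<mu> (step (n, c)) (step (m, d))"
  proof -
    have "step (n, c) x * cnj (step (m, d) x)
        = (if c - d \<in> K m then of_real (indicator (coset c (K n)) x) else 0)" for x
    proof (cases "x \<in> coset c (K n)")
      case True
      then have "x - c \<in> K m" using sub by (auto simp: mem_coset_iff)
      then have "x - d \<in> K m \<longleftrightarrow> c - d \<in> K m"
        using add_subgroup_add_cancel(1)[OF subgroup_K, of "x - c" m "c - d"] by simp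
      then show ?thesis using True by (simp add: step_def mem_coset_iff indicator_def)
    qed (simp add: step_def)
    then have "inner_L2 \<mu> (step (n, c)) (step (m, d))
        = (if c - d \<in> K m then (LINT x|\<mu>. complex_of_real (indicator (coset c (K n)) x)) else 0)"
      by (simp add: inner_L2_def)
    also have "(LINT x|\<mu>. complex_of_real (indicator (coset c (K n)) x)) = of_real (real q powi (- n))"
      by (simp only: integral_complex_of_real integral_indicator)
        (simp add: measure_coset[OF TI_\<mu>] measure_K)
    finally show ?thesis by simp
  qed
  finally show ?thesis .
qed

lemma inner_step: "inner_L2 \<nu> (fourier \<mu> (step i)) (fourier \<mu> (step k)) = inner_L2 \<mu> (step i) (step k)"
proof (cases i, cases k)
  fix n c m d assume [simp]: "i = (n, c)" "k = (m, d)"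
  show ?thesis
  proof (cases "m \<le> n")
    case True then show ?thesis by (simp add: inner_step_le)
  next
    case False
    then show ?thesis
      using inner_step_le[of n m d c] inner_L2_commute[of \<nu> "fourier \<mu> (step (n, c))"]
        inner_L2_commute[of \<mu> "step (n, c)"] by simp
  qed
qed

lemma fourier_Step:
  assumes "s \<in> Step"
  shows "fourier \<mu> s \<in> L2 \<nu>" "norm_L2 \<nu> (fourier \<mu> s) = norm_L2 \<mu> s"
proof -
  from assms obtain J a where J: "finite J" and s: "s = (\<lambda>x. \<Sum>i\<in>J. a i * step i x)"
    by (auto simp: lin_span_def)
  have F: "fourier \<mu> s = (\<lambda>\<gamma>. \<Sum>i\<in>J. a i * fourier \<mu> (step i) \<gamma>)"
  proof
    fix \<gamma>
    have "fourier \<mu> s \<gamma> = (LINT x|\<mu>. (\<Sum>i\<in>J. a i * (step i x * cnj (pairing x \<gamma>))))"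
      by (simp add: fourier_def s sum_distrib_right mult.assoc)
    also have "\<dots> = (\<Sum>i\<in>J. LINT x|\<mu>. a i * (step i x * cnj (pairing x \<gamma>)))"
      by (rule Bochner_Integration.integral_sum) (intro integrable_mult_right integrable_mult_pairing step_L12)
    finally show "fourier \<mu> s \<gamma> = (\<Sum>i\<in>J. a i * fourier \<mu> (step i) \<gamma>)" by (simp add: fourier_def)
  qed
  show "fourier \<mu> s \<in> L2 \<nu>" unfolding F by (intro L2_sum L2_scale fourier_step_L2)
  have "complex_of_real ((norm_L2 \<nu> (fourier \<mu> s))\<^sup>2) = complex_of_real ((norm_L2 \<mu> s)\<^sup>2)"
    unfolding F unfolding s norm_L2_sum_sq[OF step_L12(2)] norm_L2_sum_sq[OF fourier_step_L2] inner_step ..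
  then have "(norm_L2 \<nu> (fourier \<mu> s))\<^sup>2 = (norm_L2 \<mu> s)\<^sup>2" by (simp only: of_real_eq_iff)
  then show "norm_L2 \<nu> (fourier \<mu> s) = norm_L2 \<mu> s" by (simp add: power2_eq_iff_nonneg)
qed

lemma Step_diff: "s \<in> Step \<Longrightarrow> t \<in> Step \<Longrightarrow> (\<lambda>x. s x - t x) \<in> Step"
  using lin_span_add[of s UNIV step "\<lambda>x. (-1) * t x"] lin_span_scale[of t UNIV step "-1"] by simp

text \<open>Approximation in both norms at once gives convergence in \<open>norm_L2\<close> together
  with convergence of the transforms at every point, as needed for Fatou.\<close>

lemma Step_sequence:
  assumes h: "integrable \<mu> h" "h \<in> L2 \<mu>"
  shows "\<exists>s. (\<forall>n. s n \<in> Step) \<and> (\<lambda>n. norm_L2 \<mu> (\<lambda>x. s n x - h x)) \<longlonglongrightarrow> 0 \<and>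
    (\<forall>\<gamma>. (\<lambda>n. fourier \<mu> (s n) \<gamma>) \<longlonglongrightarrow> fourier \<mu> h \<gamma>)"
proof -
  have "\<exists>s\<in>Step. norm_L2 \<mu> (\<lambda>x. h x - s x) < inverse (real (Suc n)) \<and> (LINT x|\<mu>. norm (h x - s x)) < inverse (real (Suc n))" for n
    using step_dense[OF h(2), of "inverse (real (Suc n))"] h(1) by simp
  then obtain s where s: "\<And>n. s n \<in> Step" "\<And>n. norm_L2 \<mu> (\<lambda>x. h x - s n x) < inverse (real (Suc n))"
    "\<And>n. (LINT x|\<mu>. norm (h x - s n x)) < inverse (real (Suc n))"
    by metis
  note lim = LIMSEQ_inverse_real_of_nat
  have "(\<lambda>n. norm_L2 \<mu> (\<lambda>x. s n x - h x)) \<longlonglongrightarrow> 0"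
    by (rule Lim_null_comparison[OF _ lim])
      (use s(2) norm_L2_minus_commute[of \<mu> h] in \<open>auto intro!: always_eventually less_imp_le\<close>)
  moreover have "(\<lambda>n. fourier \<mu> (s n) \<gamma>) \<longlonglongrightarrow> fourier \<mu> h \<gamma>" for \<gamma>
  proof -
    have "(\<lambda>n. fourier \<mu> h \<gamma> - fourier \<mu> (s n) \<gamma>) \<longlonglongrightarrow> 0"
    proof (rule Lim_null_comparison[OF _ lim], rule always_eventually, rule allI)
      fix n
      have "norm (fourier \<mu> h \<gamma> - fourier \<mu> (s n) \<gamma>) \<le> (LINT x|\<mu>. norm (h x - s n x))"
        unfolding fourier_diff[OF h(1) Step_integrable[OF s(1)], symmetric]
        by (rule norm_fourier_le) (intro Bochner_Integration.integrable_diff h Step_integrable s)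
      then show "norm (fourier \<mu> h \<gamma> - fourier \<mu> (s n) \<gamma>) \<le> inverse (real (Suc n))"
        using s(3)[of n] by linarith
    qed
    from tendsto_diff[OF tendsto_const[of "fourier \<mu> h \<gamma>"] this] show ?thesis by simp
  qed
  ultimately show ?thesis using s(1) by blast
qed

text \<open>Fatou yields only an inequality; applied to the errors of an approximation it becomes
  the equality in \<open>plancherel\<close>.\<close>

lemma fourier_norm_le:
  assumes h: "integrable \<mu> h" "h \<in> L2 \<mu>" and m: "fourier \<mu> h \<in> borel_measurable \<nu>"
  shows "norm_L2 \<nu> (fourier \<mu> h) \<le> norm_L2 \<mu> h"
proof -
  from Step_sequence[OF h] obtain s where s: "\<And>n. s n \<in> Step" "(\<lambda>n. norm_L2 \<mu> (\<lambda>x. s n x - h x)) \<longlonglongrightarrow> 0"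
    "\<And>\<gamma>. (\<lambda>n. fourier \<mu> (s n) \<gamma>) \<longlonglongrightarrow> fourier \<mu> h \<gamma>" by blast
  show ?thesis
    by (rule L2_fatou(2)[where u = "\<lambda>n. fourier \<mu> (s n)" and c = "\<lambda>n. norm_L2 \<mu> (s n)"])
      (use m s fourier_Step[OF s(1)] norm_L2_tendsto[OF Step_L2[OF s(1)] h(2) s(2)] in auto)
qed

text \<open>The inequality for \<open>s n - h\<close> shows that the transforms converge in norm, so
  the equality for step functions passes to the limit.\<close>

lemma plancherel:
  assumes h: "integrable \<mu> h" "h \<in> L2 \<mu>" and F: "fourier \<mu> h \<in> L2 \<nu>"
  shows "norm_L2 \<nu> (fourier \<mu> h) = norm_L2 \<mu> h"
proof -
  from Step_sequence[OF h] obtain s where s: "\<And>n. s n \<in> Step" "(\<lambda>n. norm_L2 \<mu> (\<lambda>x. s n x - h x)) \<longlonglongrightarrow> 0"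
    by blast
  have eq: "fourier \<mu> (\<lambda>x. s n x - h x) = (\<lambda>\<gamma>. fourier \<mu> (s n) \<gamma> - fourier \<mu> h \<gamma>)" for n
    by (rule ext) (rule fourier_diff[OF Step_integrable[OF s(1)] h(1)])
  have "norm_L2 \<nu> (\<lambda>\<gamma>. fourier \<mu> (s n) \<gamma> - fourier \<mu> h \<gamma>) \<le> norm_L2 \<mu> (\<lambda>x. s n x - h x)" for n
    unfolding eq[symmetric]
  proof (rule fourier_norm_le)
    show "integrable \<mu> (\<lambda>x. s n x - h x)"
      by (intro Bochner_Integration.integrable_diff h Step_integrable s)
    show "(\<lambda>x. s n x - h x) \<in> L2 \<mu>" by (intro L2_diff h Step_L2 s)
    show "fourier \<mu> (\<lambda>x. s n x - h x) \<in> borel_measurable \<nu>"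
      unfolding eq by (intro L2_measurable L2_diff fourier_Step F s)
  qed
  then have "(\<lambda>n. norm_L2 \<nu> (\<lambda>\<gamma>. fourier \<mu> (s n) \<gamma> - fourier \<mu> h \<gamma>)) \<longlonglongrightarrow> 0"
    by (intro Lim_null_comparison[OF _ s(2)]) auto
  from norm_L2_tendsto[OF fourier_Step(1)[OF s(1)] F this]
  have "(\<lambda>n. norm_L2 \<mu> (s n)) \<longlonglongrightarrow> norm_L2 \<nu> (fourier \<mu> h)" by (simp add: fourier_Step(2)[OF s(1)])
  with norm_L2_tendsto[OF Step_L2[OF s(1)] h(2) s(2)] show ?thesis by (rule LIMSEQ_unique[rotated])
qed

lemma is_fourier_L2_diff:
  assumes "is_fourier_L2 \<mu> \<nu> f F" "is_fourier_L2 \<mu> \<nu> g G"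
  shows "is_fourier_L2 \<mu> \<nu> (\<lambda>x. f x - g x) (\<lambda>\<gamma>. F \<gamma> - G \<gamma>)"
proof -
  from assms obtain h k where fg: "f \<in> L2 \<mu>" "g \<in> L2 \<mu>" "F \<in> L2 \<nu>" "G \<in> L2 \<nu>"
    and h: "\<And>n. integrable \<mu> (h n)" "\<And>n. h n \<in> L2 \<mu>" "\<And>n. fourier \<mu> (h n) \<in> L2 \<nu>"
      "(\<lambda>n. norm_L2 \<mu> (\<lambda>x. h n x - f x)) \<longlonglongrightarrow> 0" "(\<lambda>n. norm_L2 \<nu> (\<lambda>\<gamma>. fourier \<mu> (h n) \<gamma> - F \<gamma>)) \<longlonglongrightarrow> 0"
    and k: "\<And>n. integrable \<mu> (k n)" "\<And>n. k n \<in> L2 \<mu>" "\<And>n. fourier \<mu> (k n) \<in> L2 \<nu>"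
      "(\<lambda>n. norm_L2 \<mu> (\<lambda>x. k n x - g x)) \<longlonglongrightarrow> 0" "(\<lambda>n. norm_L2 \<nu> (\<lambda>\<gamma>. fourier \<mu> (k n) \<gamma> - G \<gamma>)) \<longlonglongrightarrow> 0"
    unfolding is_fourier_L2_def by blast
  have lim: "(\<lambda>n. norm_L2 M (\<lambda>x. a n x - b n x - (c x - d x))) \<longlonglongrightarrow> 0"
    if "\<And>n. a n \<in> L2 M" "\<And>n. b n \<in> L2 M" "c \<in> L2 M" "d \<in> L2 M"
      "(\<lambda>n. norm_L2 M (\<lambda>x. a n x - c x)) \<longlonglongrightarrow> 0" "(\<lambda>n. norm_L2 M (\<lambda>x. b n x - d x)) \<longlonglongrightarrow> 0"
    for M :: "'x measure" and a b :: "nat \<Rightarrow> 'x \<Rightarrow> complex" and c d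
  proof (rule Lim_null_comparison)
    show "(\<lambda>n. norm_L2 M (\<lambda>x. a n x - c x) + norm_L2 M (\<lambda>x. d x - b n x)) \<longlonglongrightarrow> 0"
      using tendsto_add[OF that(5,6)] norm_L2_minus_commute[of M d] by simp
    have "norm_L2 M (\<lambda>x. (a n x - c x) + (d x - b n x)) \<le> norm_L2 M (\<lambda>x. a n x - c x) + norm_L2 M (\<lambda>x. d x - b n x)" for n
      by (intro norm_L2_triangle L2_diff that)
    moreover have "(a n x - c x) + (d x - b n x) = a n x - b n x - (c x - d x)" for n x by simp
    ultimately show "\<forall>\<^sub>F n in sequentially. norm (norm_L2 M (\<lambda>x. a n x - b n x - (c x - d x)))
        \<le> norm_L2 M (\<lambda>x. a n x - c x) + norm_L2 M (\<lambda>x. d x - b n x)"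
      by simp
  qed
  have eq: "fourier \<mu> (\<lambda>x. h n x - k n x) = (\<lambda>\<gamma>. fourier \<mu> (h n) \<gamma> - fourier \<mu> (k n) \<gamma>)" for n
    by (rule ext) (rule fourier_diff[OF h(1) k(1)])
  show ?thesis
    unfolding is_fourier_L2_def
    by (intro conjI exI[of _ "\<lambda>n x. h n x - k n x"] allI; (unfold eq)?)
      (intro L2_diff Bochner_Integration.integrable_diff fg h k lim)+
qed

lemma is_fourier_L2_norm:
  assumes "is_fourier_L2 \<mu> \<nu> f F"
  shows "norm_L2 \<nu> F = norm_L2 \<mu> f"
proof -
  from assms obtain h where fF: "f \<in> L2 \<mu>" "F \<in> L2 \<nu>"
    and h: "\<And>n. integrable \<mu> (h n)" "\<And>n. h n \<in> L2 \<mu>" "\<And>n. fourier \<mu> (h n) \<in> L2 \<nu>"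
      "(\<lambda>n. norm_L2 \<mu> (\<lambda>x. h n x - f x)) \<longlonglongrightarrow> 0" "(\<lambda>n. norm_L2 \<nu> (\<lambda>\<gamma>. fourier \<mu> (h n) \<gamma> - F \<gamma>)) \<longlonglongrightarrow> 0"
    unfolding is_fourier_L2_def by blast
  have "(\<lambda>n. norm_L2 \<mu> (h n)) \<longlonglongrightarrow> norm_L2 \<nu> F"
    using norm_L2_tendsto[OF h(3) fF(2) h(5)] by (simp add: plancherel[OF h(1,2,3)])
  then show ?thesis using norm_L2_tendsto[OF h(2) fF(1) h(4)] by (rule LIMSEQ_unique)
qed

text \<open>The differences f - g and F - G have equal norms. One direction makes the transform well
  defined almost everywhere, the other makes it injective.\<close>

lemma is_fourier_L2_AE_iff:
  assumes "is_fourier_L2 \<mu> \<nu> f F" "is_fourier_L2 \<mu> \<nu> g G"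
  shows "(AE \<gamma> in \<nu>. F \<gamma> = G \<gamma>) \<longleftrightarrow> (AE x in \<mu>. f x = g x)"
proof -
  note d = is_fourier_L2_diff[OF assms]
  then have "(\<lambda>x. f x - g x) \<in> L2 \<mu>" "(\<lambda>\<gamma>. F \<gamma> - G \<gamma>) \<in> L2 \<nu>"
    by (auto simp: is_fourier_L2_def)
  from this[THEN norm_L2_eq_0_iff] show ?thesis using is_fourier_L2_norm[OF d] by simp
qed

lemma is_fourier_L2_fourier:
  assumes "integrable \<mu> f" "f \<in> L2 \<mu>" "fourier \<mu> f \<in> L2 \<nu>"
  shows "is_fourier_L2 \<mu> \<nu> f (fourier \<mu> f)"
  unfolding is_fourier_L2_def using assms by (intro conjI exI[of _ "\<lambda>_. f"]) auto

lemma is_fourier_L2_exists: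
  assumes f: "f \<in> L2 \<mu>"
  shows "\<exists>F. is_fourier_L2 \<mu> \<nu> f F"
proof -
  \<comment> \<open>The extra factor 1 / 2 lets two successive errors add up to at most (1 / 2)^n,
    the rate required by \<open>L2_complete_fast\<close>.\<close>
  have "\<exists>s\<in>Step. norm_L2 \<mu> (\<lambda>x. f x - s x) < (1 / 2) ^ n / 2" for n :: nat
    using step_dense[OF f, of "(1 / 2) ^ n / 2"] by auto
  then obtain s where s: "\<And>n. s n \<in> Step" "\<And>n. norm_L2 \<mu> (\<lambda>x. f x - s n x) < (1 / 2) ^ n / 2"
    by metis
  have "norm_L2 \<nu> (\<lambda>\<gamma>. fourier \<mu> (s (Suc n)) \<gamma> - fourier \<mu> (s n) \<gamma>) \<le> (1 / 2) ^ n" for n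
  proof -
    have "(\<lambda>\<gamma>. fourier \<mu> (s (Suc n)) \<gamma> - fourier \<mu> (s n) \<gamma>) = fourier \<mu> (\<lambda>x. s (Suc n) x - s n x)"
      by (rule ext) (rule fourier_diff[OF Step_integrable Step_integrable, symmetric, OF s(1) s(1)])
    then have "norm_L2 \<nu> (\<lambda>\<gamma>. fourier \<mu> (s (Suc n)) \<gamma> - fourier \<mu> (s n) \<gamma>)
        = norm_L2 \<mu> (\<lambda>x. s (Suc n) x - s n x)"
      by (simp add: fourier_Step(2)[OF Step_diff[OF s(1) s(1)]])
    also have "\<dots> \<le> norm_L2 \<mu> (\<lambda>x. s (Suc n) x - f x) + norm_L2 \<mu> (\<lambda>x. f x - s n x)"
      by (intro norm_L2_triangle_diff Step_L2 s f)
    also have "\<dots> \<le> (1 / 2) ^ Suc n / 2 + (1 / 2) ^ n / 2"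
      using s(2)[of n] s(2)[of "Suc n"] norm_L2_minus_commute[of \<mu> f "s (Suc n)"] by simp
    also have "\<dots> \<le> (1 / 2) ^ n" by simp
    finally show ?thesis .
  qed
  from L2_complete_fast[OF fourier_Step(1)[OF s(1)] this]
  obtain F where F: "F \<in> L2 \<nu>" "(\<lambda>n. norm_L2 \<nu> (\<lambda>\<gamma>. fourier \<mu> (s n) \<gamma> - F \<gamma>)) \<longlonglongrightarrow> 0" by blast
  have "(\<lambda>n. norm_L2 \<mu> (\<lambda>x. s n x - f x)) \<longlonglongrightarrow> 0"
  proof (rule Lim_null_comparison)
    show "(\<lambda>n. (1 / 2) ^ n / 2 :: real) \<longlonglongrightarrow> 0"
      by (intro tendsto_divide_zero LIMSEQ_realpow_zero) auto
    show "\<forall>\<^sub>F n in sequentially. norm (norm_L2 \<mu> (\<lambda>x. s n x - f x)) \<le> (1 / 2) ^ n / 2"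
      using s(2) norm_L2_minus_commute[of \<mu> f] by (auto intro!: always_eventually less_imp_le)
  qed
  then have "is_fourier_L2 \<mu> \<nu> f F"
    unfolding is_fourier_L2_def using f F s(1)
    by (intro conjI exI[of _ s]) (auto intro: Step_L2 Step_integrable fourier_Step)
  then show ?thesis by (intro exI[of "\<lambda>F. is_fourier_L2 \<mu> \<nu> f F" F])
qed

text \<open>The interface to the chosen transform: from here on \<open>fourier_L2\<close> is handled
  only by comparison with an explicitly computed \<open>fourier \<mu> g\<close>.\<close>

lemma fourier_L2_AE_iff:
  assumes f: "f \<in> L2 \<mu>" and g: "integrable \<mu> g" "g \<in> L2 \<mu>" "fourier \<mu> g \<in> L2 \<nu>"
  shows "(AE \<gamma> in \<nu>. fourier_L2 \<mu> \<nu> f \<gamma> = fourier \<mu> g \<gamma>) \<longleftrightarrow> (AE x in \<mu>. f x = g x)"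
proof -
  have "is_fourier_L2 \<mu> \<nu> f (fourier_L2 \<mu> \<nu> f)"
    unfolding fourier_L2_def by (rule someI_ex[OF is_fourier_L2_exists[OF f]])
  then show ?thesis by (rule is_fourier_L2_AE_iff) (rule is_fourier_L2_fourier[OF g])
qed

end

lemma inner_L2_self: "inner_L2 M f f = of_real ((norm_L2 M f)\<^sup>2)"
  unfolding norm_L2_sq inner_L2_def integral_complex_of_real[symmetric] complex_norm_square ..

lemma inner_L2_cong_AE:
  assumes "f \<in> L2 M" "f' \<in> L2 M" "g \<in> L2 M" "g' \<in> L2 M"
    and "AE x in M. f x = f' x" "AE x in M. g x = g' x"
  shows "inner_L2 M f g = inner_L2 M f' g'"
  unfolding inner_L2_def
proof (rule integral_cong_AE)
  show "(\<lambda>x. f x * cnj (g x)) \<in> borel_measurable M" "(\<lambda>x. f' x * cnj (g' x)) \<in> borel_measurable M"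
    using assms(1-4) by (auto intro!: borel_measurable_integrable L2_mult_integrable)
  show "AE x in M. f x * cnj (g x) = f' x * cnj (g' x)" using assms(5,6) by eventually_elim simp
qed

text \<open>The index set may be uncountable, but each combination involves finitely many
  exceptional null sets.\<close>

lemma lin_span_cong_AE:
  assumes s: "s \<in> lin_span I w" and e: "\<And>i. i \<in> I \<Longrightarrow> AE x in M. e i x = w i x"
  shows "\<exists>t\<in>lin_span I e. AE x in M. t x = s x"
proof -
  from s obtain J c where J: "finite J" "J \<subseteq> I" "s = (\<lambda>x. \<Sum>i\<in>J. c i * w i x)"
    by (auto simp: lin_span_def)
  have "AE x in M. \<forall>i\<in>J. e i x = w i x"
    using J(1,2) e by (intro AE_finite_allI) auto
  then have "AE x in M. (\<Sum>i\<in>J. c i * e i x) = s x"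
    by eventually_elim (simp add: J(3))
  moreover have "(\<lambda>x. \<Sum>i\<in>J. c i * e i x) \<in> lin_span I e" using J(1,2) by (auto simp: lin_span_def)
  ultimately show ?thesis by (intro bexI)
qed

context expansive_lca
begin

section \<open>The wavelets\<close>

text \<open>Duality turns the adjoint image into the annihilator of the inverse image of
  \<open>H\<close>; the adjoint of \<open>inv A\<close> provides the preimages. The characters of
  the statement thereby enter the filtration.\<close>

lemma annihilator_K_1: "adjoint_aut A ` annihilator H = annihilator (K 1)"
proof safe
  fix \<gamma> assume "\<gamma> \<in> annihilator H"
  then show "adjoint_aut A \<gamma> \<in> annihilator (K 1)"
    by (auto simp: annihilator_def K_def aut_power_1[OF bij_A] simp flip: pairing_adjoint_aut[OF Aut_A])
next
  fix \<gamma> assume \<gamma>: "\<gamma> \<in> annihilator (K 1)"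
  define \<gamma>' where "\<gamma>' = adjoint_aut (inv A) \<gamma>"
  have *: "pairing x \<gamma>' = pairing (inv A x) \<gamma>" for x
    unfolding \<gamma>'_def by (rule pairing_adjoint_aut[OF Aut_inv[OF Aut_A], symmetric])
  have "adjoint_aut A \<gamma>' = \<gamma>"
  proof (rule dual_eqI)
    fix x
    have "pairing x (adjoint_aut A \<gamma>') = pairing (A x) \<gamma>'" by (rule pairing_adjoint_aut[OF Aut_A, symmetric])
    then show "pairing x (adjoint_aut A \<gamma>') = pairing x \<gamma>"
      unfolding * by (simp add: bij_is_inj[OF bij_A])
  qed
  moreover have "\<gamma>' \<in> annihilator H"
    using \<gamma> by (auto simp: annihilator_def * K_def aut_power_1[OF bij_A] surj_f_inv_f[OF bij_is_surj[OF bij_A]])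
  ultimately show "\<gamma> \<in> adjoint_aut A ` annihilator H" by blast
qed

section \<open>The characters selected by the coset representatives\<close>

context
  fixes D :: "'g dual set"
  assumes D: "coset_reps D (annihilator H)"
begin

lemma coset_reps_unique: "\<exists>!d. d \<in> D \<and> d - \<gamma> \<in> annihilator H"
  using D unfolding coset_reps_def quotient_group_def by (auto simp: mem_coset_iff)

lemma coset_reps_eqI: "d \<in> D \<Longrightarrow> d' \<in> D \<Longrightarrow> d - d' \<in> annihilator H \<Longrightarrow> d = d'"
  using coset_reps_unique[of d'] add_subgroup_zero[OF add_subgroup_annihilator, of H]
  by (metis diff_self)

definition Sig :: "'g dual set" where
  "Sig = D \<inter> (annihilator (K 1) - annihilator H)"

lemma transversal_D: "transversal (D \<inter> annihilator (K 1)) (annihilator H) (annihilator (K 1))"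
  unfolding transversal_def
proof (intro conjI ballI)
  fix \<gamma> assume \<gamma>: "\<gamma> \<in> annihilator (K 1)"
  have flip: "\<gamma> - d \<in> annihilator H \<longleftrightarrow> d - \<gamma> \<in> annihilator H" for d
    using add_subgroup_uminus[OF add_subgroup_annihilator] by (metis minus_diff_eq)
  have "d \<in> annihilator (K 1)" if "d - \<gamma> \<in> annihilator H" for d
    using add_subgroup_add[OF add_subgroup_annihilator _ \<gamma>, of "d - \<gamma>"]
      annihilator_antimono[OF K_1_subset] that by auto
  then have "d \<in> D \<inter> annihilator (K 1) \<and> \<gamma> - d \<in> annihilator H \<longleftrightarrow> d \<in> D \<and> d - \<gamma> \<in> annihilator H" for d
    unfolding flip by (intro iffI conjI IntI) simp_all
  then show "\<exists>!d. d \<in> D \<inter> annihilator (K 1) \<and> \<gamma> - d \<in> annihilator H"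
    using coset_reps_unique[of \<gamma>] by simp
qed simp

lemma transversal_H: "transversal R0 (K 1) H" "finite R0" "card R0 = q"
  using transversal_R0 finite_R0 by (auto simp: q_def)

text \<open>The trivial class may be represented in \<open>D\<close> by some \<open>t0\<close> other
  than 0. Being trivial on \<open>H\<close>, it contributes the summand 1 in
  \<open>sum_Sig\<close>.\<close>

lemma Sig_insert: "\<exists>t0\<in>annihilator H. t0 \<notin> Sig \<and> D \<inter> annihilator (K 1) = insert t0 Sig"
proof -
  obtain t0 where t0: "t0 \<in> D" "t0 \<in> annihilator H" using coset_reps_unique[of 0] by auto
  have eq: "t = t0" if "t \<in> D" "t \<in> annihilator H" for t
    by (intro coset_reps_eqI that t0 add_subgroup_diff[OF add_subgroup_annihilator])
  have "D \<inter> annihilator (K 1) = insert t0 Sig"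
    unfolding Sig_def using t0 eq annihilator_antimono[OF K_1_subset] by (intro equalityI subsetI) (blast, blast)
  moreover have "t0 \<notin> Sig" using t0(2) by (simp add: Sig_def)
  ultimately show ?thesis using t0(2) by (intro bexI conjI)
qed

lemma card_Sig: "card Sig = q - 1"
  and sum_Sig: "y \<in> H \<Longrightarrow> 1 + (\<Sum>t\<in>Sig. pairing y t) = (if y \<in> K 1 then of_nat q else 0)"
proof -
  obtain t0 where t0: "t0 \<in> annihilator H" "t0 \<notin> Sig" "D \<inter> annihilator (K 1) = insert t0 Sig"
    using Sig_insert by blast
  note T = transversal_D[unfolded t0(3)]
  note c = card_dual_transversal[OF transversal_H(1,2) T K_1_subset subgroup_K open_K subgroup_H]
  have fin: "finite Sig" using c(1) by simp
  show "card Sig = q - 1" using c(2) fin t0(2) transversal_H(3) by simp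
  show "1 + (\<Sum>t\<in>Sig. pairing y t) = (if y \<in> K 1 then of_nat q else 0)" if y: "y \<in> H"
    using sum_dual_transversal[OF T c(1) K_1_subset subgroup_K open_K y] fin t0(1,2) y
    by (simp add: c(2) transversal_H(3) annihilator_def)
qed

section \<open>The generators and their translates\<close>

context
  fixes \<sigma> :: "nat \<Rightarrow> 'g dual"
  assumes \<sigma>: "bij_betw \<sigma> {1..q - 1} Sig"
begin

lemma \<sigma>_mem:
  assumes "j \<in> {1..q - 1}"
  shows "\<sigma> j \<in> D" "\<sigma> j \<in> annihilator (K 1)" "\<sigma> j \<notin> annihilator H"
  using bij_betwE[OF \<sigma>] assms by (auto simp: Sig_def)

lemma \<sigma>_diff:
  assumes "j \<in> {1..q - 1}" "k \<in> {1..q - 1}" "j \<noteq> k"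
  shows "\<sigma> j - \<sigma> k \<notin> annihilator H"
  using coset_reps_eqI[OF \<sigma>_mem(1)[OF assms(1)] \<sigma>_mem(1)[OF assms(2)]] assms(3)
    inj_onD[OF bij_betw_imp_inj_on[OF \<sigma>] _ assms(1,2)] by blast

lemma sum_\<sigma>: "y \<in> H \<Longrightarrow> 1 + (\<Sum>j\<in>{1..q - 1}. pairing y (\<sigma> j)) = (if y \<in> K 1 then of_nat q else 0)"
  using sum_Sig[of y] sum.reindex_bij_betw[OF \<sigma>, of "\<lambda>t. pairing y t"] by simp

text \<open>For C = \<open>H\<close> this is the j-th generator, and for C a coset its translate.
  The translation moves the support but not the phase, because its multiplier involves
  \<open>\<gamma>\<close> only relative to \<open>\<sigma> j\<close>.\<close>

definition atom :: "nat \<Rightarrow> 'g set \<Rightarrow> 'g \<Rightarrow> complex" where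
  "atom j C x = pairing x (\<sigma> j) * indicator C x"

lemma borel_H [simp]: "H \<in> sets borel" using open_H by simp

lemma borel_coset_H [simp]: "coset c H \<in> sets borel"
  using borel_coset_K[of c 0] by simp

lemma measure_H [simp]: "measure \<mu> H = 1" by (simp add: measure_def \<mu>_H)

lemma atom_L12: "integrable \<mu> (atom j (coset s H))" "atom j (coset s H) \<in> L2 \<mu>"
proof -
  have "atom j (coset s H) = (\<lambda>x. indicator (coset s H) x * pairing x (\<sigma> j))"
    by (auto simp: atom_def mult.commute)
  then show "integrable \<mu> (atom j (coset s H))" "atom j (coset s H) \<in> L2 \<mu>"
    using indicator_mult_unimodular_L2(1,2)[of "coset s H" \<mu> "\<lambda>x. pairing x (\<sigma> j)"]
    by (auto simp: meas_\<mu> meas_pairing emeasure_coset[OF TI_\<mu>] \<mu>_H)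
qed

lemma fourier_atom:
  "fourier \<mu> (atom j (coset s H)) = (\<lambda>\<gamma>. indicator (coset (\<sigma> j) (annihilator H)) \<gamma> * cnj (pairing s (\<gamma> - \<sigma> j)))"
proof
  fix \<gamma>
  show "fourier \<mu> (atom j (coset s H)) \<gamma> = indicator (coset (\<sigma> j) (annihilator H)) \<gamma> * cnj (pairing s (\<gamma> - \<sigma> j))"
    using fourier_coset_character[OF borel_H subgroup_H, of "\<sigma> j" s \<gamma>]
    by (simp add: atom_def[abs_def] indicator_def mem_coset_iff)
qed

lemma fourier_atom_L2: "fourier \<mu> (atom j (coset s H)) \<in> L2 \<nu>"
proof -
  have "(\<lambda>\<gamma>. cnj (pairing s (\<gamma> - \<sigma> j))) = (\<lambda>\<gamma>. cnj (pairing s \<gamma>) * pairing s (\<sigma> j))"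
    by (simp add: pairing_diff_right)
  moreover have "(\<lambda>\<gamma>. cnj (pairing s \<gamma>) * pairing s (\<sigma> j)) \<in> borel_measurable borel"
    by (intro borel_measurable_times meas_cnj_pairing_right borel_measurable_const)
  ultimately have "(\<lambda>\<gamma>. cnj (pairing s (\<gamma> - \<sigma> j))) \<in> borel_measurable \<nu>" by (simp add: meas_\<nu>)
  then show ?thesis
    unfolding fourier_atom
    by (intro indicator_mult_unimodular_L2(2))
      (auto simp: sets_coset[OF TI_\<nu>] emeasure_coset[OF TI_\<nu>] \<nu>_H)
qed

lemma atom_H_eq_integral:
  "(LINT \<gamma>|\<nu>. indicator (coset (\<sigma> j) (annihilator H)) \<gamma> * pairing x \<gamma>) = atom j H x"
  using integral_annihilator_K_pairing[of "\<sigma> j" 0 x] by (simp add: atom_def)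

lemma coset_0_H [simp]: "coset 0 H = H" by (auto simp: mem_coset_iff)

lemma fourier_L2_atom_H:
  assumes "f \<in> L2 \<mu>"
  shows "(AE \<gamma> in \<nu>. fourier_L2 \<mu> \<nu> f \<gamma> = indicator (coset (\<sigma> j) (annihilator H)) \<gamma>) \<longleftrightarrow> (AE x in \<mu>. f x = atom j H x)"
proof -
  have "fourier \<mu> (atom j H) = indicator (coset (\<sigma> j) (annihilator H))"
    using fourier_atom[of j 0] by (simp add: fun_eq_iff)
  then show ?thesis using fourier_L2_AE_iff[OF assms atom_L12 fourier_atom_L2, of j 0] by simp
qed

lemma theta_eq:
  assumes "j \<in> {1..q - 1}" "\<gamma> \<in> coset (\<sigma> j) (annihilator H)"
  shows "theta H D \<gamma> = \<sigma> j"
  unfolding theta_def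
proof (rule the_equality)
  have "\<sigma> j - \<gamma> \<in> annihilator H"
    using add_subgroup_uminus[OF add_subgroup_annihilator, of "\<gamma> - \<sigma> j" H] assms(2) by (simp add: mem_coset_iff)
  then show *: "\<sigma> j \<in> D \<inter> coset \<gamma> (annihilator H)"
    using \<sigma>_mem(1)[OF assms(1)] by (simp add: mem_coset_iff)
  show "d = \<sigma> j" if "d \<in> D \<inter> coset \<gamma> (annihilator H)" for d
    using coset_reps_unique[of \<gamma>] that * by (auto simp: mem_coset_iff)
qed

text \<open>On the support of the transform \<open>theta\<close> is constantly
  \<open>\<sigma> j\<close>, so the multiplier turns the indicator into the transform of the atom on
  the coset of s. Injectivity of the Fourier transform does the rest.\<close>

lemma translation_atom:
  assumes j: "j \<in> {1..q - 1}"
  shows "translation \<mu> \<nu> H D (coset s H) (atom j H) \<in> L2 \<mu>"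
    and "AE x in \<mu>. translation \<mu> \<nu> H D (coset s H) (atom j H) x = atom j (coset s H) x"
proof -
  let ?w = "w_fun H D (coset s H)"
  have F: "AE \<gamma> in \<nu>. fourier_L2 \<mu> \<nu> (atom j H) \<gamma> = indicator (coset (\<sigma> j) (annihilator H)) \<gamma>"
    using fourier_L2_atom_H[of "atom j H" j] atom_L12(2)[of j 0] by simp
  have w: "indicator (coset (\<sigma> j) (annihilator H)) \<gamma> * ?w \<gamma> = fourier \<mu> (atom j (coset s H)) \<gamma>" for \<gamma>
    by (cases "\<gamma> \<in> coset (\<sigma> j) (annihilator H)")
      (simp_all add: fourier_atom w_fun_coset[OF subgroup_H D] eta_def theta_eq[OF j])
  have iff: "(AE \<gamma> in \<nu>. fourier_L2 \<mu> \<nu> g \<gamma> = fourier_L2 \<mu> \<nu> (atom j H) \<gamma> * ?w \<gamma>)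
      \<longleftrightarrow> (AE x in \<mu>. g x = atom j (coset s H) x)" if "g \<in> L2 \<mu>" for g
  proof -
    have "AE \<gamma> in \<nu>. fourier_L2 \<mu> \<nu> (atom j H) \<gamma> * ?w \<gamma> = fourier \<mu> (atom j (coset s H)) \<gamma>"
      using F by eventually_elim (simp add: w)
    then have "(AE \<gamma> in \<nu>. fourier_L2 \<mu> \<nu> g \<gamma> = fourier_L2 \<mu> \<nu> (atom j H) \<gamma> * ?w \<gamma>)
        \<longleftrightarrow> (AE \<gamma> in \<nu>. fourier_L2 \<mu> \<nu> g \<gamma> = fourier \<mu> (atom j (coset s H)) \<gamma>)"
      by (intro eventually_cong) (auto elim: eventually_mono)
    also have "\<dots> \<longleftrightarrow> (AE x in \<mu>. g x = atom j (coset s H) x)"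
      by (rule fourier_L2_AE_iff[OF that atom_L12 fourier_atom_L2])
    finally show ?thesis .
  qed
  let ?P = "\<lambda>g. g \<in> L2 \<mu> \<and> (AE \<gamma> in \<nu>. fourier_L2 \<mu> \<nu> g \<gamma> = fourier_L2 \<mu> \<nu> (atom j H) \<gamma> * ?w \<gamma>)"
  \<comment> \<open>The explicit atom shows that the choice by \<open>SOME\<close> has a witness; by
    \<open>iff\<close> whatever is chosen agrees with it almost everywhere.\<close>
  have "?P (atom j (coset s H))" using iff[OF atom_L12(2)] atom_L12(2) by simp
  then have *: "?P (translation \<mu> \<nu> H D (coset s H) (atom j H))"
    unfolding translation_def by (rule someI[of ?P])
  then show "translation \<mu> \<nu> H D (coset s H) (atom j H) \<in> L2 \<mu>" by blast
  from * show "AE x in \<mu>. translation \<mu> \<nu> H D (coset s H) (atom j H) x = atom j (coset s H) x"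
    using iff by blast
qed

section \<open>Explicit wavelets and their orthonormality\<close>

definition wav :: "nat \<Rightarrow> int \<Rightarrow> 'g \<Rightarrow> 'g \<Rightarrow> complex" where
  "wav j n s x = of_real (sqrt (real q powi n)) * atom j (coset s H) (aut_power A n x)"

lemma meas_power: "aut_power A n \<in> borel \<rightarrow>\<^sub>M borel"
  by (intro borel_measurable_continuous_onI Aut_continuous Aut_power)

lemma dilation_translation:
  assumes j: "j \<in> {1..q - 1}"
  shows "dilation \<mu> (aut_power A n) (translation \<mu> \<nu> H D (coset s H) (atom j H)) \<in> borel_measurable \<mu>"
    and "AE x in \<mu>. dilation \<mu> (aut_power A n) (translation \<mu> \<nu> H D (coset s H) (atom j H)) x = wav j n s x"
proof -
  let ?t = "translation \<mu> \<nu> H D (coset s H) (atom j H)"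
  have "?t \<in> borel_measurable borel"
    using L2_measurable[OF translation_atom(1)[OF j]] by (simp add: meas_\<mu>)
  then have "(\<lambda>x. ?t (aut_power A n x)) \<in> borel_measurable borel"
    by (rule measurable_compose[OF meas_power])
  then show "dilation \<mu> (aut_power A n) ?t \<in> borel_measurable \<mu>"
    unfolding dilation_def[abs_def] meas_\<mu> by (intro borel_measurable_times borel_measurable_const)
  show "AE x in \<mu>. dilation \<mu> (aut_power A n) ?t x = wav j n s x"
    using AE_power[OF translation_atom(2)[OF j, of s], of n]
    by eventually_elim (simp add: dilation_def wav_def modulus_power)
qed

lemma mem_coset_power: "aut_power A n x \<in> coset s H \<longleftrightarrow> x \<in> coset (aut_power A (- n) s) (K n)"
  by (simp add: mem_coset_iff K_def power_diff)

lemma wav_L2: "wav j n s \<in> L2 \<mu>" and norm_wav: "norm_L2 \<mu> (wav j n s) = 1"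
proof -
  let ?C = "coset (aut_power A (- n) s) (K n)"
  let ?g = "\<lambda>x. indicator ?C x * pairing (aut_power A n x) (\<sigma> j)"
  have eq: "wav j n s = (\<lambda>x. of_real (sqrt (real q powi n)) * ?g x)"
    unfolding wav_def[abs_def] atom_def by (simp add: fun_eq_iff indicator_def mem_coset_power)
  have m: "(\<lambda>x. pairing (aut_power A n x) (\<sigma> j)) \<in> borel_measurable \<mu>"
    unfolding meas_\<mu> by (rule measurable_compose[OF meas_power meas_pairing])
  have fin: "?C \<in> sets \<mu>" "emeasure \<mu> ?C < \<infinity>" by (simp_all add: emeasure_coset_K)
  show "wav j n s \<in> L2 \<mu>"
    unfolding eq by (intro L2_scale indicator_mult_unimodular_L2 m fin) simp
  have "norm_L2 \<mu> ?g = sqrt (real q powi (- n))"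
    using indicator_mult_unimodular_L2(3)[OF fin m] by (simp add: measure_coset[OF TI_\<mu>] measure_K)
  then have "norm_L2 \<mu> (wav j n s) = sqrt (real q powi n * real q powi (- n))"
    unfolding eq norm_L2_scale by (simp add: real_sqrt_mult)
  then show "norm_L2 \<mu> (wav j n s) = 1" using q_pos by (simp add: power_int_minus)
qed

lemma wav_shift:
  assumes "aut_power A n h \<in> H"
  shows "wav j n s (h + x) = pairing (aut_power A n h) (\<sigma> j) * wav j n s x"
proof -
  have "aut_power A n (h + x) \<in> coset s H \<longleftrightarrow> aut_power A n x \<in> coset s H"
    using add_subgroup_add_cancel(1)[OF subgroup_H assms, of "aut_power A n x - s"]
    by (simp add: mem_coset_iff Aut_add[OF Aut_power] add_diff_eq)
  then show ?thesis
    by (simp add: wav_def atom_def indicator_def Aut_add[OF Aut_power] pairing_add_left mult_ac)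
qed

text \<open>A translation by h in both \<open>K n\<close> and \<open>K m\<close> multiplies each
  wavelet by a character value; if the combined factor is not 1, the integral is twisted and
  vanishes.\<close>

lemma inner_wav_shift:
  assumes h: "aut_power A n h \<in> H" "aut_power A m h \<in> H"
    and ne: "pairing (aut_power A n h) (\<sigma> j) * cnj (pairing (aut_power A m h) (\<sigma> k)) \<noteq> 1"
  shows "inner_L2 \<mu> (wav j n s) (wav k m t) = 0"
  unfolding inner_L2_def
proof (rule integral_twisted_eq_0[OF TI_\<mu> _ _ ne])
  show "(\<lambda>x. wav j n s x * cnj (wav k m t x)) \<in> borel_measurable \<mu>"
    by (intro borel_measurable_integrable L2_mult_integrable wav_L2)
  show "wav j n s (h + x) * cnj (wav k m t (h + x))
      = pairing (aut_power A n h) (\<sigma> j) * cnj (pairing (aut_power A m h) (\<sigma> k)) * (wav j n s x * cnj (wav k m t x))" for x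
    by (simp add: wav_shift[OF h(1)] wav_shift[OF h(2)])
qed

text \<open>The translation is chosen at the finer scale m, by an h in \<open>H\<close> that
  \<open>\<sigma> k\<close> detects. Seen at the coarser scale n it falls into \<open>K 1\<close>,
  where \<open>\<sigma> j\<close> is trivial, so only the second factor is twisted.\<close>

lemma inner_wav_lt:
  assumes jk: "j \<in> {1..q - 1}" "k \<in> {1..q - 1}" and nm: "n < m"
  shows "inner_L2 \<mu> (wav j n s) (wav k m t) = 0"
proof -
  obtain h where h: "h \<in> H" "pairing h (\<sigma> k) \<noteq> 1"
    using \<sigma>_mem(3)[OF jk(2)] by (auto simp: annihilator_def)
  have n: "aut_power A n (aut_power A (- m) h) = aut_power A (n - m) h"
    using aut_power_add[OF bij_A, of n "- m" h] by simp
  have "aut_power A (n - m) h \<in> K (m - n)" using h(1) mem_K_shift[of h "n - m" "m - n"] by simp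
  then have k1: "aut_power A (n - m) h \<in> K 1" using K_antimono[of 1 "m - n"] nm by auto
  then have "pairing (aut_power A (n - m) h) (\<sigma> j) = 1"
    using \<sigma>_mem(2)[OF jk(1)] by (simp add: annihilator_def)
  with h k1 K_1_subset show ?thesis
    by (intro inner_wav_shift[where h = "aut_power A (- m) h"]) (auto simp: n complex_eq_iff)
qed

lemma orthonormal_wav:
  assumes "j \<in> {1..q - 1}" "k \<in> {1..q - 1}"
  shows "inner_L2 \<mu> (wav j n s) (wav k m t) = (if j = k \<and> n = m \<and> coset s H = coset t H then 1 else 0)"
proof -
  consider "n < m" | "m < n" | "n = m" "j \<noteq> k" | "n = m" "j = k" "coset s H \<noteq> coset t H"
    | "n = m" "j = k" "coset s H = coset t H" by linarith
  then show ?thesis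
  proof cases
    case 1
    then show ?thesis using inner_wav_lt[OF assms] by simp
  next
    case 2
    then show ?thesis
      using inner_wav_lt[OF assms(2,1)] inner_L2_commute[of \<mu> "wav j n s" "wav k m t"] by simp
  next
    case 3
    \<comment> \<open>Distinct \<open>\<sigma> j\<close> and \<open>\<sigma> k\<close> lie in
      different cosets of \<open>annihilator H\<close>, so some element of \<open>H\<close>
      distinguishes them.\<close>
    obtain h where h: "h \<in> H" "pairing h (\<sigma> j - \<sigma> k) \<noteq> 1"
      using \<sigma>_diff[OF assms 3(2)] by (auto simp: annihilator_def)
    then have "inner_L2 \<mu> (wav j n s) (wav k n t) = 0"
      by (intro inner_wav_shift[where h = "aut_power A (- n) h"]) (auto simp: pairing_diff_right)
    with 3 show ?thesis by simp
  next
    case 4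
    have "\<not> (y \<in> coset s H \<and> y \<in> coset t H)" for y
    proof
      assume "y \<in> coset s H \<and> y \<in> coset t H"
      then have "(y - t) - (y - s) \<in> H" by (intro add_subgroup_diff[OF subgroup_H, of "y - t"]) (auto simp: mem_coset_iff)
      then show False using 4(3) by (simp add: coset_eq_iff[OF subgroup_H])
    qed
    then have 0: "wav j n s x * cnj (wav k m t x) = 0" for x
      using 4 by (auto simp: wav_def atom_def indicator_def)
    have "inner_L2 \<mu> (wav j n s) (wav k m t) = 0"
      by (simp only: inner_L2_def 0 Bochner_Integration.integral_zero)
    with 4 show ?thesis by simp
  next
    case 5
    then have "wav k m t = wav j n s" by (simp add: wav_def[abs_def])
    with 5 show ?thesis by (simp add: inner_L2_self norm_wav)
  qed
qed

text \<open>One refinement step: the indicator of a coset of \<open>K (n + 1)\<close> is the average of the \<open>q\<close>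
  characters of \<open>K n\<close> modulo \<open>K (n + 1)\<close>; the nontrivial ones are the wavelets at scale \<open>n\<close>.\<close>

lemma step_refine:
  "step (n + 1, c) x = 1 / of_nat q * step (n, c) x + (\<Sum>j\<in>{1..q - 1}.
     (cnj (pairing (aut_power A n c) (\<sigma> j)) / (of_nat q * of_real (sqrt (real q powi n)))) * wav j n (aut_power A n c) x)"
proof (cases "x - c \<in> K n")
  case False
  moreover from this have "x - c \<notin> K (n + 1)" using K_plus_1_subset by blast
  moreover have "aut_power A n x \<notin> coset (aut_power A n c) H"
    using False by (simp add: mem_coset_iff K_def power_diff)
  ultimately show ?thesis by (simp add: step_def wav_def atom_def mem_coset_iff)
next
  case True
  define y where "y = aut_power A n (x - c)"
  have y: "y \<in> H" using True by (simp add: y_def K_def)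
  have q0: "(of_nat q :: complex) \<noteq> 0" "sqrt (real q powi n) \<noteq> 0" using q_pos by simp_all
  have "x - c \<in> K (n + 1) \<longleftrightarrow> y \<in> K 1" by (simp add: mem_K_shift y_def)
  then have "step (n + 1, c) x = (1 + (\<Sum>j\<in>{1..q - 1}. pairing y (\<sigma> j))) / of_nat q"
    unfolding sum_\<sigma>[OF y] by (simp add: step_def mem_coset_iff)
  also have "\<dots> = 1 / of_nat q * step (n, c) x + (\<Sum>j\<in>{1..q - 1}. pairing y (\<sigma> j) / of_nat q)"
    using True by (simp add: step_def mem_coset_iff add_divide_distrib sum_divide_distrib)
  also have "(\<Sum>j\<in>{1..q - 1}. pairing y (\<sigma> j) / of_nat q) = (\<Sum>j\<in>{1..q - 1}.
     (cnj (pairing (aut_power A n c) (\<sigma> j)) / (of_nat q * of_real (sqrt (real q powi n)))) * wav j n (aut_power A n c) x)"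
  \<comment> \<open>The coefficient undoes the normalisation of the wavelet and moves the base point
    of the character from 0 to c.\<close>
  proof (rule sum.cong[OF refl])
    fix j
    have "aut_power A n x \<in> coset (aut_power A n c) H"
      using y by (simp add: mem_coset_iff y_def power_diff)
    then have "wav j n (aut_power A n c) x = of_real (sqrt (real q powi n)) * pairing (aut_power A n x) (\<sigma> j)"
      by (simp add: wav_def atom_def)
    moreover have "pairing y (\<sigma> j) = pairing (aut_power A n x) (\<sigma> j) * cnj (pairing (aut_power A n c) (\<sigma> j))"
      by (simp add: y_def power_diff pairing_diff_left)
    ultimately show "pairing y (\<sigma> j) / of_nat q
        = (cnj (pairing (aut_power A n c) (\<sigma> j)) / (of_nat q * of_real (sqrt (real q powi n)))) * wav j n (aut_power A n c) x"
      using q0 by (simp add: divide_simps)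
  qed
  finally show ?thesis .
qed

section \<open>Density of the span of the wavelets\<close>

abbreviation "wavs \<equiv> lin_span ({1..q - 1} \<times> UNIV \<times> UNIV) (\<lambda>(j, n, s). wav j n s)"

lemma wav_mem: "j \<in> {1..q - 1} \<Longrightarrow> wav j n s \<in> wavs"
  using lin_span_base[of "(j, n, s)" "{1..q - 1} \<times> UNIV \<times> UNIV" "\<lambda>(j, n, s). wav j n s"] by simp

lemma step_coarsen:
  "(\<lambda>x. step (n, c) x - (1 / of_nat q) ^ m * step (n - int m, c) x) \<in> wavs"
proof (induction m)
  case 0
  show ?case using lin_span_zero by simp
next
  case (Suc m)
  let ?r = "\<lambda>x. step (n - int m, c) x - 1 / of_nat q * step (n - int m - 1, c) x"
  have "?r x = (\<Sum>j\<in>{1..q - 1}. (cnj (pairing (aut_power A (n - int m - 1) c) (\<sigma> j)) /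
      (of_nat q * of_real (sqrt (real q powi (n - int m - 1))))) * wav j (n - int m - 1) (aut_power A (n - int m - 1) c) x)" for x
    using step_refine[of "n - int m - 1" c x] by simp
  then have "?r \<in> wavs" by (simp only:) (intro lin_span_sum lin_span_scale wav_mem)
  from lin_span_add[OF Suc lin_span_scale[OF this, of "(1 / of_nat q) ^ m"]]
  have "(\<lambda>x. step (n, c) x - (1 / of_nat q) ^ m * step (n - int m, c) x + (1 / of_nat q) ^ m * ?r x) \<in> wavs" .
  moreover have "step (n, c) x - (1 / of_nat q) ^ m * step (n - int m, c) x + (1 / of_nat q) ^ m * ?r x
      = step (n, c) x - (1 / of_nat q) ^ Suc m * step (n - int (Suc m), c) x" for x
    by (simp add: algebra_simps)
  ultimately show ?case by (simp only:)
qed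

text \<open>The averages over larger and larger cosets tend to \<open>0\<close> in norm because the measures of the
  cosets grow.\<close>

lemma step_approx_wavs:
  assumes \<epsilon>: "\<epsilon> > 0"
  shows "\<exists>s\<in>wavs. norm_L2 \<mu> (\<lambda>x. step i x - s x) < \<epsilon>"
proof (cases i)
  case (Pair n c)
  \<comment> \<open>The averaging factor q^-m enters the squared norm twice, while the measure of
    the coset grows only by q^m; a factor q^-m remains.\<close>
  have nrm: "norm_L2 \<mu> (\<lambda>x. (1 / of_nat q) ^ m * step (n - int m, c) x)
      = sqrt (real q powi (- n) * (1 / real q) ^ m)" for m
  proof -
    have "norm_L2 \<mu> (step (n - int m, c)) = sqrt (real q powi (int m - n))"
      using indicator_mult_unimodular_L2(3)[of "coset c (K (n - int m))" \<mu> "\<lambda>_. 1"]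
      by (simp add: step_def emeasure_coset_K measure_coset[OF TI_\<mu>] measure_K)
    then have "norm_L2 \<mu> (\<lambda>x. (1 / of_nat q) ^ m * step (n - int m, c) x)
        = (1 / real q) ^ m * sqrt (real q powi (int m - n))"
      unfolding norm_L2_scale by (simp add: norm_power norm_divide)
    also have "\<dots> = sqrt (((1 / real q) ^ m)\<^sup>2 * real q powi (int m - n))"
      by (simp add: real_sqrt_mult)
    also have "((1 / real q) ^ m)\<^sup>2 * real q powi (int m - n) = real q powi (- n) * (1 / real q) ^ m"
      using q_pos by (simp add: power_int_diff power_int_minus power2_eq_square field_simps)
    finally show ?thesis .
  qed
  have "(\<lambda>m. sqrt (real q powi (- n) * (1 / real q) ^ m)) \<longlonglongrightarrow> sqrt (real q powi (- n) * 0)"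
    using q_ge_2 by (intro tendsto_intros LIMSEQ_realpow_zero) auto
  then have "\<forall>\<^sub>F m in sequentially. sqrt (real q powi (- n) * (1 / real q) ^ m) < \<epsilon>"
    using \<epsilon> by (intro order_tendstoD(2)) auto
  then obtain m where m: "sqrt (real q powi (- n) * (1 / real q) ^ m) < \<epsilon>"
    using eventually_happens'[OF sequentially_bot] by blast
  show ?thesis
    by (rule bexI[OF _ step_coarsen[of n c m]]) (use m in \<open>simp add: Pair nrm\<close>)
qed

lemma wavs_dense:
  assumes f: "f \<in> L2 \<mu>" and \<epsilon>: "\<epsilon> > 0"
  shows "\<exists>s\<in>wavs. norm_L2 \<mu> (\<lambda>x. f x - s x) < \<epsilon>"
proof -
  have wL: "(\<lambda>(j, n, s). wav j n s) i \<in> L2 \<mu>" for i by (cases i) (simp add: wav_L2)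
  obtain s where s: "s \<in> Step" "norm_L2 \<mu> (\<lambda>x. f x - s x) < \<epsilon> / 2"
    using step_dense[OF f, of "\<epsilon> / 2"] \<epsilon> by auto
  obtain t where t: "t \<in> wavs" "norm_L2 \<mu> (\<lambda>x. s x - t x) < \<epsilon> / 2"
    using lin_span_approx_lin_span[OF step_L12(2) wL step_approx_wavs s(1), of "\<epsilon> / 2"] \<epsilon> by auto
  have "norm_L2 \<mu> (\<lambda>x. f x - t x) < \<epsilon>"
    using norm_L2_triangle_diff[OF f Step_L2[OF s(1)] lin_span_L2[OF wL t(1)]] s(2) t(2) by linarith
  with t(1) show ?thesis by blast
qed

text \<open>Transfers the results from \<open>wav\<close>, indexed by exponents and representatives,
  to the defined family, indexed by automorphisms and cosets.\<close>

lemma wavelet_generators_atom: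
  assumes \<psi>: "\<And>j. j \<in> {1..q - 1} \<Longrightarrow> \<psi> j = atom j H"
  shows "wavelet_generators \<mu> \<nu> H D (range (aut_power A)) (q - 1) \<psi>"
proof -
  define I where "I = {1..q - 1} \<times> range (aut_power A) \<times> quotient_group H"
  define e where "e = (\<lambda>(j, A', C). dilation \<mu> A' (translation \<mu> \<nu> H D C (\<psi> j)))"
  have e: "e (j, aut_power A n, coset s H) \<in> L2 \<mu>"
    "AE x in \<mu>. e (j, aut_power A n, coset s H) x = wav j n s x" if "j \<in> {1..q - 1}" for j n s
  proof -
    have eq: "e (j, aut_power A n, coset s H) = dilation \<mu> (aut_power A n) (translation \<mu> \<nu> H D (coset s H) (atom j H))"
      using \<psi>[OF that] by (simp add: e_def)
    note * = dilation_translation[OF that, of n s, folded eq]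
    show "AE x in \<mu>. e (j, aut_power A n, coset s H) x = wav j n s x" by (rule *(2))
    then have "AE x in \<mu>. wav j n s x = e (j, aut_power A n, coset s H) x"
      by eventually_elim simp
    then show "e (j, aut_power A n, coset s H) \<in> L2 \<mu>" by (rule L2_cong_AE[OF wav_L2 *(1)])
  qed
  have IE: "\<exists>j n s. i = (j, aut_power A n, coset s H) \<and> j \<in> {1..q - 1}" if "i \<in> I" for i
    using that by (auto simp: I_def quotient_group_def)
  have "orthonormal_basis_L2 \<mu> I e"
    unfolding orthonormal_basis_L2_def
  proof (intro conjI ballI allI impI)
    fix i assume "i \<in> I"
    then show "e i \<in> L2 \<mu>" using IE[of i] e(1) by blast
  next
    fix i k assume "i \<in> I" "k \<in> I"
    from IE[OF this(1)] IE[OF this(2)] obtain j n s j' n' s' where i: "i = (j, aut_power A n, coset s H)" "j \<in> {1..q - 1}"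
      and k: "k = (j', aut_power A n', coset s' H)" "j' \<in> {1..q - 1}"
      by (elim exE conjE)
    have "inner_L2 \<mu> (e i) (e k) = inner_L2 \<mu> (wav j n s) (wav j' n' s')"
      unfolding i(1) k(1) by (intro inner_L2_cong_AE e wav_L2 i(2) k(2))
    also have "\<dots> = (if j = j' \<and> n = n' \<and> coset s H = coset s' H then 1 else 0)"
      by (rule orthonormal_wav[OF i(2) k(2)])
    also have "(j = j' \<and> n = n' \<and> coset s H = coset s' H) \<longleftrightarrow> i = k"
    proof -
      \<comment> \<open>Distinct powers of \<open>A\<close> have distinct moduli because q > 1, so
        an automorphism in the index determines its exponent.\<close>
      have "n = n'" if "aut_power A n = aut_power A n'"
      proof -
        have "real q powi n = real q powi n'"
          unfolding modulus_power[symmetric] that ..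
        then show ?thesis
          using q_ge_2 power_int_strict_increasing[of n n' "real q"] power_int_strict_increasing[of n' n "real q"]
          by (cases n n' rule: linorder_cases) auto
      qed
      then show ?thesis by (auto simp: i(1) k(1))
    qed
    finally show "inner_L2 \<mu> (e i) (e k) = (if i = k then 1 else 0)" .
  next
    fix f :: "'g \<Rightarrow> complex" and \<epsilon> :: real assume f: "f \<in> L2 \<mu>" and \<epsilon>: "\<epsilon> > 0"
    obtain s where s: "s \<in> wavs" "norm_L2 \<mu> (\<lambda>x. f x - s x) < \<epsilon>"
      using wavs_dense[OF f \<epsilon>] by blast
    let ?I = "{1..q - 1} \<times> (UNIV :: int set) \<times> (UNIV :: 'g set)"
    let ?e = "\<lambda>(j, n, s). e (j, aut_power A n, coset s H)"
    have "AE x in \<mu>. ?e i x = (\<lambda>(j, n, s). wav j n s) i x" if "i \<in> ?I" for i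
      using that e(2) by auto
    from lin_span_cong_AE[OF s(1) this] obtain t where t: "t \<in> lin_span ?I ?e" "AE x in \<mu>. t x = s x" by blast
    \<comment> \<open>Different representatives s may give the same index in I; taking sums inside
      \<open>lin_span I e\<close> merges the repeated terms.\<close>
    have tI: "t \<in> lin_span I e"
    proof -
      from t(1) obtain J c where J: "finite J" "J \<subseteq> ?I" "t = (\<lambda>x. \<Sum>i\<in>J. c i * ?e i x)"
        by (auto simp: lin_span_def)
      show ?thesis unfolding J(3)
      proof (intro lin_span_sum lin_span_scale)
        fix i assume "i \<in> J"
        then obtain j n s where i: "i = (j, n, s)" "j \<in> {1..q - 1}" using J(2) by auto
        then have "(j, aut_power A n, coset s H) \<in> I" by (auto simp: I_def quotient_group_def)
        from lin_span_base[OF this, of e] show "?e i \<in> lin_span I e" by (simp add: i)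
      qed
    qed
    have eL2: "e i \<in> L2 \<mu>" if "i \<in> I" for i using IE[OF that] e(1) by blast
    have sL2: "s \<in> L2 \<mu>" by (rule lin_span_L2[OF _ s(1)]) (auto simp: wav_L2)
    have "norm_L2 \<mu> (\<lambda>x. f x - t x) = norm_L2 \<mu> (\<lambda>x. f x - s x)"
    proof (rule norm_L2_cong_AE)
      show "(\<lambda>x. f x - t x) \<in> borel_measurable \<mu>"
        by (rule L2_measurable[OF L2_diff[OF f lin_span_L2[OF eL2 tI]]])
      show "(\<lambda>x. f x - s x) \<in> borel_measurable \<mu>"
        by (rule L2_measurable[OF L2_diff[OF f sL2]])
      show "AE x in \<mu>. f x - t x = f x - s x" using t(2) by eventually_elim simp
    qed
    moreover from tI obtain J c where "finite J" "J \<subseteq> I" "t = (\<lambda>x. \<Sum>i\<in>J. c i * e i x)"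
      by (auto simp: lin_span_def)
    ultimately show "\<exists>J c. finite J \<and> J \<subseteq> I \<and> norm_L2 \<mu> (\<lambda>x. f x - (\<Sum>i\<in>J. c i * e i x)) < \<epsilon>"
      using s(2) by (intro exI[of _ J] exI[of _ c]) simp
  qed
  moreover have "\<psi> j \<in> L2 \<mu>" if "j \<in> {1..q - 1}" for j
    using \<psi>[OF that] atom_L12(2)[of j 0] by simp
  ultimately show ?thesis
    unfolding wavelet_generators_def I_def e_def using Aut_power by auto
qed

text \<open>Elements of \<open>K 1\<close> lie in \<open>H\<close>, which fixes the indicator, and
  are annihilated by \<open>\<sigma> j\<close>, which fixes the character.\<close>

lemma atom_constant_on:
  assumes j: "j \<in> {1..q - 1}"
  shows "atom j H constant_on coset c (K 1)"
  unfolding constant_on_def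
proof (intro exI ballI)
  fix x assume "x \<in> coset c (K 1)"
  then have k: "x - c \<in> K 1" by (simp add: mem_coset_iff)
  then have "x - c \<in> H" using K_1_subset by blast
  then have "x \<in> H \<longleftrightarrow> c \<in> H" using add_subgroup_add_cancel(1)[OF subgroup_H, of "x - c" c] by simp
  moreover have "pairing (x - c) (\<sigma> j) = 1" using \<sigma>_mem(2)[OF j] k by (simp add: annihilator_def)
  then have "pairing x (\<sigma> j) = pairing c (\<sigma> j)" using pairing_add_left[of "x - c" c "\<sigma> j"] by simp
  ultimately show "atom j H x = atom j H c" by (simp add: atom_def indicator_def)
qed

end

end

end

theorem proposition5p1:
  fixes H :: "'g::{topological_ab_group_add,t2_space} set"
    and \<mu> :: "'g measure" and \<nu> :: "'g dual measure"
    and D :: "'g dual set" and A\<^sub>1 :: "'g \<Rightarrow> 'g"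
  assumes "locally_compact_space (euclidean :: 'g topology)"
    and "add_subgroup H" and "compact H" and "open H"
    and "haar_measure \<mu>" and "emeasure \<mu> H = 1"
    and "haar_measure \<nu>" and "emeasure \<nu> (annihilator H) = 1"
    and "coset_reps D (annihilator H)"
    and "A\<^sub>1 \<in> Aut" and "expansive H A\<^sub>1"
  shows "\<exists>N::nat. real N = modulus \<mu> A\<^sub>1 - 1 \<and> N \<ge> 1 \<and>
    card (D \<inter> (adjoint_aut A\<^sub>1 ` annihilator H - annihilator H)) = N \<and>
    (\<forall>\<sigma> :: nat \<Rightarrow> 'g dual. \<forall>\<Omega> :: nat \<Rightarrow> 'g dual set. \<forall>\<psi> :: nat \<Rightarrow> 'g \<Rightarrow> complex.
       bij_betw \<sigma> {1..N} (D \<inter> (adjoint_aut A\<^sub>1 ` annihilator H - annihilator H)) \<longrightarrow>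
       (\<forall>j\<in>{1..N}. \<Omega> j = coset (\<sigma> j) (annihilator H)) \<longrightarrow>
       (\<forall>j\<in>{1..N}. \<forall>x. \<psi> j x = (LINT \<gamma>|\<nu>. indicator (\<Omega> j) \<gamma> * pairing x \<gamma>)) \<longrightarrow>
         (\<forall>j\<in>{1..N}. \<psi> j \<in> L2 \<mu> \<and>
            (\<forall>f\<in>L2 \<mu>. (AE \<gamma> in \<nu>. fourier_L2 \<mu> \<nu> f \<gamma> = indicator (\<Omega> j) \<gamma>)
                        \<longleftrightarrow> (AE x in \<mu>. f x = \<psi> j x))) \<and>
         wavelet_generators \<mu> \<nu> H D (range (aut_power A\<^sub>1)) N \<psi> \<and>
         (\<forall>j\<in>{1..N}. \<forall>x. \<psi> j x = pairing x (\<sigma> j) * indicator H x) \<and>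
         (\<forall>j\<in>{1..N}. \<forall>c. open (coset c (inv A\<^sub>1 ` H)) \<and> \<psi> j constant_on coset c (inv A\<^sub>1 ` H)))"
proof -
  interpret expansive_lca H \<mu> \<nu> A\<^sub>1 by unfold_locales fact+
  note D = \<open>coset_reps D (annihilator H)\<close>
  have S: "D \<inter> (adjoint_aut A\<^sub>1 ` annihilator H - annihilator H) = Sig D"
    unfolding annihilator_K_1 Sig_def[OF D] ..
  have K1: "inv A\<^sub>1 ` H = K 1" unfolding K_eq_image aut_power_def by simp
  show ?thesis
    unfolding S K1
  proof (intro exI[of _ "q - 1"] conjI allI impI)
    show "real (q - 1) = modulus \<mu> A\<^sub>1 - 1" "q - 1 \<ge> 1" using q_ge_2 by (auto simp: modulus_A)
    show "card (Sig D) = q - 1" by (rule card_Sig[OF D])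
  next
    fix \<sigma> \<Omega> and \<psi> :: "nat \<Rightarrow> 'g \<Rightarrow> complex"
    assume \<sigma>: "bij_betw \<sigma> {1..q - 1} (Sig D)"
      and \<Omega>: "\<forall>j\<in>{1..q - 1}. \<Omega> j = coset (\<sigma> j) (annihilator H)"
      and "\<forall>j\<in>{1..q - 1}. \<forall>x. \<psi> j x = (LINT \<gamma>|\<nu>. indicator (\<Omega> j) \<gamma> * pairing x \<gamma>)"
    \<comment> \<open>The inversion integral identifies each given function with an atom at every
      point, so the results about atoms apply without exceptional sets.\<close>
    then have \<psi>: "\<psi> j = atom \<sigma> j H" if "j \<in> {1..q - 1}" for j
      using that by (auto simp: atom_H_eq_integral[OF D \<sigma>])
    show "\<forall>j\<in>{1..q - 1}. \<psi> j \<in> L2 \<mu> \<and>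
        (\<forall>f\<in>L2 \<mu>. (AE \<gamma> in \<nu>. fourier_L2 \<mu> \<nu> f \<gamma> = indicator (\<Omega> j) \<gamma>) \<longleftrightarrow> (AE x in \<mu>. f x = \<psi> j x))"
      using atom_L12(2)[OF D \<sigma>, of _ 0] \<Omega> \<psi> fourier_L2_atom_H[OF D \<sigma>] by (auto simp: coset_0_H[OF D \<sigma>])
    show "wavelet_generators \<mu> \<nu> H D (range (aut_power A\<^sub>1)) (q - 1) \<psi>"
      by (rule wavelet_generators_atom[OF D \<sigma> \<psi>])
    show "\<forall>j\<in>{1..q - 1}. \<forall>x. \<psi> j x = pairing x (\<sigma> j) * indicator H x"
      using \<psi> by (simp add: atom_def[OF D \<sigma>])
    show "\<forall>j\<in>{1..q - 1}. \<forall>c. open (coset c (K 1)) \<and> \<psi> j constant_on coset c (K 1)"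
      using \<psi> atom_constant_on[OF D \<sigma>] open_coset[OF open_K] by simp
  qed
qed

end
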